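(* There is a function $N:(0,1)\to\mathbb{N}$ with the following property. For every $\epsilon\in(0,1)$, every $n\ge1$, and all continuous distributions $\mathcal{D}_1,\ldots,\mathcal{D}_n$ on $\mathbb{R}$, there is an algorithm for the secretary problem with distributions $\mathcal{D}_1,\ldots,\mathcal{D}_n$ that succeeds with probability at least $\gamma-\epsilon$. The algorithm is given $N(\epsilon)$ independent samples from each $\mathcal{D}_i$ and no other knowledge of the distributions. Here $N(\epsilon)$ does not depend on $n$, and $\gamma=(e^c-c-1)\int_c^\infty \frac{e^{-x}}{x}\,dx+e^{-c}\approx0.5801$, where $c>0$ solves $\int_0^c\frac{e^x-1}{x}\,dx=1$.
   Context: The secretary problem with distributions: independent random variables $X_1,\ldots,X_n$ are drawn, $X_i\sim\mathcal{D}_i$, independently of the samples. They are presented one at a time in a uniformly random order. After each observation the algorithm must irrevocably decide whether to accept the current value, and it may accept at most one value. It succeeds if the accepted value equals $\max_k X_k$. The success probability is over the samples, the draws, the random order, and any internal randomness of the algorithm. The constant $\gamma$ equals the limiting (as $n\to\infty$) optimal success probability in the case where the $X_i$ are i.i.d. from a single known continuous distribution. *)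

theory Defs
  imports "HOL-Probability.Probability" "HOL-Combinatorics.Permutations"
begin

section \<open>The constant\<close>

text \<open>At \<open>x = 0\<close> the integrand below takes the junk value \<open>0 / 0 = 0\<close>, which does not affect
  the integral.\<close>

definition c_opt :: real where
  "c_opt = (THE c. c > 0 \<and> integral {0..c} (\<lambda>x. (exp x - 1) / x) = 1)"

definition gamma_opt :: real where
  "gamma_opt = (exp c_opt - c_opt - 1) * integral {c_opt..} (\<lambda>x. exp (- x) / x) + exp (- c_opt)"

text \<open>The definite description is proper.\<close>

lemma ex1_c_opt: "\<exists>!c::real. c > 0 \<and> integral {0..c} (\<lambda>x. (exp x - 1) / x) = 1"
proof -
  define f where "f = (\<lambda>x::real. (exp x - 1) / x)"
  define g where "g = (\<lambda>x::real. if x = 0 then 1 else (exp x - 1) / x)"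
  have lim: "(f \<longlongrightarrow> 1) (at 0)"
    using DERIV_exp[of "0::real"] by (simp add: f_def DERIV_def)
  have contg: "isCont g x" for x
  proof (cases "x = 0")
    case True
    have "(g \<longlongrightarrow> 1) (at 0)"
      using lim by (rule Lim_transform_eventually) (auto simp: eventually_at_filter f_def g_def)
    then show ?thesis using True by (simp add: isCont_def g_def)
  next
    case False
    have "isCont f x" using False unfolding f_def by (intro continuous_intros) auto
    moreover have "eventually (\<lambda>y. f y = g y) (nhds x)"
      using False by (intro eventually_mono[OF t1_space_nhds[of x 0]]) (auto simp: f_def g_def)
    ultimately show ?thesis using isCont_cong by blast
  qed
  have contS: "continuous_on S g" for S
    using contg by (simp add: continuous_at_imp_continuous_on)
  have intg: "g integrable_on {a..b}" for a b
    by (rule integrable_continuous_real[OF contS])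
  have g1: "g x \<ge> 1" if "x \<ge> 0" for x
    using that exp_ge_add_one_self[of x] by (auto simp: g_def field_simps)
  have eq: "integral {0..c} f = integral {0..c} g" for c
    by (rule integral_spike[of "{0}"]) (auto simp: f_def g_def)
  define G where "G = (\<lambda>c. integral {0..c} g)"
  have contG: "continuous_on {0..1} G"
    unfolding G_def by (rule indefinite_integral_continuous_1[OF intg])
  have incr: "b - a \<le> G b - G a" if "0 \<le> a" "a \<le> b" for a b
  proof -
    have "G a + integral {a..b} g = G b"
      unfolding G_def using that by (intro Henstock_Kurzweil_Integration.integral_combine intg) auto
    moreover have "integral {a..b} (\<lambda>_. 1::real) \<le> integral {a..b} g"
      using that g1 by (intro integral_le intg) auto
    ultimately show ?thesis using that by simp
  qed
  have G0: "G 0 = 0" by (simp add: G_def)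
  have "G 1 \<ge> 1" using incr[of 0 1] G0 by simp
  then obtain c where c: "0 \<le> c" "c \<le> 1" "G c = 1"
    using IVT'[of G 0 1 1] contG G0 by auto
  have "c > 0" using c G0 by (cases "c = 0") auto
  moreover have "d = c" if "d > 0" "G d = 1" for d
    using incr[of c d] incr[of d c] that c by linarith
  ultimately have "\<exists>!c. c > 0 \<and> G c = 1" using c by blast
  then show ?thesis using eq by (simp add: G_def f_def)
qed

section \<open>The secretary problem with sampled distributions\<close>

text \<open>Values are indexed by \<open>{..<n}\<close> and time steps run from \<open>0\<close> to \<open>n - 1\<close>; the value shown at
  time \<open>t\<close> is \<open>x (\<sigma> t)\<close>, where \<open>\<sigma>\<close> is the presentation order.\<close>

text \<open>A continuous distribution is a probability measure on the reals with a continuous distribution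
  function; it need not have a density.\<close>

definition continuous_distribution :: "real measure \<Rightarrow> bool" where
  "continuous_distribution D \<longleftrightarrow> real_distribution D \<and> continuous_on UNIV (cdf D)"

text \<open>The internal randomness of an algorithm is a sequence of independent uniform variables
  on \<open>[0, 1]\<close>.\<close>

definition random_source :: "(nat \<Rightarrow> real) measure" where
  "random_source = (\<Pi>\<^sub>M k\<in>UNIV. uniform_measure lborel {0..1})"

text \<open>A decision rule \<open>A t r s h\<close> says whether to accept the value shown at time \<open>t\<close>, given the
  internal randomness \<open>r\<close>, the samples \<open>s\<close>, where \<open>s (i, j)\<close> is the \<open>j\<close>-th sample from the
  \<open>i\<close>-th distribution, and the values \<open>h 0, \<dots>, h t\<close> shown so far. Rules are only ever applied to
  a history \<open>h\<close> restricted to \<open>{..t}\<close>, so they cannot anticipate; nor do they see the indices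
  \<open>\<sigma> 0, \<dots>, \<sigma> t\<close> of the shown values.\<close>

type_synonym algorithm =
  "nat \<Rightarrow> (nat \<Rightarrow> real) \<Rightarrow> (nat \<times> nat \<Rightarrow> real) \<Rightarrow> (nat \<Rightarrow> real) \<Rightarrow> bool"

definition secretary_algorithm :: "nat \<Rightarrow> nat \<Rightarrow> algorithm \<Rightarrow> bool" where
  "secretary_algorithm n N A \<longleftrightarrow>
     (\<forall>t<n. Measurable.pred
        ((\<Pi>\<^sub>M k\<in>UNIV. borel) \<Otimes>\<^sub>M (\<Pi>\<^sub>M ij\<in>{..<n} \<times> {..<N}. borel) \<Otimes>\<^sub>M (\<Pi>\<^sub>M u\<in>{..t}. borel))
        (\<lambda>(r, s, h). A t r s h))"

definition accepts_at ::
  "algorithm \<Rightarrow> (nat \<Rightarrow> real) \<Rightarrow> (nat \<times> nat \<Rightarrow> real) \<Rightarrow> (nat \<Rightarrow> real) \<Rightarrow> nat \<Rightarrow> bool" where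
  "accepts_at A r s y t \<longleftrightarrow>
     A t r s (restrict y {..t}) \<and> (\<forall>u<t. \<not> A u r s (restrict y {..u}))"

definition succeeds ::
  "nat \<Rightarrow> algorithm \<Rightarrow> (nat \<Rightarrow> real) \<Rightarrow> (nat \<times> nat \<Rightarrow> real) \<Rightarrow> (nat \<Rightarrow> real) \<Rightarrow> (nat \<Rightarrow> nat) \<Rightarrow> bool"
where
  "succeeds n A r s x \<sigma> \<longleftrightarrow>
     (\<exists>t<n. accepts_at A r s (x \<circ> \<sigma>) t \<and> x (\<sigma> t) = Max (x ` {..<n}))"

text \<open>Internal randomness, samples, draws and presentation order, all independent.\<close>

definition secretary_space ::
  "nat \<Rightarrow> nat \<Rightarrow> (nat \<Rightarrow> real measure) \<Rightarrow>
    ((nat \<Rightarrow> real) \<times> (nat \<times> nat \<Rightarrow> real) \<times> (nat \<Rightarrow> real) \<times> (nat \<Rightarrow> nat)) measure" where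
  "secretary_space n N D =
     random_source \<Otimes>\<^sub>M (\<Pi>\<^sub>M (i, j)\<in>{..<n} \<times> {..<N}. D i) \<Otimes>\<^sub>M (\<Pi>\<^sub>M i\<in>{..<n}. D i)
       \<Otimes>\<^sub>M uniform_count_measure {\<sigma>. \<sigma> permutes {..<n}}"

definition success_prob :: "nat \<Rightarrow> nat \<Rightarrow> (nat \<Rightarrow> real measure) \<Rightarrow> algorithm \<Rightarrow> real" where
  "success_prob n N D A =
     measure (secretary_space n N D)
       {(r, s, x, \<sigma>) \<in> space (secretary_space n N D). succeeds n A r s x \<sigma>}"

end

theory Submission
  imports Defs "HOL-Real_Asymp.Real_Asymp"
begin

text \<open>The algorithm uses its internal randomness to give the \<open>n\<close> values independent uniform arrival
  times in \<open>[0, 1]\<close>: the value shown at step \<open>k\<close> arrives at the \<open>k\<close>-th smallest time. Let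
  \<open>Q = \<Prod>i. F i\<close> be the distribution function of the maximum and \<open>level T = exp (- c / (1 - T))\<close>. A
  record \<open>x\<close> arriving at time \<open>T\<close> is accepted iff \<open>level T \<le> Q' x\<close>, where \<open>Q'\<close> is the empirical
  distribution function of the \<open>N\<close> sampled maxima; since \<open>Q\<close> of the maximum is uniform, \<open>Q'\<close> is
  uniformly close to \<open>Q\<close> at a rate that depends on neither \<open>n\<close> nor the distributions.

  Acceptance is monotone in time and value, so the maximum, with value \<open>x\<close> and arrival time \<open>T\<close>, is
  accepted iff it is acceptable and the best of the earlier values was not acceptable when it arrived.
  That arrival time is uniform on \<open>[0, T]\<close> and independent of the value, so the conditional success
  probability is the average over \<open>s\<close> in \<open>[0, T]\<close> of the probability that no value before \<open>T\<close> is
  acceptable at time \<open>s\<close>. The latter is a product of convex combinations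
  \<open>(1 - T) * F l x + T * F l m\<close>, and weighted AM-GM bounds it below by \<open>(Q m / Q x) powr T\<close>, up to the
  factor \<open>\<Prod>l. F l x\<close>. What remains depends on the distributions only through \<open>Q\<close> of the maximum, and is
  the i.i.d. success probability, which a direct computation identifies with \<open>gamma_opt\<close>.\<close>

section \<open>The limiting success probability\<close>

text \<open>The curve \<open>level\<close> is the indifference curve of the i.i.d. problem in the
  limit. If a record with \<open>Q x = q\<close> arrives at time T, the number of later values
  beating it is Poisson with mean a = (1 - T) ln (1/q). Accepting wins with probability exp (- a).
  Skipping it and taking the first later value that beats it wins with the sum over k \<ge> 1 of exp
  (- a) a^k / (k! k), which is exp (- a) times the integral of (e^x - 1) / x over [0, a]. The two
  agree for a = \<open>c_opt\<close>, that is, for q = exp (- \<open>c_opt\<close> / (1 - T)). With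
  a sample size free of n, the individual \<open>F l\<close> are never estimated: the rule sees only
  the one-dimensional function \<open>Q\<close>, and the \<open>F l\<close> occur in the analysis
  alone. Continuous arrival times make the pairs of time and value independent, so probabilities
  factor over items. The sampling error becomes a margin \<delta> on both sides of
  \<open>level\<close>; the resulting bound is a function of \<delta> alone and tends to
  \<open>gamma_opt\<close>, so \<delta>, and then N, depend on \<epsilon> only.\<close>

lemma c_opt_pos: "c_opt > 0"
  and c_opt_integral: "integral {0..c_opt} (\<lambda>x. (exp x - 1) / x) = 1"
  using theI'[OF ex1_c_opt] unfolding c_opt_def by auto

text \<open>The value 0 from time 1 on is the left limit at 1 and keeps the curve antitone on the
  whole line, so that \<open>level_antimono\<close> compares arbitrary times.\<close>

definition level :: "real \<Rightarrow> real" where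
  "level T = (if T < 1 then exp (- (c_opt / (1 - T))) else 0)"

lemma level_antimono: "s \<le> t \<Longrightarrow> level t \<le> level s"
  using c_opt_pos by (auto simp: level_def frac_le)

lemma level_pos: "t < 1 \<Longrightarrow> 0 < level t" and level_nonneg: "0 \<le> level t"
  and level_less_1: "level t < 1"
  using c_opt_pos by (auto simp: level_def)

lemma level_strict_antimono: "s < t \<Longrightarrow> t < 1 \<Longrightarrow> level t < level s"
  using c_opt_pos by (auto simp: level_def frac_less2)

lemma borel_measurable_level[measurable]: "level \<in> borel_measurable borel"
  unfolding level_def[abs_def] by measurable

section \<open>Integrals attached to the constant\<close>

lemma nn_integral_c_opt:
  "(\<integral>\<^sup>+x. ennreal ((exp x - 1) / x) * indicator {0..c_opt} x \<partial>lborel) = 1"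
proof -
  \<comment> \<open>A Henstock-Kurzweil integral that fails to exist has the value 0; the value 1
    thus yields integrability.\<close>
  have "(\<lambda>x. (exp x - 1) / x) integrable_on {0..c_opt}"
    using c_opt_integral not_integrable_integral by fastforce
  then have "((\<lambda>x. (exp x - 1) / x) has_integral 1) {0..c_opt}"
    using c_opt_integral has_integral_integral by metis
  from nn_integral_has_integral_lebesgue'[OF _ this] show ?thesis by simp
qed

text \<open>The exponential integral E_1 at \<open>c_opt\<close>. In \<open>ennreal\<close> the
  later splittings are plain additivity; finiteness is settled once, in
  \<open>E_opt_eq\<close>.\<close>

definition E_opt :: ennreal where
  "E_opt = (\<integral>\<^sup>+x. ennreal (exp (- x) / x) * indicator {c_opt..} x \<partial>lborel)"

lemma E_opt_eq: "E_opt = ennreal (integral {c_opt..} (\<lambda>x. exp (- x) / x))"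
  and E_opt_nonneg: "0 \<le> integral {c_opt..} (\<lambda>x. exp (- x) / x)"
proof -
  define f where "f = (\<lambda>x. exp (- x) / x * indicator {c_opt..} x :: real)"
  have [measurable]: "f \<in> borel_measurable borel" unfolding f_def by measurable
  have nn: "f x \<ge> 0" for x using c_opt_pos by (auto simp: f_def indicator_def)
  have E: "E_opt = (\<integral>\<^sup>+x. f x \<partial>lborel)"
    unfolding E_opt_def f_def by (intro nn_integral_cong) (auto simp: indicator_def)
  have "(\<integral>\<^sup>+x. ennreal (exp (- x)) * indicator {c_opt..} x \<partial>lborel) = ennreal (0 - (- exp (- c_opt)))"
    by (rule nn_integral_FTC_atLeast[where F="\<lambda>x. - exp (- x)"])
       (auto intro!: derivative_eq_intros, real_asymp)
  moreover have "E_opt \<le> (\<integral>\<^sup>+x. ennreal (1/c_opt) * (ennreal (exp (- x)) * indicator {c_opt..} x) \<partial>lborel)"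
    unfolding E_opt_def using c_opt_pos
    by (intro nn_integral_mono) (auto simp: indicator_def ennreal_mult[symmetric] frac_le intro!: ennreal_leI)
  ultimately have "E_opt < \<top>"
    by (subst (asm) nn_integral_cmult)
       (auto simp: ennreal_mult[symmetric] c_opt_pos less_imp_le intro: le_less_trans)
  then obtain r where r: "r \<ge> 0" "E_opt = ennreal r"
    by (cases E_opt) auto
  then have "(f has_integral r) UNIV"
    using E nn by (intro nn_integral_has_integral) auto
  moreover have "f = (\<lambda>x. if x \<in> {c_opt..} then exp (- x) / x else 0)"
    by (auto simp: f_def)
  ultimately have "((\<lambda>x. exp (- x) / x) has_integral r) {c_opt..}"
    by (simp only: has_integral_restrict_UNIV)
  then have "integral {c_opt..} (\<lambda>x. exp (- x) / x) = r" by (rule integral_unique)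
  with r show "E_opt = ennreal (integral {c_opt..} (\<lambda>x. exp (- x) / x))"
    "0 \<le> integral {c_opt..} (\<lambda>x. exp (- x) / x)" by auto
qed

text \<open>Here T is the arrival time of the maximum, q the value of \<open>Q\<close> at it, s the
  arrival time of the best earlier value, and 1/T the density of s. The margin \<delta> is the
  sampling error: from \<open>level T + \<delta>\<close> on acceptance is certain, and up to
  \<open>level s - \<delta>\<close> rejection is certain. The outer \<open>min\<close> covers q
  below the rejection level, the inner \<open>max\<close> a negative one.\<close>

definition success_density :: "real \<Rightarrow> real \<Rightarrow> real \<Rightarrow> real \<Rightarrow> real" where
  "success_density \<delta> T s q =
     (if 0 < s \<and> s < T \<and> T < 1 \<and> level T + \<delta> \<le> q \<and> q \<le> 1
      then min 1 (max 0 (level s - \<delta>) / q) powr T / T else 0)"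

definition success_bound :: "real \<Rightarrow> ennreal" where
  "success_bound \<delta> = (\<integral>\<^sup>+T. \<integral>\<^sup>+s. \<integral>\<^sup>+q. ennreal (success_density \<delta> T s q) \<partial>lborel \<partial>lborel \<partial>lborel)"

text \<open>The inequality at \<open>level T\<close> is strict because every positive margin
  excludes q = \<open>level T\<close>; this gives convergence at every point.\<close>

definition limit_density :: "real \<Rightarrow> real \<Rightarrow> real \<Rightarrow> real" where
  "limit_density T s q =
     (if 0 < s \<and> s < T \<and> T < 1 \<and> level T < q \<and> q \<le> 1
      then min 1 (level s / q) powr T / T else 0)"

lemma measurable_success_density[measurable (raw)]:
  assumes [measurable]: "f \<in> borel_measurable M" "g \<in> borel_measurable M" "h \<in> borel_measurable M"
  shows "(\<lambda>x. success_density \<delta> (f x) (g x) (h x)) \<in> borel_measurable M"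
  unfolding success_density_def by measurable

lemma success_density_antimono:
  assumes "0 \<le> \<delta>" "\<delta> \<le> \<delta>'"
  shows "success_density \<delta>' T s q \<le> success_density \<delta> T s q"
proof (cases "0 < s \<and> s < T \<and> T < 1 \<and> level T + \<delta>' \<le> q \<and> q \<le> 1")
  case True
  then have "0 < q" using level_pos[of T] assms by linarith
  have "min 1 (max 0 (level s - \<delta>') / q) powr T / T \<le> min 1 (max 0 (level s - \<delta>) / q) powr T / T"
    using True \<open>0 < q\<close> assms divide_right_mono[of "max 0 (level s - \<delta>')" "max 0 (level s - \<delta>)" q]
    by (intro divide_right_mono powr_mono2 min.mono) auto
  then show ?thesis using True assms by (auto simp: success_density_def)
qed (auto simp: success_density_def)

lemma success_density_tendsto:
  assumes d: "d \<longlonglongrightarrow> 0" "\<And>k. d k > 0"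
  shows "(\<lambda>k. success_density (d k) T s q) \<longlonglongrightarrow> limit_density T s q"
proof (cases "0 < s \<and> s < T \<and> T < 1 \<and> level T < q \<and> q \<le> 1")
  case True
  have "q > 0" using True level_pos[of T] by linarith
  have "(\<lambda>k. level T + d k) \<longlonglongrightarrow> level T + 0" by (intro tendsto_intros d)
  then have "eventually (\<lambda>k. level T + d k < q) sequentially"
    using True by (intro order_tendstoD) auto
  then have ev: "eventually (\<lambda>k. min 1 (max 0 (level s - d k) / q) powr T / T = success_density (d k) T s q) sequentially"
    by eventually_elim (use True in \<open>auto simp: success_density_def\<close>)
  have "(\<lambda>k. min 1 (max 0 (level s - d k) / q) powr T / T) \<longlonglongrightarrow> min 1 (max 0 (level s - 0) / q) powr T / T"
    using True \<open>q > 0\<close> by (intro tendsto_intros d) auto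
  also have "min 1 (max 0 (level s - 0) / q) powr T / T = limit_density T s q"
    using True level_nonneg[of s] by (simp add: limit_density_def)
  finally show ?thesis using ev by (rule Lim_transform_eventually)
next
  case False
  then have "\<not> (0 < s \<and> s < T \<and> T < 1 \<and> level T + d k \<le> q \<and> q \<le> 1)" for k
    using d(2)[of k] by linarith
  then have "success_density (d k) T s q = 0" for k
    unfolding success_density_def by (intro if_not_P)
  moreover have "limit_density T s q = 0"
    unfolding limit_density_def using False by (intro if_not_P)
  ultimately show ?thesis by simp
qed

text \<open>The integrand increases as the margin shrinks, so monotone convergence moves the
  supremum out of the three integrals one after the other.\<close>

lemma SUP_success_bound:
  assumes d: "d \<longlonglongrightarrow> 0" "\<And>k. d k > 0" "decseq d"
  shows "(SUP k. success_bound (d k)) =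
    (\<integral>\<^sup>+T. \<integral>\<^sup>+s. \<integral>\<^sup>+q. ennreal (limit_density T s q) \<partial>lborel \<partial>lborel \<partial>lborel)"
proof -
  have mono: "ennreal (success_density (d k) T s q) \<le> ennreal (success_density (d l) T s q)" if "k \<le> l" for k l T s q
    using d that by (intro ennreal_leI success_density_antimono) (auto simp: decseq_def less_imp_le)
  have lim: "(SUP k. ennreal (success_density (d k) T s q)) = ennreal (limit_density T s q)" for T s q
  proof (rule LIMSEQ_unique)
    show "(\<lambda>k. ennreal (success_density (d k) T s q)) \<longlonglongrightarrow> (SUP k. ennreal (success_density (d k) T s q))"
      by (rule LIMSEQ_SUP) (auto simp: incseq_def mono)
    show "(\<lambda>k. ennreal (success_density (d k) T s q)) \<longlonglongrightarrow> ennreal (limit_density T s q)"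
      by (intro tendsto_ennrealI success_density_tendsto d)
  qed
  have "(\<integral>\<^sup>+T. \<integral>\<^sup>+s. \<integral>\<^sup>+q. ennreal (limit_density T s q) \<partial>lborel \<partial>lborel \<partial>lborel) =
      (\<integral>\<^sup>+T. \<integral>\<^sup>+s. \<integral>\<^sup>+q. (SUP k. ennreal (success_density (d k) T s q)) \<partial>lborel \<partial>lborel \<partial>lborel)"
    by (simp add: lim)
  also have "\<dots> = (\<integral>\<^sup>+T. \<integral>\<^sup>+s. (SUP k. \<integral>\<^sup>+q. ennreal (success_density (d k) T s q) \<partial>lborel) \<partial>lborel \<partial>lborel)"
    by (intro nn_integral_cong nn_integral_monotone_convergence_SUP) (auto simp: incseq_def le_fun_def mono)
  also have "\<dots> = (\<integral>\<^sup>+T. (SUP k. \<integral>\<^sup>+s. \<integral>\<^sup>+q. ennreal (success_density (d k) T s q) \<partial>lborel \<partial>lborel) \<partial>lborel)"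
    by (intro nn_integral_cong nn_integral_monotone_convergence_SUP)
       (auto simp: incseq_def le_fun_def intro!: nn_integral_mono mono)
  also have "\<dots> = (SUP k. success_bound (d k))"
    unfolding success_bound_def
    by (intro nn_integral_monotone_convergence_SUP)
       (auto simp: incseq_def le_fun_def intro!: nn_integral_mono mono)
  finally show ?thesis ..
qed

text \<open>The minimum is 1 up to q = \<open>level s\<close>, which gives the first summand; beyond
  that point the integrand is a multiple of q^(-T), with antiderivative q^(1 - T) / (1 - T) up to
  the factor.\<close>

lemma nn_integral_limit_density:
  assumes "0 < s" "s < T" "T < 1"
  shows "(\<integral>\<^sup>+q. ennreal (limit_density T s q) \<partial>lborel) =
    ennreal ((level s - level T) / T + (level s powr T - level s) / (T * (1 - T)))"
proof -
  have lv: "0 < level T" "level T < level s" "level s < 1"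
    using assms level_pos level_strict_antimono level_less_1 by auto
  have 1: "(\<integral>\<^sup>+q. ennreal (1 / T) * indicator {level T..level s} q \<partial>lborel) = ennreal ((level s - level T) / T)"
    using lv assms by (simp add: nn_integral_cmult ennreal_mult[symmetric])
  have F: "(\<integral>\<^sup>+q. ennreal ((level s / q) powr T / T) * indicator {level s..1} q \<partial>lborel)
     = ennreal (level s powr T * 1 powr (1 - T) / (T * (1 - T)) - level s powr T * level s powr (1 - T) / (T * (1 - T)))"
  proof (rule nn_integral_FTC_Icc[where F="\<lambda>q. level s powr T * q powr (1 - T) / (T * (1 - T))"])
    fix q assume q: "q \<in> {level s..1}"
    then have "q > 0" using lv by auto
    have "((\<lambda>q. level s powr T * q powr (1 - T) / (T * (1 - T))) has_real_derivative
       level s powr T * ((1 - T) * q powr (1 - T - 1)) / (T * (1 - T))) (at q)"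
      using \<open>q > 0\<close> by (intro derivative_intros DERIV_cdivide DERIV_cmult has_real_derivative_powr) auto
    also have "level s powr T * ((1 - T) * q powr (1 - T - 1)) / (T * (1 - T)) = (level s / q) powr T / T"
      using assms lv \<open>q > 0\<close> by (simp add: powr_divide powr_minus field_simps)
    finally show "((\<lambda>q. level s powr T * q powr (1 - T) / (T * (1 - T))) has_real_derivative (level s / q) powr T / T) (at q)" .
  qed (use lv assms in auto)
  have eq: "level s powr T * 1 powr (1 - T) / (T * (1 - T)) - level s powr T * level s powr (1 - T) / (T * (1 - T))
     = (level s powr T - level s) / (T * (1 - T))"
    using lv by (simp add: powr_add[symmetric] diff_divide_distrib)
  have 2: "(\<integral>\<^sup>+q. ennreal ((level s / q) powr T / T) * indicator {level s..1} q \<partial>lborel)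
     = ennreal ((level s powr T - level s) / (T * (1 - T)))"
    by (simp only: F eq)
  have le: "level s \<le> level s powr T"
    using powr_mono'[of T 1 "level s"] lv assms by auto
  have "(\<integral>\<^sup>+q. ennreal (limit_density T s q) \<partial>lborel) =
    (\<integral>\<^sup>+q. ennreal (1 / T) * indicator {level T..level s} q + ennreal ((level s / q) powr T / T) * indicator {level s..1} q \<partial>lborel)"
  proof (rule nn_integral_cong_AE)
    show "AE q in lborel. ennreal (limit_density T s q) =
       ennreal (1 / T) * indicator {level T..level s} q + ennreal ((level s / q) powr T / T) * indicator {level s..1} q"
      using AE_lborel_singleton[of "level T"] AE_lborel_singleton[of "level s"]
    proof eventually_elim
      case (elim q)
      consider "q < level T" | "level T < q" "q < level s" | "level s < q" "q \<le> 1" | "1 < q"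
        using elim by linarith
      then show ?case
        using lv assms by cases (auto simp: limit_density_def indicator_def min_def)
    qed
  qed
  also have "\<dots> = ennreal ((level s - level T) / T) + ennreal ((level s powr T - level s) / (T * (1 - T)))"
    by (subst nn_integral_add) (simp_all add: 1 2)
  also have "\<dots> = ennreal ((level s - level T) / T + (level s powr T - level s) / (T * (1 - T)))"
    using lv assms le by (intro ennreal_plus[symmetric]) auto
  finally show ?thesis .
qed

section \<open>Evaluating the triple integral\<close>

lemma nn_integral_lborel_swap:
  fixes f :: "real \<Rightarrow> real \<Rightarrow> ennreal"
  assumes "case_prod f \<in> borel_measurable (lborel \<Otimes>\<^sub>M lborel)"
  shows "(\<integral>\<^sup>+x. \<integral>\<^sup>+y. f x y \<partial>lborel \<partial>lborel) = (\<integral>\<^sup>+y. \<integral>\<^sup>+x. f x y \<partial>lborel \<partial>lborel)"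
  using lborel_pair.Fubini'[of f] assms by simp

lemma level_eq: "s < 1 \<Longrightarrow> level s = exp (- (c_opt / (1 - s)))"
  and level_powr: "s < 1 \<Longrightarrow> level s powr T = exp (- (T * c_opt / (1 - s)))"
  by (auto simp: level_def powr_def)

text \<open>The only place where the equation defining \<open>c_opt\<close> acts. With b = c / (1 -
  s) we have \<open>level s powr T\<close> = exp (- b T), and T = 1 - y / b turns the integrand into
  \<open>level s\<close> times (e^y - 1) / y, with y running exactly over (0, c).\<close>

lemma nn_integral_level_powr_diff:
  assumes s: "0 < s" "s < 1"
  shows "(\<integral>\<^sup>+T. ennreal (if s < T \<and> T < 1 then (level s powr T - level s) / (1 - T) else 0) \<partial>lborel)
    = ennreal (level s)"
proof -
  define b where "b = c_opt / (1 - s)"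
  have b: "b > 0" "b * (1 - s) = c_opt" using c_opt_pos s by (auto simp: b_def)
  have "(\<integral>\<^sup>+T. ennreal (if s < T \<and> T < 1 then (level s powr T - level s) / (1 - T) else 0) \<partial>lborel)
      = ennreal \<bar>- (1/b)\<bar> * (\<integral>\<^sup>+y. ennreal (if s < 1 + - (1/b) * y \<and> 1 + - (1/b) * y < 1 then
           (level s powr (1 + - (1/b) * y) - level s) / (1 - (1 + - (1/b) * y)) else 0) \<partial>lborel)"
    using b by (intro nn_integral_real_affine) auto
  also have "(\<integral>\<^sup>+y. ennreal (if s < 1 + - (1/b) * y \<and> 1 + - (1/b) * y < 1 then
           (level s powr (1 + - (1/b) * y) - level s) / (1 - (1 + - (1/b) * y)) else 0) \<partial>lborel)
     = (\<integral>\<^sup>+y. ennreal (b * level s) * (ennreal ((exp y - 1) / y) * indicator {0..c_opt} y) \<partial>lborel)"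
  proof (rule nn_integral_cong_AE)
    show "AE y in lborel. ennreal (if s < 1 + - (1/b) * y \<and> 1 + - (1/b) * y < 1 then
           (level s powr (1 + - (1/b) * y) - level s) / (1 - (1 + - (1/b) * y)) else 0)
       = ennreal (b * level s) * (ennreal ((exp y - 1) / y) * indicator {0..c_opt} y)"
      using AE_lborel_singleton[of "0::real"] AE_lborel_singleton[of c_opt]
    proof eventually_elim
      case (elim y)
      have 1: "1 + - (1/b) * y < 1 \<longleftrightarrow> 0 < y" using b by (simp add: field_simps)
      have 2: "s < 1 + - (1/b) * y \<longleftrightarrow> y < c_opt"
      proof -
        have "s < 1 + - (1/b) * y \<longleftrightarrow> y < b * (1 - s)" using b(1) by (simp add: field_simps)
        then show ?thesis unfolding b(2) .
      qed
      show ?case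
      proof (cases "0 < y \<and> y < c_opt")
        case True
        have "(1 + - (1/b) * y) * - b = - b + y" using b(1) by (simp add: field_simps)
        then have p: "level s powr (1 + - (1/b) * y) = level s * exp y"
          unfolding level_eq[OF s(2)] powr_def b_def[symmetric] by (simp add: exp_add[symmetric])
        have "(level s powr (1 + - (1/b) * y) - level s) / (1 - (1 + - (1/b) * y)) = (level s * (exp y - 1)) / (y / b)"
          unfolding p by (simp add: right_diff_distrib)
        also have "\<dots> = (b * level s) * ((exp y - 1) / y)" by simp
        finally have "(level s powr (1 + - (1/b) * y) - level s) / (1 - (1 + - (1/b) * y)) = (b * level s) * ((exp y - 1) / y)" .
        moreover have "0 \<le> b * level s" using b level_nonneg by simp
        moreover have "y \<in> {0..c_opt}" using True by auto
        ultimately show ?thesis using True 1 2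
          by (simp only: if_True simp_thms indicator_simps mult_1_right ennreal_mult'[symmetric])
      qed (use elim 1 2 in \<open>auto simp: indicator_def\<close>)
    qed
  qed
  also have "\<dots> = ennreal (b * level s)"
    by (subst nn_integral_cmult) (simp_all add: nn_integral_c_opt)
  finally show ?thesis using b by (simp add: ennreal_mult[symmetric] level_nonneg)
qed

text \<open>The substitution x = c T / (1 - s) turns \<open>level s powr T\<close> into exp (- x)
  and dT / T into dx / x. The condition s < T becomes s < x / (c + x), and T < 1 becomes 1 - c / x <
  s; after exchanging the integrals only the width of this range of s remains.\<close>

lemma nn_integral_level_powr:
  "(\<integral>\<^sup>+s. \<integral>\<^sup>+T. ennreal (if 0 < s \<and> s < T \<and> T < 1 then level s powr T / T else 0) \<partial>lborel \<partial>lborel)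
    = (\<integral>\<^sup>+x. ennreal (if 0 < x then exp (- x) / x * (x / (c_opt + x) - max 0 (1 - c_opt / x)) else 0) \<partial>lborel)"
proof -
  note c = c_opt_pos
  have "(\<integral>\<^sup>+T. ennreal (if 0 < s \<and> s < T \<and> T < 1 then level s powr T / T else 0) \<partial>lborel) =
        (\<integral>\<^sup>+x. ennreal (if 0 < x \<and> max 0 (1 - c_opt / x) < s \<and> s < x / (c_opt + x) then exp (- x) / x else 0) \<partial>lborel)" for s
  proof (cases "0 < s \<and> s < 1")
    case True
    define a where "a = (1 - s) / c_opt"
    have a: "a > 0" using True c by (auto simp: a_def)
    have "(\<integral>\<^sup>+T. ennreal (if 0 < s \<and> s < T \<and> T < 1 then level s powr T / T else 0) \<partial>lborel) =
       ennreal \<bar>a\<bar> * (\<integral>\<^sup>+x. ennreal (if 0 < s \<and> s < 0 + a * x \<and> 0 + a * x < 1 then level s powr (0 + a * x) / (0 + a * x) else 0) \<partial>lborel)"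
      using a by (intro nn_integral_real_affine) auto
    also have "\<dots> = (\<integral>\<^sup>+x. ennreal \<bar>a\<bar> * ennreal (if 0 < s \<and> s < 0 + a * x \<and> 0 + a * x < 1 then level s powr (0 + a * x) / (0 + a * x) else 0) \<partial>lborel)"
      by (rule nn_integral_cmult[symmetric]) auto
    also have "\<dots> = (\<integral>\<^sup>+x. ennreal (if 0 < x \<and> max 0 (1 - c_opt / x) < s \<and> s < x / (c_opt + x) then exp (- x) / x else 0) \<partial>lborel)"
    proof (rule nn_integral_cong)
      fix x :: real
      show "ennreal \<bar>a\<bar> * ennreal (if 0 < s \<and> s < 0 + a * x \<and> 0 + a * x < 1 then level s powr (0 + a * x) / (0 + a * x) else 0)
         = ennreal (if 0 < x \<and> max 0 (1 - c_opt / x) < s \<and> s < x / (c_opt + x) then exp (- x) / x else 0)"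
      proof (cases "0 < x")
        case x: True
        have 1: "s < a * x \<longleftrightarrow> s < x / (c_opt + x)" using x c by (simp add: a_def field_simps)
        have 2: "a * x < 1 \<longleftrightarrow> 1 - c_opt / x < s" using x c by (simp add: a_def field_simps)
        have 3: "level s powr (a * x) = exp (- x)"
          using True c by (simp add: level_powr a_def)
        show ?thesis
          using True x a 1 2 3 by (auto simp: ennreal_mult[symmetric])
      next
        case False
        then have "a * x \<le> 0" using a by (simp add: mult_nonneg_nonpos)
        then show ?thesis using False True by auto
      qed
    qed
    finally show ?thesis .
  next
    case False
    then have "\<not> (0 < x \<and> max 0 (1 - c_opt / x) < s \<and> s < x / (c_opt + x))" for x
      using c by (auto simp: field_simps) (smt (verit) mult_less_cancel_left1 mult_le_cancel_left1)
    moreover have "\<not> (0 < s \<and> s < T \<and> T < 1)" for T using False by auto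
    ultimately show ?thesis by (simp only: if_False)
  qed
  then have "(\<integral>\<^sup>+s. \<integral>\<^sup>+T. ennreal (if 0 < s \<and> s < T \<and> T < 1 then level s powr T / T else 0) \<partial>lborel \<partial>lborel)
    = (\<integral>\<^sup>+s. \<integral>\<^sup>+x. ennreal (if 0 < x \<and> max 0 (1 - c_opt / x) < s \<and> s < x / (c_opt + x) then exp (- x) / x else 0) \<partial>lborel \<partial>lborel)"
    by simp
  also have "\<dots> = (\<integral>\<^sup>+x. \<integral>\<^sup>+s. ennreal (if 0 < x \<and> max 0 (1 - c_opt / x) < s \<and> s < x / (c_opt + x) then exp (- x) / x else 0) \<partial>lborel \<partial>lborel)"
    by (rule nn_integral_lborel_swap) measurable
  also have "\<dots> = (\<integral>\<^sup>+x. ennreal (if 0 < x then exp (- x) / x * (x / (c_opt + x) - max 0 (1 - c_opt / x)) else 0) \<partial>lborel)"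
  proof (rule nn_integral_cong)
    fix x :: real
    show "(\<integral>\<^sup>+s. ennreal (if 0 < x \<and> max 0 (1 - c_opt / x) < s \<and> s < x / (c_opt + x) then exp (- x) / x else 0) \<partial>lborel)
      = ennreal (if 0 < x then exp (- x) / x * (x / (c_opt + x) - max 0 (1 - c_opt / x)) else 0)"
    proof (cases "0 < x")
      case True
      have le: "max 0 (1 - c_opt / x) \<le> x / (c_opt + x)"
        using True c by (auto simp: field_simps)
      have "(\<integral>\<^sup>+s. ennreal (if 0 < x \<and> max 0 (1 - c_opt / x) < s \<and> s < x / (c_opt + x) then exp (- x) / x else 0) \<partial>lborel)
        = (\<integral>\<^sup>+s. ennreal (exp (- x) / x) * indicator {max 0 (1 - c_opt / x) <..< x / (c_opt + x)} s \<partial>lborel)"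
        using True by (intro nn_integral_cong) (auto simp: indicator_def)
      also have "\<dots> = ennreal (exp (- x) / x) * ennreal (x / (c_opt + x) - max 0 (1 - c_opt / x))"
        using le by (simp add: nn_integral_cmult)
      finally show ?thesis using True le by (simp add: ennreal_mult[symmetric])
    qed simp
  qed
  finally show ?thesis .
qed

text \<open>With E the exponential integral at c, three linear relations determine the value R: R +
  X = e^c E (shift by c), X + Y = E, and Y + c E = e^(-c) (integration by parts). Hence R = e^c E -
  E + e^(-c) - c E.\<close>

lemma nn_integral_level_powr_eq_gamma:
  "(\<integral>\<^sup>+s. \<integral>\<^sup>+T. ennreal (if 0 < s \<and> s < T \<and> T < 1 then level s powr T / T else 0) \<partial>lborel \<partial>lborel)
    = ennreal gamma_opt" (is "?R = _")
proof -
  note c = c_opt_pos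
  define X Y where "X = (\<integral>\<^sup>+x. ennreal (exp (- x) / x * (1 - c_opt / x)) * indicator {c_opt..} x \<partial>lborel)"
    and "Y = (\<integral>\<^sup>+x. ennreal (c_opt * exp (- x) / x^2) * indicator {c_opt..} x \<partial>lborel)"
  have XY: "X + Y = E_opt"
    unfolding X_def Y_def E_opt_def using c
    by (subst nn_integral_add[symmetric])
       (auto intro!: nn_integral_cong simp: indicator_def field_simps power2_eq_square simp flip: ennreal_plus)
  have "(\<integral>\<^sup>+x. ennreal (c_opt * exp (- x) / x^2 + c_opt * (exp (- x) / x)) * indicator {c_opt..} x \<partial>lborel)
      = ennreal (0 - (- c_opt * exp (- c_opt) / c_opt))"
    by (rule nn_integral_FTC_atLeast[where F="\<lambda>x. - c_opt * exp (- x) / x"])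
       (use c in \<open>auto intro!: derivative_eq_intros simp: field_simps power2_eq_square\<close>, real_asymp)
  also have "(\<integral>\<^sup>+x. ennreal (c_opt * exp (- x) / x^2 + c_opt * (exp (- x) / x)) * indicator {c_opt..} x \<partial>lborel)
     = Y + ennreal c_opt * E_opt"
    unfolding Y_def E_opt_def using c
    by (subst nn_integral_cmult[symmetric], simp, subst nn_integral_add[symmetric])
       (auto intro!: nn_integral_cong simp: indicator_def ennreal_mult[symmetric] simp flip: ennreal_plus)
  finally have Y: "Y + ennreal c_opt * E_opt = ennreal (exp (- c_opt))" using c by simp
  \<comment> \<open>Adding \<open>X\<close> cancels the term 1 - c / x where it is positive, that is
    for x \<ge> c; the remaining width x / (c + x) times exp (- x) / x is exp (- x) / (c +
    x).\<close>
  have "?R + X = (\<integral>\<^sup>+x. ennreal (if 0 < x then exp (- x) / (c_opt + x) else 0) \<partial>lborel)"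
    unfolding nn_integral_level_powr X_def
  proof (subst nn_integral_add[symmetric], measurable, rule nn_integral_cong)
    fix x :: real
    have "1 - c_opt / x \<le> x / (c_opt + x)" if "x > 0"
      using that c by (auto simp: field_simps)
    moreover have "0 \<le> 1 - c_opt / x" if "x \<ge> c_opt" using that c by simp
    moreover have "1 - c_opt / x < 0" if "x < c_opt" "x > 0" using that c by simp
    moreover have "ennreal (p * (u - v)) + ennreal (p * v) = ennreal (p * u)" if "0 \<le> p" "0 \<le> v" "v \<le> u" for p u v :: real
      using that by (simp add: right_diff_distrib mult_left_mono flip: ennreal_plus)
    from this[of "exp (- x) / x" "1 - c_opt / x" "x / (c_opt + x)"]
    have "ennreal (exp (- x) / x * (x / (c_opt + x) - (1 - c_opt / x))) + ennreal (exp (- x) / x * (1 - c_opt / x))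
      = ennreal (exp (- x) / (c_opt + x))" if "x \<ge> c_opt"
      using that c calculation(1,2) by simp
    ultimately show "ennreal (if 0 < x then exp (- x) / x * (x / (c_opt + x) - max 0 (1 - c_opt / x)) else 0)
       + ennreal (exp (- x) / x * (1 - c_opt / x)) * indicator {c_opt..} x =
       ennreal (if 0 < x then exp (- x) / (c_opt + x) else 0)"
      using c by (cases "x \<ge> c_opt") (simp_all add: max_def)
  qed
  also have "\<dots> = ennreal \<bar>1\<bar> * (\<integral>\<^sup>+x. ennreal (if 0 < - c_opt + 1 * x then exp (- (- c_opt + 1 * x)) / (c_opt + (- c_opt + 1 * x)) else 0) \<partial>lborel)"
    by (rule nn_integral_real_affine) auto
  also have "\<dots> = (\<integral>\<^sup>+x. ennreal (exp c_opt) * (ennreal (exp (- x) / x) * indicator {c_opt..} x) \<partial>lborel)"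
  proof -
    have "AE x in lborel. ennreal (if 0 < - c_opt + 1 * x then exp (- (- c_opt + 1 * x)) / (c_opt + (- c_opt + 1 * x)) else 0)
       = ennreal (exp c_opt) * (ennreal (exp (- x) / x) * indicator {c_opt..} x)"
      using AE_lborel_singleton[of c_opt]
    proof eventually_elim
      case (elim x)
      have "exp (- (- c_opt + 1 * x)) = exp c_opt * exp (- x)"
        by (simp flip: exp_add)
      then show ?case using elim c by (auto simp: indicator_def ennreal_mult'[symmetric])
    qed
    then show ?thesis by (simp only: abs_one ennreal_1 mult_1_left) (rule nn_integral_cong_AE)
  qed
  also have "\<dots> = ennreal (exp c_opt) * E_opt"
    unfolding E_opt_def by (rule nn_integral_cmult) auto
  finally have R: "?R + X = ennreal (exp c_opt) * E_opt" .
  define e where "e = integral {c_opt..} (\<lambda>x. exp (- x) / x)"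
  have e: "E_opt = ennreal e" "e \<ge> 0" using E_opt_eq E_opt_nonneg by (auto simp: e_def)
  have "R = ennreal gamma_opt" if R: "R + X = ennreal (exp c_opt) * E_opt" for R
  proof -
    \<comment> \<open>Subtraction in \<open>ennreal\<close> is truncated, so the relations are
      solved over the reals once every part is known to be finite.\<close>
    have "X + Y \<noteq> \<top>" "R + X \<noteq> \<top>" unfolding XY R e(1) by (simp_all add: ennreal_mult_eq_top_iff)
    then have "X \<noteq> \<top>" "Y \<noteq> \<top>" "R \<noteq> \<top>" by (simp_all add: ennreal_add_eq_top)
    then obtain x y r where xyr: "X = ennreal x" "Y = ennreal y" "R = ennreal r" "x \<ge> 0" "y \<ge> 0" "r \<ge> 0"
      by (metis ennreal_cases)
    have "x + y = e" "y + c_opt * e = exp (- c_opt)" "r + x = exp c_opt * e"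
      using XY Y R c unfolding e(1) xyr(1-3)
      by (simp_all add: e xyr ennreal_mult[symmetric] flip: ennreal_plus)
    then have "r = gamma_opt"
      unfolding gamma_opt_def e_def[symmetric] by (simp add: algebra_simps)
    with xyr show ?thesis by simp
  qed
  from this[OF R] show ?thesis .
qed

text \<open>Adding \<open>level T / T\<close> to the integrand splits it into a part that integrates to \<open>gamma_opt\<close> and a part
  that, by the equation defining \<open>c_opt\<close>, has the same integral as the term added.\<close>

lemma nn_integral_limit_density_eq_gamma:
  "(\<integral>\<^sup>+T. \<integral>\<^sup>+s. \<integral>\<^sup>+q. ennreal (limit_density T s q) \<partial>lborel \<partial>lborel \<partial>lborel) = ennreal gamma_opt"
  (is "?P = _")
proof -
  define ind where "ind T s r = (if 0 < s \<and> s < T \<and> T < 1 then r else 0)" for T s r :: real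
  have [measurable]: "(\<lambda>x. ind (f x) (g x) (h x)) \<in> borel_measurable M"
    if [measurable]: "f \<in> borel_measurable M" "g \<in> borel_measurable M" "h \<in> borel_measurable M" for f g h and M :: "'a measure"
    unfolding ind_def by measurable
  have P: "(\<integral>\<^sup>+q. ennreal (limit_density T s q) \<partial>lborel) =
     ennreal (ind T s ((level s - level T) / T + (level s powr T - level s) / (T * (1 - T))))" for T s
  proof (cases "0 < s \<and> s < T \<and> T < 1")
    case False
    then have "limit_density T s q = 0" for q by (auto simp: limit_density_def)
    with False show ?thesis by (auto simp: ind_def)
  qed (simp add: ind_def nn_integral_limit_density)
  \<comment> \<open>\<open>K\<close> is the common value of the added term and of the leftover; it
    is finite, so it can be cancelled at the end.\<close>
  define K where "K = (\<integral>\<^sup>+s. ennreal (if 0 < s \<and> s < 1 then level s else 0) \<partial>lborel)"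
  have "K \<le> (\<integral>\<^sup>+s. indicator {0..1::real} s \<partial>lborel)"
    unfolding K_def using level_less_1 by (intro nn_integral_mono) (auto simp: indicator_def less_imp_le)
  then have K: "K \<noteq> \<top>" by (auto simp: top_unique)
  have K1: "(\<integral>\<^sup>+T. \<integral>\<^sup>+s. ennreal (ind T s (level T / T)) \<partial>lborel \<partial>lborel) = K"
    unfolding K_def
  proof (rule nn_integral_cong)
    fix T :: real
    have "(\<integral>\<^sup>+s. ennreal (ind T s (level T / T)) \<partial>lborel) =
      (\<integral>\<^sup>+s. ennreal (if T < 1 then level T / T else 0) * indicator {0<..<T} s \<partial>lborel)"
      by (intro nn_integral_cong) (auto simp: ind_def indicator_def)
    then show "(\<integral>\<^sup>+s. ennreal (ind T s (level T / T)) \<partial>lborel) = ennreal (if 0 < T \<and> T < 1 then level T else 0)"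
      by (cases "0 < T") (auto simp: nn_integral_cmult ennreal_mult[symmetric] level_nonneg)
  qed
  have K2: "(\<integral>\<^sup>+T. \<integral>\<^sup>+s. ennreal (ind T s ((level s powr T - level s) / (1 - T))) \<partial>lborel \<partial>lborel) = K"
  proof -
    have "(\<integral>\<^sup>+T. \<integral>\<^sup>+s. ennreal (ind T s ((level s powr T - level s) / (1 - T))) \<partial>lborel \<partial>lborel) =
          (\<integral>\<^sup>+s. \<integral>\<^sup>+T. ennreal (ind T s ((level s powr T - level s) / (1 - T))) \<partial>lborel \<partial>lborel)"
      by (rule nn_integral_lborel_swap) measurable
    also have "\<dots> = K" unfolding K_def
    proof (rule nn_integral_cong)
      fix s :: real
      show "(\<integral>\<^sup>+T. ennreal (ind T s ((level s powr T - level s) / (1 - T))) \<partial>lborel) = ennreal (if 0 < s \<and> s < 1 then level s else 0)"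
      proof (cases "0 < s \<and> s < 1")
        case True
        then show ?thesis using nn_integral_level_powr_diff[of s] by (simp add: ind_def)
      next
        case False
        then have "ind T s r = 0" for T r by (auto simp: ind_def)
        then show ?thesis using False by auto
      qed
    qed
    finally show ?thesis .
  qed
  have R: "(\<integral>\<^sup>+T. \<integral>\<^sup>+s. ennreal (ind T s (level s powr T / T)) \<partial>lborel \<partial>lborel) = ennreal gamma_opt"
    unfolding nn_integral_level_powr_eq_gamma[symmetric] ind_def
    by (rule nn_integral_lborel_swap) measurable
  have eq: "ennreal (ind T s ((level s - level T) / T + (level s powr T - level s) / (T * (1 - T)))) + ennreal (ind T s (level T / T))
    = ennreal (ind T s (level s powr T / T)) + ennreal (ind T s ((level s powr T - level s) / (1 - T)))" for T s
  proof (cases "0 < s \<and> s < T \<and> T < 1")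
    case True
    then have lv: "0 < level T" "level T < level s" "level s < 1"
      using level_pos level_strict_antimono level_less_1 by auto
    have le: "level s \<le> level s powr T"
      using powr_mono'[of T 1 "level s"] lv True by auto
    \<comment> \<open>Partial fractions: 1 / (T (1 - T)) = 1 / T + 1 / (1 - T), after which the
      terms \<open>level s / T\<close> and \<open>level T / T\<close> cancel.\<close>
    have "(level s - level T) / T + (level s powr T - level s) / (T * (1 - T)) + level T / T =
       level s powr T / T + (level s powr T - level s) / (1 - T)"
      using True by (simp add: field_simps)
    then show ?thesis using True lv le by (simp add: ind_def flip: ennreal_plus)
  qed (auto simp: ind_def)
  have "?P + K = (\<integral>\<^sup>+T. \<integral>\<^sup>+s. ennreal (ind T s ((level s - level T) / T + (level s powr T - level s) / (T * (1 - T)))) + ennreal (ind T s (level T / T)) \<partial>lborel \<partial>lborel)"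
    unfolding P K1[symmetric] by (simp add: nn_integral_add)
  also have "\<dots> = ennreal gamma_opt + K"
    unfolding eq R[symmetric] K2[symmetric] by (simp add: nn_integral_add)
  finally show ?thesis using K by (simp add: add.commute ennreal_add_left_cancel)
qed

section \<open>Choosing the margin\<close>

lemma gamma_opt_nonneg: "0 \<le> gamma_opt"
proof -
  have "c_opt + 1 \<le> exp c_opt" using exp_ge_add_one_self[of c_opt] by (simp add: add.commute)
  then show ?thesis using E_opt_nonneg by (auto simp: gamma_opt_def intro!: add_nonneg_nonneg mult_nonneg_nonneg)
qed

text \<open>\<open>success_bound\<close> mentions neither n nor any distribution, so \<delta>
  depends on \<epsilon> alone; this is the source of a sample size that is uniform in n.\<close>

lemma success_bound_approx:
  assumes "\<epsilon> > 0"
  shows "\<exists>\<delta>>0. ennreal (gamma_opt - \<epsilon>) \<le> success_bound \<delta>"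
proof (cases "gamma_opt - \<epsilon> \<le> 0")
  case True
  then show ?thesis by (intro exI[of _ 1]) (auto simp: ennreal_neg)
next
  case False
  have "(\<lambda>k. 1 / real (Suc k)) \<longlonglongrightarrow> 0" by real_asymp
  then have "(SUP k. success_bound (1 / real (Suc k))) = ennreal gamma_opt"
    by (subst SUP_success_bound)
       (auto simp: nn_integral_limit_density_eq_gamma decseq_def frac_le)
  moreover have "ennreal (gamma_opt - \<epsilon>) < ennreal gamma_opt"
    using assms False by (intro ennreal_lessI) auto
  ultimately have "ennreal (gamma_opt - \<epsilon>) < (SUP k. success_bound (1 / real (Suc k)))"
    by (simp only:)
  then obtain k where "ennreal (gamma_opt - \<epsilon>) < success_bound (1 / real (Suc k))"
    unfolding less_SUP_iff by blast
  moreover have "1 / real (Suc k) > 0" by simp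
  ultimately show ?thesis using less_imp_le by blast
qed

section \<open>Products of continuous distributions\<close>

abbreviation uniform01 :: "real measure" where
  "uniform01 \<equiv> uniform_measure lborel {0..1}"

lemma prob_space_uniform01: "prob_space uniform01"
  by (intro prob_space_uniform_measure) auto

lemma measurable_of_bool_ennreal[measurable (raw)]:
  "Measurable.pred M P \<Longrightarrow> (\<lambda>x. of_bool (P x) :: ennreal) \<in> borel_measurable M"
  unfolding of_bool_def by measurable

lemma prod_of_bool: "finite J \<Longrightarrow> (\<Prod>l\<in>J. of_bool (p l)) = (of_bool (\<forall>l\<in>J. p l) :: 'a :: comm_semiring_1)"
  by (induction J rule: finite_induct) auto

lemma nn_integral_uniform01:
  assumes [measurable]: "f \<in> borel_measurable borel"
  shows "(\<integral>\<^sup>+x. f x \<partial>uniform01) = (\<integral>\<^sup>+x. f x * indicator {0..1} x \<partial>lborel)"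
  by (subst nn_integral_uniform_measure) (auto simp: divide_ennreal_def)

lemma prob_space_pair:
  assumes "prob_space M" "prob_space N"
  shows "prob_space (M \<Otimes>\<^sub>M N)"
proof -
  interpret M: prob_space M by fact
  interpret N: prob_space N by fact
  interpret pair_prob_space M N ..
  show ?thesis by (rule P.prob_space_axioms)
qed

text \<open>Boxes with arbitrary measurable sides in the pair spaces determine a finite product, and
  on a box both measures factor over the index by Fubini. This regroups all times and all values
  into independent pairs.\<close>

lemma distr_PiM_pair:
  assumes I: "finite I" and M: "\<And>i. prob_space (M i)" and N: "\<And>i. prob_space (N i)"
  shows "distr (PiM I M \<Otimes>\<^sub>M PiM I N) (PiM I (\<lambda>i. M i \<Otimes>\<^sub>M N i)) (\<lambda>(x, y). \<lambda>i\<in>I. (x i, y i))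
    = PiM I (\<lambda>i. M i \<Otimes>\<^sub>M N i)"
proof -
  interpret M: product_prob_space M I by (rule product_prob_spaceI) (rule M)
  interpret N: product_prob_space N I by (rule product_prob_spaceI) (rule N)
  interpret MN: product_prob_space "\<lambda>i. M i \<Otimes>\<^sub>M N i" I
    by (intro product_prob_spaceI prob_space_pair M N)
  show ?thesis
  proof (rule MN.PiM_eqI[OF I])
    fix A assume A: "\<And>i. i \<in> I \<Longrightarrow> A i \<in> sets (M i \<Otimes>\<^sub>M N i)"
    have [measurable]: "Pi\<^sub>E I A \<in> sets (PiM I (\<lambda>i. M i \<Otimes>\<^sub>M N i))"
      using A I by (intro sets_PiM_I_finite) auto
    have [measurable]: "(\<lambda>(x, y). \<lambda>i\<in>I. (x i, y i)) \<in> measurable (PiM I M \<Otimes>\<^sub>M PiM I N) (PiM I (\<lambda>i. M i \<Otimes>\<^sub>M N i))"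
      by (auto simp: case_prod_beta' intro!: measurable_restrict)
    let ?T = "distr (PiM I M \<Otimes>\<^sub>M PiM I N) (PiM I (\<lambda>i. M i \<Otimes>\<^sub>M N i)) (\<lambda>(x, y). \<lambda>i\<in>I. (x i, y i))"
    have "emeasure ?T (Pi\<^sub>E I A) = (\<integral>\<^sup>+w. indicator (Pi\<^sub>E I A) w \<partial>?T)"
      by simp
    also have "\<dots> = (\<integral>\<^sup>+z. indicator (Pi\<^sub>E I A) (case z of (x, y) \<Rightarrow> \<lambda>i\<in>I. (x i, y i)) \<partial>(PiM I M \<Otimes>\<^sub>M PiM I N))"
      by (rule nn_integral_distr) measurable
    also have "\<dots> = (\<integral>\<^sup>+x. \<integral>\<^sup>+y. indicator (Pi\<^sub>E I A) (\<lambda>i\<in>I. (x i, y i)) \<partial>PiM I N \<partial>PiM I M)"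
      by (subst sigma_finite_measure.nn_integral_fst[symmetric, OF prob_space_imp_sigma_finite[OF prob_space_PiM[OF N]]]) auto
    also have "\<dots> = (\<integral>\<^sup>+x. \<integral>\<^sup>+y. (\<Prod>i\<in>I. indicator (A i) (x i, y i)) \<partial>PiM I N \<partial>PiM I M)"
      using I by (intro nn_integral_cong) (auto simp: indicator_def PiE_iff prod_of_bool)
    also have "\<dots> = (\<integral>\<^sup>+x. (\<Prod>i\<in>I. \<integral>\<^sup>+y. indicator (A i) (x i, y) \<partial>N i) \<partial>PiM I M)"
      using I A by (intro nn_integral_cong N.product_nn_integral_prod)
         (auto simp: space_PiM PiE_iff intro!: borel_measurable_indicator' )
    also have "\<dots> = (\<Prod>i\<in>I. \<integral>\<^sup>+x. \<integral>\<^sup>+y. indicator (A i) (x, y) \<partial>N i \<partial>M i)"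
      using I A by (intro M.product_nn_integral_prod sigma_finite_measure.borel_measurable_nn_integral)
        (auto simp: prob_space_imp_sigma_finite N)
    also have "\<dots> = (\<Prod>i\<in>I. emeasure (M i \<Otimes>\<^sub>M N i) (A i))"
      using A by (intro prod.cong refl sigma_finite_measure.emeasure_pair_measure[symmetric])
        (auto simp: prob_space_imp_sigma_finite N)
    finally show "emeasure (distr (PiM I M \<Otimes>\<^sub>M PiM I N) (PiM I (\<lambda>i. M i \<Otimes>\<^sub>M N i)) (\<lambda>(x, y). \<lambda>i\<in>I. (x i, y i))) (Pi\<^sub>E I A)
       = (\<Prod>i\<in>I. emeasure (M i \<Otimes>\<^sub>M N i) (A i))" .
  qed simp
qed

text \<open>With the other coordinates fixed, coordinate i would have to hit one given number, a
  null event. The map f is general because the lemma serves both bare times (identity) and pairs of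
  time and value (\<open>snd\<close>).\<close>

lemma AE_PiM_distinct:
  fixes f :: "'a \<Rightarrow> real"
  assumes J: "finite J" and M: "\<And>i. prob_space (M i)" and f: "\<And>i. f \<in> borel_measurable (M i)"
    and ne: "\<And>i c. AE p in M i. f p \<noteq> c"
  shows "AE z in PiM J M. \<forall>i\<in>J. \<forall>j\<in>J. i \<noteq> j \<longrightarrow> f (z i) \<noteq> f (z j)"
proof (intro AE_finite_allI J)
  interpret product_prob_space M J by (rule product_prob_spaceI) (rule M)
  fix i j assume ij: "i \<in> J" "j \<in> J"
  show "AE z in PiM J M. i \<noteq> j \<longrightarrow> f (z i) \<noteq> f (z j)"
  proof (cases "i = j")
    case False
    have J_eq: "insert i (J - {i}) = J" using ij by auto
    have comp: "(\<lambda>z. f (z k)) \<in> borel_measurable (PiM J M)" if "k \<in> J" for k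
      using measurable_compose[OF measurable_component_singleton[OF that] f] .
    note [measurable] = borel_measurable_eq[OF comp[OF ij(1)] comp[OF ij(2)]]
    have meas: "(\<lambda>z. of_bool (f (z i) = f (z j)) :: ennreal) \<in> borel_measurable (PiM J M)"
      by measurable
    have "(\<integral>\<^sup>+z. of_bool (f (z i) = f (z j)) \<partial>PiM J M) =
      (\<integral>\<^sup>+z. \<integral>\<^sup>+p. of_bool (f p = f (z j)) \<partial>M i \<partial>PiM (J - {i}) M)"
      using product_nn_integral_insert[of "J - {i}" i "\<lambda>z. of_bool (f (z i) = f (z j))"] J False meas
      unfolding J_eq by simp
    also have "\<dots> = (\<integral>\<^sup>+z. 0 \<partial>PiM (J - {i}) M)"
    proof (intro nn_integral_cong)
      have [measurable]: "f \<in> borel_measurable (M i)" by (rule f)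
      show "(\<integral>\<^sup>+p. of_bool (f p = c) \<partial>M i) = 0" for c
        using ne[where i=i and c=c] by (subst nn_integral_0_iff_AE) (auto elim!: eventually_mono)
    qed
    finally have "(\<integral>\<^sup>+z. of_bool (f (z i) = f (z j)) \<partial>PiM J M) = 0" by simp
    then show ?thesis
      by (subst (asm) nn_integral_0_iff_AE[OF meas]) (auto elim!: eventually_mono)
  qed simp
qed

text \<open>If u or v is 0 the left side is 0, even for t = 0 or t = 1, because
  \<open>0 powr 0 = 0\<close>; otherwise this is Young's inequality.\<close>

lemma amgm_two_point:
  fixes u v t :: real
  assumes "0 \<le> u" "0 \<le> v" "0 \<le> t" "t \<le> 1"
  shows "u powr (1 - t) * v powr t \<le> (1 - t) * u + t * v"
proof (cases "u = 0 \<or> v = 0")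
  case True
  then show ?thesis using assms by auto
next
  case False
  with assms show ?thesis by (intro Youngs_inequality_0) auto
qed

text \<open>All indices are covered because \<open>product_prob_space\<close> takes a family over
  the whole index type; a family given below n only is extended by \<open>D 0\<close> at the very
  end.\<close>

locale continuous_distributions =
  fixes D :: "nat \<Rightarrow> real measure"
  assumes cont: "continuous_distribution (D i)"
begin

abbreviation F :: "nat \<Rightarrow> real \<Rightarrow> real" where "F i \<equiv> cdf (D i)"

lemma D_rd: "real_distribution (D i)"
  and F_cont: "continuous_on S (F i)"
  using cont[of i] continuous_on_subset by (auto simp: continuous_distribution_def)

lemma D_prob: "prob_space (D i)" and D_sets[measurable_cong, simp]: "sets (D i) = sets borel"
  and D_space[simp]: "space (D i) = UNIV"
proof -
  interpret real_distribution "D i" by (rule D_rd)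
  show "prob_space (D i)" "sets (D i) = sets borel" "space (D i) = UNIV"
    by (simp_all add: prob_space_axioms)
qed

lemma D_singleton: "emeasure (D i) {x} = 0"
proof -
  interpret real_distribution "D i" by (rule D_rd)
  have "isCont (F i) x" using F_cont[of UNIV i] by (simp add: continuous_on_eq_continuous_at)
  then show ?thesis by (simp add: isCont_cdf emeasure_eq_measure)
qed

lemma emeasure_D_less: "emeasure (D i) {y. y < x} = F i x"
  and emeasure_D_le: "emeasure (D i) {y. y \<le> x} = F i x"
proof -
  interpret real_distribution "D i" by (rule D_rd)
  show le: "emeasure (D i) {y. y \<le> x} = F i x"
    by (simp add: cdf_def emeasure_eq_measure atMost_def)
  have "{y. y \<le> x} = {y. y < x} \<union> {x}" by auto
  then have "emeasure (D i) {y. y \<le> x} = emeasure (D i) {y. y < x} + emeasure (D i) {x}"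
    by (simp only:) (rule plus_emeasure[symmetric], auto)
  then show "emeasure (D i) {y. y < x} = F i x" using le D_singleton by simp
qed

lemma F_mono: "x \<le> y \<Longrightarrow> F i x \<le> F i y" and F_nonneg: "0 \<le> F i x" and F_le_1: "F i x \<le> 1"
proof -
  interpret real_distribution "D i" by (rule D_rd)
  show "x \<le> y \<Longrightarrow> F i x \<le> F i y" by (rule cdf_nondecreasing)
  show "0 \<le> F i x" by (rule cdf_nonneg)
  show "F i x \<le> 1" by (rule cdf_bounded_prob)
qed

sublocale product_prob_space D I for I
  by (rule product_prob_spaceI) (rule D_prob)

text \<open>Joint law of arrival time and value of item i. Under \<open>PiM I P\<close> the items
  are independent, which a random presentation order alone would not provide.\<close>

definition P :: "nat \<Rightarrow> (real \<times> real) measure" where "P i = uniform01 \<Otimes>\<^sub>M D i"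

lemma P_sets[measurable_cong, simp]: "sets (P i) = sets (borel \<Otimes>\<^sub>M borel)"
  unfolding P_def by (intro sets_pair_measure_cong) auto

lemma P_prob: "prob_space (P i)"
  unfolding P_def by (intro prob_space_pair prob_space_uniform01 D_prob)

lemma nn_integral_P:
  assumes [measurable]: "f \<in> borel_measurable (borel \<Otimes>\<^sub>M borel)"
  shows "(\<integral>\<^sup>+p. f p \<partial>P i) = (\<integral>\<^sup>+t. \<integral>\<^sup>+y. f (t, y) \<partial>D i \<partial>uniform01)"
  unfolding P_def
  by (rule sigma_finite_measure.nn_integral_fst[symmetric]) (auto simp: prob_space_imp_sigma_finite D_prob)

sublocale P: product_prob_space P I for I
  by (rule product_prob_spaceI) (rule P_prob)

lemma P_component:
  assumes "i \<in> J"
  shows "(\<lambda>z. fst (z i)) \<in> borel_measurable (PiM J P)" "(\<lambda>z. snd (z i)) \<in> borel_measurable (PiM J P)"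
proof -
  have [measurable]: "(\<lambda>z. z i) \<in> measurable (PiM J P) (borel \<Otimes>\<^sub>M borel)"
    using measurable_component_singleton[OF assms, of P] by (simp cong: measurable_cong_sets)
  show "(\<lambda>z. fst (z i)) \<in> borel_measurable (PiM J P)" "(\<lambda>z. snd (z i)) \<in> borel_measurable (PiM J P)"
    by measurable
qed

lemma AE_D_neq: "AE y in D i. y \<noteq> x"
  using D_singleton by (intro AE_I[of _ _ "{x}"]) auto

lemma AE_P_neq: "AE p in P i. snd p \<noteq> x"
proof -
  have "(\<integral>\<^sup>+p. of_bool (snd p = x) \<partial>P i) = (\<integral>\<^sup>+t. \<integral>\<^sup>+y. of_bool (y = x) \<partial>D i \<partial>uniform01)"
    by (subst nn_integral_P) auto
  also have "(\<integral>\<^sup>+y. of_bool (y = x) \<partial>D i) = 0"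
    using AE_D_neq[where i=i and x=x] by (subst nn_integral_0_iff_AE) (auto elim!: eventually_mono)
  finally have "(\<integral>\<^sup>+p. of_bool (snd p = x) \<partial>P i) = 0" by simp
  then show ?thesis by (subst (asm) nn_integral_0_iff_AE) (auto elim!: eventually_mono)
qed

lemma AE_PiM_P_distinct:
  assumes J: "finite J"
  shows "AE z in PiM J P. \<forall>i\<in>J. \<forall>j\<in>J. i \<noteq> j \<longrightarrow> snd (z i) \<noteq> snd (z j)"
  by (rule AE_PiM_distinct[OF J P_prob _ AE_P_neq]) simp

end

section \<open>Arrival times and acceptance\<close>

lemma sum_of_bool_unique:
  assumes "finite J" "\<And>i j. i \<in> J \<Longrightarrow> j \<in> J \<Longrightarrow> Q i \<Longrightarrow> Q j \<Longrightarrow> i = j"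
  shows "(\<Sum>j\<in>J. of_bool (Q j)) = (of_bool (\<exists>j\<in>J. Q j) :: 'a :: semiring_1)"
proof (cases "\<exists>j\<in>J. Q j")
  case True
  then obtain j where j: "j \<in> J" "Q j" by blast
  then have "(\<Sum>k\<in>J. of_bool (Q k)) = (\<Sum>k\<in>J. if k = j then 1 else (0::'a))"
    using assms(2) by (intro sum.cong) auto
  with j assms(1) True show ?thesis by simp
qed auto

text \<open>\<open>a t y\<close> stands for: y is acceptable at time t. Joint measurability is what
  Fubini requires; the empirical rule with its samples held fixed is the intended instance.\<close>

locale acceptance =
  fixes a :: "real \<Rightarrow> real \<Rightarrow> bool"
  assumes acceptance_pred: "Measurable.pred (borel \<Otimes>\<^sub>M borel) (\<lambda>(t, y). a t y)"
begin

lemma measurable_acceptance[measurable (raw)]: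
  assumes "f \<in> borel_measurable M" "g \<in> borel_measurable M"
  shows "Measurable.pred M (\<lambda>w. a (f w) (g w))"
  using measurable_compose[OF measurable_Pair[OF assms] acceptance_pred] by simp

text \<open>Here and below, \<open>z l\<close> is the pair of the arrival time and the value of item \<open>l\<close>.\<close>

definition past_ok :: "nat set \<Rightarrow> real \<Rightarrow> (nat \<Rightarrow> real \<times> real) \<Rightarrow> bool" where
  "past_ok J T z \<longleftrightarrow> (\<forall>l\<in>J. T \<le> fst (z l)) \<or>
     (\<exists>j\<in>J. fst (z j) < T \<and> \<not> a (fst (z j)) (snd (z j)) \<and>
        (\<forall>l\<in>J - {j}. fst (z l) < T \<longrightarrow> snd (z l) < snd (z j)))"

end

locale accepted_distributions = continuous_distributions + acceptance
begin

text \<open>The predicate b is a parameter because it is instantiated in two ways: rejection at the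
  leader's own arrival time, and rejection at a fixed time s. Comparing the two is the point of
  \<open>nn_integral_past_ok\<close>.\<close>

definition leads :: "nat set \<Rightarrow> real \<Rightarrow> real \<Rightarrow> (real \<Rightarrow> real \<Rightarrow> bool) \<Rightarrow> nat \<Rightarrow> (nat \<Rightarrow> real \<times> real) \<Rightarrow> bool" where
  "leads J T x b j z \<longleftrightarrow> fst (z j) < T \<and> b (fst (z j)) (snd (z j)) \<and> snd (z j) < x \<and>
     (\<forall>l\<in>J - {j}. snd (z l) < x \<and> (fst (z l) < T \<longrightarrow> snd (z l) < snd (z j)))"

text \<open>A leader is strictly best among the early items, so there is at most one. The event
  splits into disjoint pieces, nobody early or exactly one leader, that can be integrated
  separately.\<close>

lemma sum_leads:
  assumes "finite J"
  shows "of_bool ((\<forall>l\<in>J. snd (z l) < x) \<and> ((\<forall>l\<in>J. T \<le> fst (z l)) \<or>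
      (\<exists>j\<in>J. fst (z j) < T \<and> b (fst (z j)) (snd (z j)) \<and> (\<forall>l\<in>J - {j}. fst (z l) < T \<longrightarrow> snd (z l) < snd (z j))))) =
    (of_bool (\<forall>l\<in>J. snd (z l) < x \<and> T \<le> fst (z l)) + (\<Sum>j\<in>J. of_bool (leads J T x b j z)) :: ennreal)"
proof -
  have "(\<Sum>j\<in>J. of_bool (leads J T x b j z)) = (of_bool (\<exists>j\<in>J. leads J T x b j z) :: ennreal)"
  proof (rule sum_of_bool_unique[OF assms])
    fix i j assume ij: "i \<in> J" "j \<in> J" "leads J T x b i z" "leads J T x b j z"
    show "i = j"
    proof (rule ccontr)
      assume "i \<noteq> j"
      then have "snd (z i) < snd (z j)" "snd (z j) < snd (z i)" using ij by (auto simp: leads_def)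
      then show False by simp
    qed
  qed
  moreover have lead: "leads J T x b j z \<longleftrightarrow> (\<forall>l\<in>J. snd (z l) < x) \<and> fst (z j) < T \<and> b (fst (z j)) (snd (z j)) \<and>
      (\<forall>l\<in>J - {j}. fst (z l) < T \<longrightarrow> snd (z l) < snd (z j))" if "j \<in> J" for j
    using that unfolding leads_def by auto
  moreover have "(\<exists>j\<in>J. leads J T x b j z) \<longleftrightarrow> (\<forall>l\<in>J. snd (z l) < x) \<and>
      (\<exists>j\<in>J. fst (z j) < T \<and> b (fst (z j)) (snd (z j)) \<and> (\<forall>l\<in>J - {j}. fst (z l) < T \<longrightarrow> snd (z l) < snd (z j)))"
    by (auto simp: lead)
  moreover have "\<not> ((\<forall>l\<in>J. snd (z l) < x \<and> T \<le> fst (z l)) \<and> (\<exists>j\<in>J. leads J T x b j z))"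
    unfolding leads_def using not_less by blast
  ultimately show ?thesis
    by (cases "\<exists>j\<in>J. leads J T x b j z"; cases "\<forall>l\<in>J. snd (z l) < x \<and> T \<le> fst (z l)") (auto simp: of_bool_def)
qed

text \<open>Probability, over the items other than j, of what they must satisfy for j to lead with
  value y. The arrival time of j does not occur in it.\<close>

definition lead_weight :: "nat set \<Rightarrow> real \<Rightarrow> real \<Rightarrow> nat \<Rightarrow> real \<Rightarrow> ennreal" where
  "lead_weight J T x j y =
     (\<integral>\<^sup>+z. of_bool (\<forall>l\<in>J - {j}. snd (z l) < x \<and> (fst (z l) < T \<longrightarrow> snd (z l) < y)) \<partial>PiM (J - {j}) P)"

lemma measurable_lead_weight[measurable]:
  assumes "finite J"
  shows "lead_weight J T x j \<in> borel_measurable borel"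
proof -
  interpret prob_space "PiM (J - {j}) P" by (intro prob_space_PiM P_prob)
  have fin: "finite (J - {j})" using assms by simp
  note [measurable] = pred_intros_finite(3)[OF fin]
  show ?thesis unfolding lead_weight_def[abs_def] by measurable
qed

text \<open>Integrating the other items first leaves \<open>lead_weight\<close>, in which only the
  value of j appears; the arrival time of j survives in \<open>t < T\<close> and
  \<open>b t y\<close> alone.\<close>

lemma nn_integral_leads:
  assumes J: "finite J" "j \<in> J" and b: "Measurable.pred (borel \<Otimes>\<^sub>M borel) (\<lambda>(t, y). b t y)"
  shows "(\<integral>\<^sup>+z. of_bool (leads J T x b j z) \<partial>PiM J P) =
    (\<integral>\<^sup>+t. \<integral>\<^sup>+y. of_bool (t < T \<and> b t y \<and> y < x) * lead_weight J T x j y \<partial>D j \<partial>uniform01)"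
proof -
  interpret b: acceptance b by standard (rule b)
  have eq: "insert j (J - {j}) = J" using J by auto
  have [measurable]: "finite (J - {j})" "finite J" using J by auto
  have [measurable]: "Measurable.pred (PiM J P) (leads J T x b j)"
    unfolding leads_def[abs_def] using J by measurable
  have "(\<integral>\<^sup>+z. of_bool (leads J T x b j z) \<partial>PiM J P) =
     (\<integral>\<^sup>+p. \<integral>\<^sup>+z. of_bool (leads J T x b j (z(j := p))) \<partial>PiM (J - {j}) P \<partial>P j)"
    using P.product_nn_integral_insert_rev[of "J - {j}" j "\<lambda>z. of_bool (leads J T x b j z)"] J
    unfolding eq by simp
  also have "\<dots> = (\<integral>\<^sup>+p. of_bool (fst p < T \<and> b (fst p) (snd p) \<and> snd p < x) * lead_weight J T x j (snd p) \<partial>P j)"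
    unfolding lead_weight_def
    by (intro nn_integral_cong, cases) (auto simp: leads_def intro!: nn_integral_cong)
  also have "\<dots> = (\<integral>\<^sup>+t. \<integral>\<^sup>+y. of_bool (t < T \<and> b t y \<and> y < x) * lead_weight J T x j y \<partial>D j \<partial>uniform01)"
    using J by (subst nn_integral_P) auto
  finally show ?thesis .
qed

end

lemma nn_integral_uniform01_less:
  assumes "0 \<le> T" "T \<le> 1"
  shows "(\<integral>\<^sup>+t. of_bool (t < T) * c \<partial>uniform01) = ennreal T * c"
    and "(\<integral>\<^sup>+t. of_bool (T \<le> t) * c \<partial>uniform01) = ennreal (1 - T) * c"
proof -
  have "(\<integral>\<^sup>+t. of_bool (t < T) * c \<partial>uniform01) = (\<integral>\<^sup>+t. c * indicator {0..<T} t \<partial>lborel)"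
    using assms by (subst nn_integral_uniform01) (auto intro!: nn_integral_cong simp: indicator_def)
  then show "(\<integral>\<^sup>+t. of_bool (t < T) * c \<partial>uniform01) = ennreal T * c"
    using assms by (simp add: nn_integral_cmult mult.commute)
  have "(\<integral>\<^sup>+t. of_bool (T \<le> t) * c \<partial>uniform01) = (\<integral>\<^sup>+t. c * indicator {T..1} t \<partial>lborel)"
    using assms by (subst nn_integral_uniform01) (auto intro!: nn_integral_cong simp: indicator_def)
  then show "(\<integral>\<^sup>+t. of_bool (T \<le> t) * c \<partial>uniform01) = ennreal (1 - T) * c"
    using assms by (simp add: nn_integral_cmult mult.commute)
qed

context accepted_distributions
begin

definition past_ok_at :: "nat set \<Rightarrow> real \<Rightarrow> real \<Rightarrow> (nat \<Rightarrow> real \<times> real) \<Rightarrow> bool" where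
  "past_ok_at J T s z \<longleftrightarrow> (\<forall>l\<in>J. T \<le> fst (z l)) \<or>
     (\<exists>j\<in>J. fst (z j) < T \<and> \<not> a s (snd (z j)) \<and>
        (\<forall>l\<in>J - {j}. fst (z l) < T \<longrightarrow> snd (z l) < snd (z j)))"

text \<open>Given that item \<open>j\<close> leads before time \<open>T\<close>, its arrival time is uniform on \<open>[0, T]\<close> and independent of
  everything else, so it may be replaced by a fresh uniform time \<open>s\<close>.\<close>

lemma nn_integral_past_ok:
  assumes J: "finite J" and T: "0 < T" "T < 1"
  shows "(\<integral>\<^sup>+z. of_bool ((\<forall>l\<in>J. snd (z l) < x) \<and> past_ok J T z) \<partial>PiM J P) =
    (\<integral>\<^sup>+s. ennreal (1 / T) * (\<integral>\<^sup>+z. of_bool ((\<forall>l\<in>J. snd (z l) < x) \<and> past_ok_at J T s z) \<partial>PiM J P)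
       * indicator {0<..<T} s \<partial>lborel)"
proof -
  note [measurable] = measurable_lead_weight[OF J]
  have [measurable]: "finite J" by (rule J)
  \<comment> \<open>Both leader events are governed by this one function: with rejection at j's own
    time the probability is its integral over (0, T), with rejection at a fixed s it is T times its
    value at s.\<close>
  define c where "c j s = (\<integral>\<^sup>+y. of_bool (\<not> a s y \<and> y < x) * lead_weight J T x j y \<partial>D j)" for j s
  have c_meas[measurable]: "c j \<in> borel_measurable borel" for j
  proof -
    interpret prob_space "D j" by (rule D_prob)
    show ?thesis unfolding c_def[abs_def] by measurable
  qed
  define L where "L = (\<integral>\<^sup>+z. of_bool (\<forall>l\<in>J. snd (z l) < x \<and> T \<le> fst (z l)) \<partial>PiM J P)"
  have L_meas[measurable]: "Measurable.pred (PiM J P) (\<lambda>z. \<forall>l\<in>J. snd (z l) < x \<and> T \<le> fst (z l))"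
    by measurable
  have leads_meas[measurable]: "Measurable.pred (PiM J P) (leads J T x b j)"
    if j: "j \<in> J" and b: "Measurable.pred (borel \<Otimes>\<^sub>M borel) (\<lambda>(t, y). b t y)" for b j
  proof -
    interpret b: acceptance b by standard (rule b)
    have [measurable]: "finite (J - {j})" using J by simp
    show ?thesis unfolding leads_def[abs_def] using j by measurable
  qed
  have b1: "Measurable.pred (borel \<Otimes>\<^sub>M borel) (\<lambda>(t, y). \<not> a t y)"
    and b2: "Measurable.pred (borel \<Otimes>\<^sub>M borel) (\<lambda>(t :: real, y). \<not> a s y)" for s
    by measurable
  have 1: "(\<integral>\<^sup>+z. of_bool (leads J T x (\<lambda>t y. \<not> a t y) j z) \<partial>PiM J P) =
      (\<integral>\<^sup>+t. c j t * indicator {0<..<T} t \<partial>lborel)" if "j \<in> J" for j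
  proof -
    have "(\<integral>\<^sup>+z. of_bool (leads J T x (\<lambda>t y. \<not> a t y) j z) \<partial>PiM J P) =
      (\<integral>\<^sup>+t. \<integral>\<^sup>+y. of_bool (t < T \<and> \<not> a t y \<and> y < x) * lead_weight J T x j y \<partial>D j \<partial>uniform01)"
      by (rule nn_integral_leads[OF J that b1])
    also have "\<dots> = (\<integral>\<^sup>+t. of_bool (t < T) * c j t \<partial>uniform01)"
      by (intro nn_integral_cong) (auto simp: c_def)
    also have "\<dots> = (\<integral>\<^sup>+t. of_bool (t < T) * c j t * indicator {0..1} t \<partial>lborel)"
      by (rule nn_integral_uniform01) measurable
    also have "\<dots> = (\<integral>\<^sup>+t. c j t * indicator {0<..<T} t \<partial>lborel)"
      using AE_lborel_singleton[of "0::real"] T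
      by (intro nn_integral_cong_AE, elim eventually_mono) (auto simp: indicator_def)
    finally show ?thesis .
  qed
  have 2: "(\<integral>\<^sup>+z. of_bool (leads J T x (\<lambda>t y. \<not> a s y) j z) \<partial>PiM J P) = ennreal T * c j s" if "j \<in> J" for j s
  proof -
    have "(\<integral>\<^sup>+z. of_bool (leads J T x (\<lambda>t y. \<not> a s y) j z) \<partial>PiM J P) =
      (\<integral>\<^sup>+t. \<integral>\<^sup>+y. of_bool (t < T \<and> \<not> a s y \<and> y < x) * lead_weight J T x j y \<partial>D j \<partial>uniform01)"
      by (rule nn_integral_leads[OF J that b2])
    also have "\<dots> = (\<integral>\<^sup>+t. of_bool (t < T) * c j s \<partial>uniform01)"
      by (intro nn_integral_cong) (auto simp: c_def)
    finally show ?thesis using T by (simp add: nn_integral_uniform01_less)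
  qed
  have 3: "L + (\<Sum>j\<in>J. ennreal T * c j s) = (\<integral>\<^sup>+z. of_bool ((\<forall>l\<in>J. snd (z l) < x) \<and> past_ok_at J T s z) \<partial>PiM J P)" for s
  proof -
    have "(\<integral>\<^sup>+z. of_bool ((\<forall>l\<in>J. snd (z l) < x) \<and> past_ok_at J T s z) \<partial>PiM J P) =
     (\<integral>\<^sup>+z. (of_bool (\<forall>l\<in>J. snd (z l) < x \<and> T \<le> fst (z l)) + (\<Sum>j\<in>J. of_bool (leads J T x (\<lambda>t y. \<not> a s y) j z))) \<partial>PiM J P)"
      unfolding past_ok_at_def by (simp only: sum_leads[OF J, of _ x T "\<lambda>t y. \<not> a s y"])
    also have "\<dots> = L + (\<Sum>j\<in>J. \<integral>\<^sup>+z. of_bool (leads J T x (\<lambda>t y. \<not> a s y) j z) \<partial>PiM J P)"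
      unfolding L_def using b2
      by (subst nn_integral_add) (auto simp: nn_integral_sum intro!: borel_measurable_sum measurable_of_bool_ennreal leads_meas)
    finally show ?thesis by (simp add: 2)
  qed
  have "(\<integral>\<^sup>+z. of_bool ((\<forall>l\<in>J. snd (z l) < x) \<and> past_ok J T z) \<partial>PiM J P) =
     (\<integral>\<^sup>+z. (of_bool (\<forall>l\<in>J. snd (z l) < x \<and> T \<le> fst (z l)) + (\<Sum>j\<in>J. of_bool (leads J T x (\<lambda>t y. \<not> a t y) j z))) \<partial>PiM J P)"
    unfolding past_ok_def by (simp only: sum_leads[OF J, of _ x T "\<lambda>t y. \<not> a t y"])
  also have "\<dots> = L + (\<Sum>j\<in>J. \<integral>\<^sup>+z. of_bool (leads J T x (\<lambda>t y. \<not> a t y) j z) \<partial>PiM J P)"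
    unfolding L_def using b1
    by (subst nn_integral_add) (auto simp: nn_integral_sum intro!: borel_measurable_sum measurable_of_bool_ennreal leads_meas)
  also have "\<dots> = L + (\<Sum>j\<in>J. \<integral>\<^sup>+t. c j t * indicator {0<..<T} t \<partial>lborel)"
    by (simp add: 1)
  \<comment> \<open>\<open>L\<close> does not depend on s; written as its own average over (0, T) it
    joins the other terms under a single integral.\<close>
  also have "L = (\<integral>\<^sup>+s. ennreal (1 / T) * L * indicator {0<..<T} s \<partial>lborel)"
  proof -
    have "ennreal (1 / T) * ennreal T = 1" using T by (simp add: ennreal_mult[symmetric])
    then show ?thesis using T by (simp add: nn_integral_cmult mult.commute[of _ L] mult.assoc)
  qed
  also have "\<dots> + (\<Sum>j\<in>J. \<integral>\<^sup>+t. c j t * indicator {0<..<T} t \<partial>lborel)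
     = (\<integral>\<^sup>+s. ennreal (1 / T) * L * indicator {0<..<T} s + (\<Sum>j\<in>J. c j s * indicator {0<..<T} s) \<partial>lborel)"
    by (subst nn_integral_add) (auto simp: nn_integral_sum)
  also have "\<dots> = (\<integral>\<^sup>+s. ennreal (1 / T) * (L + (\<Sum>j\<in>J. ennreal T * c j s)) * indicator {0<..<T} s \<partial>lborel)"
  proof (intro nn_integral_cong)
    fix s
    have "ennreal (1 / T) * (\<Sum>j\<in>J. ennreal T * c j s) = (\<Sum>j\<in>J. c j s)"
      unfolding sum_distrib_left mult.assoc[symmetric] using T by (simp add: ennreal_mult[symmetric])
    then show "ennreal (1 / T) * L * indicator {0<..<T} s + (\<Sum>j\<in>J. c j s * indicator {0<..<T} s) =
       ennreal (1 / T) * (L + (\<Sum>j\<in>J. ennreal T * c j s)) * indicator {0<..<T} s"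
      by (simp add: distrib_left distrib_right sum_distrib_right[symmetric])
  qed
  finally show ?thesis unfolding 3 .
qed

text \<open>If no early item is acceptable at time s, neither is the best early one, and the
  stronger condition factors over items: late with a value below x, or early with a value below x
  that is rejected at s. A strictly best early item exists because ties are null events.\<close>

lemma nn_integral_past_ok_at_ge:
  assumes J: "finite J" and T: "0 < T" "T < 1"
  shows "(\<Prod>l\<in>J. ennreal (1 - T) * ennreal (F l x) + ennreal T * emeasure (D l) {y. y < x \<and> \<not> a s y})
    \<le> (\<integral>\<^sup>+z. of_bool ((\<forall>l\<in>J. snd (z l) < x) \<and> past_ok_at J T s z) \<partial>PiM J P)"
proof -
  have "ennreal (1 - T) * ennreal (F l x) + ennreal T * emeasure (D l) {y. y < x \<and> \<not> a s y} =
     (\<integral>\<^sup>+p. of_bool (snd p < x \<and> (fst p < T \<longrightarrow> \<not> a s (snd p))) \<partial>P l)" for l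
  proof -
    have "(\<integral>\<^sup>+p. of_bool (snd p < x \<and> (fst p < T \<longrightarrow> \<not> a s (snd p))) \<partial>P l) =
      (\<integral>\<^sup>+t. \<integral>\<^sup>+y. of_bool (y < x \<and> (t < T \<longrightarrow> \<not> a s y)) \<partial>D l \<partial>uniform01)"
      by (subst nn_integral_P) auto
    also have "\<dots> = (\<integral>\<^sup>+t. of_bool (T \<le> t) * ennreal (F l x) + of_bool (t < T) * emeasure (D l) {y. y < x \<and> \<not> a s y} \<partial>uniform01)"
    proof (intro nn_integral_cong)
      fix t :: real
      have "(\<integral>\<^sup>+y. of_bool (y < x) \<partial>D l) = (\<integral>\<^sup>+y. indicator {y. y < x} y \<partial>D l)"
        "(\<integral>\<^sup>+y. of_bool (y < x \<and> \<not> a s y) \<partial>D l) = (\<integral>\<^sup>+y. indicator {y. y < x \<and> \<not> a s y} y \<partial>D l)"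
        by (auto intro!: nn_integral_cong simp: indicator_def)
      moreover have "{y. y < x} \<in> sets (D l)" "{y. y < x \<and> \<not> a s y} \<in> sets (D l)"
        by measurable
      ultimately show "(\<integral>\<^sup>+y. of_bool (y < x \<and> (t < T \<longrightarrow> \<not> a s y)) \<partial>D l) =
        of_bool (T \<le> t) * ennreal (F l x) + of_bool (t < T) * emeasure (D l) {y. y < x \<and> \<not> a s y}"
        by (cases "t < T") (auto simp: emeasure_D_less)
    qed
    also have "\<dots> = ennreal (1 - T) * ennreal (F l x) + ennreal T * emeasure (D l) {y. y < x \<and> \<not> a s y}"
      using T by (subst nn_integral_add) (auto simp: nn_integral_uniform01_less)
    finally show ?thesis ..
  qed
  then have "(\<Prod>l\<in>J. ennreal (1 - T) * ennreal (F l x) + ennreal T * emeasure (D l) {y. y < x \<and> \<not> a s y}) =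
    (\<Prod>l\<in>J. \<integral>\<^sup>+p. of_bool (snd p < x \<and> (fst p < T \<longrightarrow> \<not> a s (snd p))) \<partial>P l)"
    by simp
  also have "\<dots> = (\<integral>\<^sup>+z. (\<Prod>l\<in>J. of_bool (snd (z l) < x \<and> (fst (z l) < T \<longrightarrow> \<not> a s (snd (z l))))) \<partial>PiM J P)"
    by (rule P.product_nn_integral_prod[symmetric]) (auto simp: J)
  also have "\<dots> \<le> (\<integral>\<^sup>+z. of_bool ((\<forall>l\<in>J. snd (z l) < x) \<and> past_ok_at J T s z) \<partial>PiM J P)"
  proof (rule nn_integral_mono_AE)
    show "AE z in PiM J P. (\<Prod>l\<in>J. of_bool (snd (z l) < x \<and> (fst (z l) < T \<longrightarrow> \<not> a s (snd (z l)))))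
       \<le> (of_bool ((\<forall>l\<in>J. snd (z l) < x) \<and> past_ok_at J T s z) :: ennreal)"
      using AE_PiM_P_distinct[OF J]
    proof eventually_elim
      case (elim z)
      have "past_ok_at J T s z" if *: "\<forall>l\<in>J. snd (z l) < x \<and> (fst (z l) < T \<longrightarrow> \<not> a s (snd (z l)))"
      proof (cases "\<forall>l\<in>J. T \<le> fst (z l)")
        case False
        define B where "B = {l\<in>J. fst (z l) < T}"
        have "finite B" "B \<noteq> {}" using J False by (auto simp: B_def not_le)
        then have "Max ((\<lambda>l. snd (z l)) ` B) \<in> (\<lambda>l. snd (z l)) ` B" by (intro Max_in) auto
        then obtain j where j: "j \<in> B" "snd (z j) = Max ((\<lambda>l. snd (z l)) ` B)" by fastforce
        then have j: "j \<in> B" "\<forall>l\<in>B. snd (z l) \<le> snd (z j)"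
          using \<open>finite B\<close> by auto
        have "snd (z l) < snd (z j)" if "l \<in> J - {j}" "fst (z l) < T" for l
        proof -
          have "l \<in> B" "l \<noteq> j" "l \<in> J" "j \<in> J" using that j by (auto simp: B_def)
          then show ?thesis using j(2) elim by (metis less_le)
        qed
        with j * show ?thesis unfolding past_ok_at_def B_def by blast
      qed (simp add: past_ok_at_def)
      then show ?case by (auto simp: prod_of_bool J)
    qed
  qed
  finally show ?thesis .
qed

end

section \<open>The law of the maximum\<close>

context continuous_distributions
begin

definition Q :: "nat set \<Rightarrow> real \<Rightarrow> real" where "Q I x = (\<Prod>i\<in>I. F i x)"

lemma Q_nonneg: "0 \<le> Q I x" and Q_le_1: "Q I x \<le> 1" and Q_mono: "x \<le> y \<Longrightarrow> Q I x \<le> Q I y"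
  unfolding Q_def by (auto intro!: prod_nonneg prod_le_1 prod_mono F_mono simp: F_nonneg F_le_1)

lemma Q_cont: "continuous_on S (Q I)"
  unfolding Q_def[abs_def] by (intro continuous_intros F_cont)

lemma Q_measurable[measurable]: "Q I \<in> borel_measurable borel"
  by (intro borel_measurable_continuous_onI Q_cont)

text \<open>One factor alone pushes \<open>Q I\<close> below p at the left end, since the others are
  at most 1. The values 0 and 1 are excluded because they need not be attained.\<close>

lemma Q_surj:
  assumes I: "finite I" "I \<noteq> {}" and p: "0 < p" "p < 1"
  shows "\<exists>b. Q I b = p"
proof -
  obtain i where i: "i \<in> I" using I by auto
  have bot: "(F j \<longlongrightarrow> 0) at_bot" and top: "(F j \<longlongrightarrow> 1) at_top" for j
  proof -
    interpret real_distribution "D j" by (rule D_rd)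
    show "(F j \<longlongrightarrow> 0) at_bot" by (rule cdf_lim_at_bot)
    show "(F j \<longlongrightarrow> 1) at_top" by (rule cdf_lim_at_top_prob)
  qed
  have "eventually (\<lambda>x. F i x < p) at_bot" using bot[of i] p(1) by (rule order_tendstoD)
  then obtain u where u: "F i u < p" by (meson eventually_happens trivial_limit_at_bot_linorder)
  have "Q I u = F i u * (\<Prod>j\<in>I - {i}. F j u)" using I i by (simp add: Q_def prod.remove)
  also have "\<dots> \<le> F i u * 1"
    by (intro mult_left_mono prod_le_1 F_nonneg) (auto simp: F_nonneg F_le_1)
  finally have u: "Q I u \<le> p" using u by simp
  have "(Q I \<longlongrightarrow> (\<Prod>j\<in>I. 1)) at_top" unfolding Q_def[abs_def] by (intro tendsto_prod top)
  then have "eventually (\<lambda>x. p < Q I x) at_top" using p by (intro order_tendstoD) auto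
  then obtain v where v: "p < Q I v" by (meson eventually_happens trivial_limit_at_top_linorder)
  have "u \<le> v" using u v Q_mono[of v u I] by linarith
  then show ?thesis using IVT'[of "Q I" u p v] u v Q_cont by auto
qed

section \<open>The distribution function evaluated at the maximum\<close>

definition Z_max :: "nat set \<Rightarrow> (nat \<Rightarrow> real \<times> real) \<Rightarrow> real" where
  "Z_max I z = Max ((\<lambda>l. snd (z l)) ` I)"

lemma nn_integral_D_less: "(\<integral>\<^sup>+y. of_bool (y < x) \<partial>D i) = ennreal (F i x)"
  and nn_integral_D_le: "(\<integral>\<^sup>+y. of_bool (y \<le> x) \<partial>D i) = ennreal (F i x)"
proof -
  have "(\<integral>\<^sup>+y. of_bool (y < x) \<partial>D i) = (\<integral>\<^sup>+y. indicator {y. y < x} y \<partial>D i)"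
    "(\<integral>\<^sup>+y. of_bool (y \<le> x) \<partial>D i) = (\<integral>\<^sup>+y. indicator {y. y \<le> x} y \<partial>D i)"
    by (auto intro!: nn_integral_cong simp: indicator_def)
  then show "(\<integral>\<^sup>+y. of_bool (y < x) \<partial>D i) = ennreal (F i x)" "(\<integral>\<^sup>+y. of_bool (y \<le> x) \<partial>D i) = ennreal (F i x)"
    by (auto simp: emeasure_D_less emeasure_D_le)
qed

lemma nn_integral_P_snd:
  assumes [measurable]: "f \<in> borel_measurable borel"
  shows "(\<integral>\<^sup>+p. f (snd p) \<partial>P i) = (\<integral>\<^sup>+y. f y \<partial>D i)"
  using prob_space.emeasure_space_1[OF prob_space_uniform01] by (subst nn_integral_P) auto

lemma Z_max_measurable[measurable]: "finite I \<Longrightarrow> Z_max I \<in> borel_measurable (PiM I P)"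
  unfolding Z_max_def[abs_def] by (intro borel_measurable_Max P_component)

lemma prob_Z_max_le:
  assumes I: "finite I" "I \<noteq> {}"
  shows "measure (PiM I P) {z \<in> space (PiM I P). Z_max I z \<le> b} = Q I b"
proof -
  note [measurable] = Z_max_measurable[OF I(1)]
  have "emeasure (PiM I P) {z \<in> space (PiM I P). Z_max I z \<le> b} =
     (\<integral>\<^sup>+z. indicator {z \<in> space (PiM I P). Z_max I z \<le> b} z \<partial>PiM I P)"
    by (rule nn_integral_indicator[symmetric]) measurable
  also have "\<dots> = (\<integral>\<^sup>+z. (\<Prod>l\<in>I. of_bool (snd (z l) \<le> b)) \<partial>PiM I P)"
    using I by (intro nn_integral_cong) (auto simp: prod_of_bool Z_max_def indicator_def)
  also have "\<dots> = (\<Prod>l\<in>I. \<integral>\<^sup>+p. of_bool (snd p \<le> b) \<partial>P l)"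
    by (rule P.product_nn_integral_prod) (use I in auto)
  also have "\<dots> = (\<Prod>l\<in>I. ennreal (F l b))"
  proof (intro prod.cong refl)
    fix l
    show "(\<integral>\<^sup>+p. of_bool (snd p \<le> b) \<partial>P l) = ennreal (F l b)"
      by (subst nn_integral_P_snd) (auto simp: nn_integral_D_le)
  qed
  also have "\<dots> = ennreal (Q I b)" unfolding Q_def by (simp add: prod_ennreal F_nonneg)
  finally show ?thesis by (simp add: P.P.emeasure_eq_measure Q_nonneg)
qed

text \<open>The probability integral transform. \<open>Q I\<close> may be constant on intervals, so
  \<open>Q I (Z_max I z) \<le> p\<close> need not be of the form \<open>Z_max I z \<le> b\<close>
  for a given p-quantile b. A p-quantile bounds its probability from below, p'-quantiles with p' > p
  from above, and p' tends to p.\<close>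

lemma distr_Q_Z_max:
  assumes I: "finite I" "I \<noteq> {}"
  shows "distr (PiM I P) borel (\<lambda>z. Q I (Z_max I z)) = uniform01"
proof -
  note [measurable] = Z_max_measurable[OF I(1)]
  interpret U: prob_space uniform01 by (rule prob_space_uniform01)
  interpret rd: real_distribution "distr (PiM I P) borel (\<lambda>z. Q I (Z_max I z))"
    by (intro P.P.real_distribution_distr) measurable
  interpret rdU: real_distribution uniform01 by standard auto
  have U: "cdf uniform01 p = (if p \<le> 0 then 0 else if p \<ge> 1 then 1 else p)" for p
  proof -
    have "cdf uniform01 p = measure lborel ({0..1} \<inter> {..p})"
      unfolding cdf_def by (subst measure_uniform_measure) auto
    also have "{0..1} \<inter> {..p} = (if p < 0 then {} else {0..min 1 p})" by auto
    finally show ?thesis by (auto simp: min_def)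
  qed
  have cdf: "cdf (distr (PiM I P) borel (\<lambda>z. Q I (Z_max I z))) p =
     measure (PiM I P) {z \<in> space (PiM I P). Q I (Z_max I z) \<le> p}" for p
    unfolding cdf_def by (subst measure_distr) (auto intro!: arg_cong2[where f=measure])
  have le: "measure (PiM I P) {z \<in> space (PiM I P). Q I (Z_max I z) \<le> p} \<le> p'" if "0 < p'" "p' < 1" "p < p'" for p p'
  proof -
    obtain b where b: "Q I b = p'" using Q_surj[OF I \<open>0 < p'\<close> \<open>p' < 1\<close>] by auto
    have "Z_max I z \<le> b" if "Q I (Z_max I z) \<le> p" for z
      using Q_mono[of b "Z_max I z" I] b that \<open>p < p'\<close> by linarith
    then have "measure (PiM I P) {z \<in> space (PiM I P). Q I (Z_max I z) \<le> p} \<le>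
      measure (PiM I P) {z \<in> space (PiM I P). Z_max I z \<le> b}"
      by (intro P.P.finite_measure_mono) auto
    then show ?thesis using prob_Z_max_le[OF I] b by simp
  qed
  have ge: "p \<le> measure (PiM I P) {z \<in> space (PiM I P). Q I (Z_max I z) \<le> p}" if "0 < p" "p < 1" for p
  proof -
    obtain b where b: "Q I b = p" using Q_surj[OF I \<open>0 < p\<close> \<open>p < 1\<close>] by auto
    have "measure (PiM I P) {z \<in> space (PiM I P). Z_max I z \<le> b} \<le>
      measure (PiM I P) {z \<in> space (PiM I P). Q I (Z_max I z) \<le> p}"
      using Q_mono[of _ b I] b by (intro P.P.finite_measure_mono) auto
    then show ?thesis using prob_Z_max_le[OF I] b by simp
  qed
  have "cdf (distr (PiM I P) borel (\<lambda>z. Q I (Z_max I z))) p = cdf uniform01 p" for p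
  proof -
    let ?c = "measure (PiM I P) {z \<in> space (PiM I P). Q I (Z_max I z) \<le> p}"
    consider "p \<le> 0" | "0 < p" "p < 1" | "p \<ge> 1" by linarith
    then show ?thesis
    proof cases
      case 1
      have "?c \<le> 0"
      proof (rule field_le_epsilon)
        fix e :: real assume "e > 0"
        \<comment> \<open>The cap keeps p' inside (0, 1), where quantiles exist.\<close>
        then have "?c \<le> min e (1/2)" using 1 by (intro le) auto
        then show "?c \<le> 0 + e" by simp
      qed
      then show ?thesis using 1 unfolding cdf U by (simp add: antisym)
    next
      case 2
      have "?c \<le> p"
      proof (rule field_le_epsilon)
        fix e :: real assume "e > 0"
        then have "?c \<le> min (p + e) ((p + 1) / 2)" using 2 by (intro le) (auto simp: min_less_iff_disj)
        then show "?c \<le> p + e" by simp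
      qed
      then show ?thesis using 2 ge[of p] unfolding cdf U by simp
    next
      case 3
      then have "{z \<in> space (PiM I P). Q I (Z_max I z) \<le> p} = space (PiM I P)"
        using Q_le_1[of I] by (auto intro: order_trans)
      then show ?thesis using 3 unfolding cdf U by (simp add: P.P.prob_space)
    qed
  qed
  then show ?thesis by (intro cdf_unique ext) (auto intro: rd.real_distribution_axioms rdU.real_distribution_axioms)
qed

text \<open>The summand for i is the contribution of the event that i attains the maximum: the other
  items, integrated first, lie below x with probability given by the product. These events partition
  the space up to ties, and summing them makes the individual distributions disappear.\<close>

lemma nn_integral_max:
  assumes I: "finite I" "I \<noteq> {}" and g[measurable]: "g \<in> borel_measurable borel"
  shows "(\<Sum>i\<in>I. \<integral>\<^sup>+x. (\<Prod>l\<in>I - {i}. ennreal (F l x)) * g (Q I x) \<partial>D i) = (\<integral>\<^sup>+q. g q \<partial>uniform01)"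
proof -
  note [measurable] = Z_max_measurable[OF I(1)]
  have F_meas[measurable]: "F l \<in> borel_measurable borel" for l
    by (intro borel_measurable_continuous_onI F_cont)
  have fin[measurable]: "finite (I - {i})" for i using I by simp
  have term_i: "(\<integral>\<^sup>+x. (\<Prod>l\<in>I - {i}. ennreal (F l x)) * g (Q I x) \<partial>D i) =
     (\<integral>\<^sup>+z. of_bool (\<forall>l\<in>I - {i}. snd (z l) < snd (z i)) * g (Q I (snd (z i))) \<partial>PiM I P)" if i: "i \<in> I" for i
  proof -
    have eq: "insert i (I - {i}) = I" using i by auto
    have [measurable]: "(\<lambda>z. snd (z i)) \<in> borel_measurable (PiM I P)"
      using i by (rule P_component)
    have [measurable]: "Measurable.pred (PiM I P) (\<lambda>z. \<forall>l\<in>I - {i}. snd (z l) < snd (z i))"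
      using i by measurable
    have "(\<integral>\<^sup>+z. of_bool (\<forall>l\<in>I - {i}. snd (z l) < snd (z i)) * g (Q I (snd (z i))) \<partial>PiM I P) =
      (\<integral>\<^sup>+p. \<integral>\<^sup>+z. of_bool (\<forall>l\<in>I - {i}. snd (z l) < snd p) * g (Q I (snd p)) \<partial>PiM (I - {i}) P \<partial>P i)"
    proof -
      have "(\<integral>\<^sup>+p. \<integral>\<^sup>+z. of_bool (\<forall>l\<in>I - {i}. snd ((z(i := p)) l) < snd ((z(i := p)) i)) * g (Q I (snd ((z(i := p)) i))) \<partial>PiM (I - {i}) P \<partial>P i)
        = (\<integral>\<^sup>+p. \<integral>\<^sup>+z. of_bool (\<forall>l\<in>I - {i}. snd (z l) < snd p) * g (Q I (snd p)) \<partial>PiM (I - {i}) P \<partial>P i)"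
        by (intro nn_integral_cong) auto
      then show ?thesis
        using P.product_nn_integral_insert_rev[of "I - {i}" i "\<lambda>z. of_bool (\<forall>l\<in>I - {i}. snd (z l) < snd (z i)) * g (Q I (snd (z i)))"] I
        unfolding eq by simp
    qed
    also have "\<dots> = (\<integral>\<^sup>+p. (\<Prod>l\<in>I - {i}. ennreal (F l (snd p))) * g (Q I (snd p)) \<partial>P i)"
    proof (intro nn_integral_cong)
      fix p
      have "(\<integral>\<^sup>+z. of_bool (\<forall>l\<in>I - {i}. snd (z l) < snd p) * g (Q I (snd p)) \<partial>PiM (I - {i}) P)
        = (\<integral>\<^sup>+z. (\<Prod>l\<in>I - {i}. of_bool (snd (z l) < snd p)) \<partial>PiM (I - {i}) P) * g (Q I (snd p))"
        using I by (subst nn_integral_multc[symmetric]) (auto simp: prod_of_bool)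
      also have "(\<integral>\<^sup>+z. (\<Prod>l\<in>I - {i}. of_bool (snd (z l) < snd p)) \<partial>PiM (I - {i}) P) = (\<Prod>l\<in>I - {i}. \<integral>\<^sup>+w. of_bool (snd w < snd p) \<partial>P l)"
        by (rule P.product_nn_integral_prod) (use I in auto)
      also have "\<dots> = (\<Prod>l\<in>I - {i}. ennreal (F l (snd p)))"
        by (intro prod.cong refl, subst nn_integral_P_snd) (auto simp: nn_integral_D_less)
      finally show "(\<integral>\<^sup>+z. of_bool (\<forall>l\<in>I - {i}. snd (z l) < snd p) * g (Q I (snd p)) \<partial>PiM (I - {i}) P)
        = (\<Prod>l\<in>I - {i}. ennreal (F l (snd p))) * g (Q I (snd p))" .
    qed
    also have "\<dots> = (\<integral>\<^sup>+x. (\<Prod>l\<in>I - {i}. ennreal (F l x)) * g (Q I x) \<partial>D i)"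
      by (rule nn_integral_P_snd) measurable
    finally show ?thesis ..
  qed
  have meas_i: "(\<lambda>z. of_bool (\<forall>l\<in>I - {i}. snd (z l) < snd (z i)) * g (Q I (snd (z i)))) \<in> borel_measurable (PiM I P)"
    if i: "i \<in> I" for i
  proof -
    have [measurable]: "(\<lambda>z. snd (z i)) \<in> borel_measurable (PiM I P)"
      using i by (rule P_component)
    show ?thesis using i by measurable
  qed
  have "(\<Sum>i\<in>I. \<integral>\<^sup>+x. (\<Prod>l\<in>I - {i}. ennreal (F l x)) * g (Q I x) \<partial>D i) =
    (\<integral>\<^sup>+z. (\<Sum>i\<in>I. of_bool (\<forall>l\<in>I - {i}. snd (z l) < snd (z i)) * g (Q I (snd (z i)))) \<partial>PiM I P)"
    by (simp add: term_i nn_integral_sum meas_i)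
  also have "\<dots> = (\<integral>\<^sup>+z. g (Q I (Z_max I z)) \<partial>PiM I P)"
  proof (rule nn_integral_cong_AE)
    show "AE z in PiM I P. (\<Sum>i\<in>I. of_bool (\<forall>l\<in>I - {i}. snd (z l) < snd (z i)) * g (Q I (snd (z i)))) = g (Q I (Z_max I z))"
      using AE_PiM_P_distinct[OF I(1)]
    proof eventually_elim
      case (elim z)
      have "Z_max I z \<in> (\<lambda>l. snd (z l)) ` I" unfolding Z_max_def using I by (intro Max_in) auto
      then obtain j where j: "j \<in> I" "Z_max I z = snd (z j)" by auto
      have le: "snd (z l) \<le> snd (z j)" if "l \<in> I" for l
        using I that unfolding j(2)[symmetric] Z_max_def by auto
      have "(\<forall>l\<in>I - {i}. snd (z l) < snd (z i)) \<longleftrightarrow> i = j" if "i \<in> I" for i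
      proof
        assume *: "\<forall>l\<in>I - {i}. snd (z l) < snd (z i)"
        show "i = j"
        proof (rule ccontr)
          assume "i \<noteq> j"
          then show False using * j(1) le[OF that] by (auto simp: not_less[symmetric])
        qed
      next
        assume "i = j"
        then show "\<forall>l\<in>I - {i}. snd (z l) < snd (z i)"
          using le elim j(1) by (auto simp: less_le)
      qed
      then have "(\<Sum>i\<in>I. of_bool (\<forall>l\<in>I - {i}. snd (z l) < snd (z i)) * g (Q I (snd (z i)))) =
        (\<Sum>i\<in>I. if i = j then g (Q I (snd (z i))) else 0)"
        by (intro sum.cong) auto
      also have "\<dots> = g (Q I (Z_max I z))" using I j by simp
      finally show ?case .
    qed
  qed
  also have "\<dots> = (\<integral>\<^sup>+q. g q \<partial>distr (PiM I P) borel (\<lambda>z. Q I (Z_max I z)))"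
    by (rule nn_integral_distr[symmetric]) measurable
  finally show ?thesis unfolding distr_Q_Z_max[OF I] .
qed

end

section \<open>The success bound\<close>

context accepted_distributions
begin

text \<open>Success expressed through times and values only, with no presentation order;
  \<open>wins_imp_succeeds\<close> connects it with the actual game.\<close>

definition wins :: "nat set \<Rightarrow> (nat \<Rightarrow> real \<times> real) \<Rightarrow> bool" where
  "wins I z \<longleftrightarrow> (\<exists>i\<in>I. a (fst (z i)) (snd (z i)) \<and> (\<forall>l\<in>I - {i}. snd (z l) < snd (z i)) \<and>
     past_ok (I - {i}) (fst (z i)) z)"

text \<open>The products omit item \<open>i\<close>; completing them to \<open>Q\<close> costs a factor \<open>(F i m / F i x) powr T \<le> 1\<close>.\<close>

lemma weighted_prod_ge:
  assumes I: "finite I" "i \<in> I" and T: "0 < T" "T < 1" and x: "0 < Q I x" "Q I x \<le> 1"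
    and rej: "\<And>y. Q I y \<le> \<kappa> \<Longrightarrow> \<not> a s y" and \<kappa>: "\<kappa> < 1"
  shows "(\<Prod>l\<in>I - {i}. ennreal (F l x)) * ennreal (min 1 (max 0 \<kappa> / Q I x) powr T) \<le>
    (\<Prod>l\<in>I - {i}. ennreal (1 - T) * ennreal (F l x) + ennreal T * emeasure (D l) {y. y < x \<and> \<not> a s y})"
proof (cases "\<kappa> \<le> 0")
  case True
  then show ?thesis using x by simp
next
  case False
  \<comment> \<open>m is a \<kappa>-quantile of \<open>Q I\<close>, capped at x; every value below m
    has \<open>Q I\<close> at most \<kappa> and is therefore rejected at s.\<close>
  have "\<exists>m\<le>x. Q I m = min \<kappa> (Q I x)"
  proof (cases "Q I x \<le> \<kappa>")
    case False
    obtain b where b: "Q I b = \<kappa>" using Q_surj[of I \<kappa>] I \<open>\<not> \<kappa> \<le> 0\<close> \<kappa> by auto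
    then have "b \<le> x" using False Q_mono[of x b I] by linarith
    with b False show ?thesis by (intro exI[of _ b]) auto
  qed auto
  then obtain m where m: "m \<le> x" "Q I m = min \<kappa> (Q I x)" by blast
  have Fpos: "0 < F l x" if "l \<in> I" for l
    using x(1) that I F_nonneg[of l x] by (auto simp: Q_def less_le)
  define A B where "A = (\<Prod>l\<in>I - {i}. F l x)" and "B = (\<Prod>l\<in>I - {i}. F l m)"
  have AB: "0 < A" "0 \<le> B" unfolding A_def B_def using Fpos by (auto intro!: prod_pos prod_nonneg F_nonneg)
  have QA: "Q I x = F i x * A" "Q I m = F i m * B"
    unfolding Q_def A_def B_def using I by (simp_all add: prod.remove)
  have "min 1 (max 0 \<kappa> / Q I x) = Q I m / Q I x"
    using x False m(2) by (auto simp: min_def field_simps)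
  also have "\<dots> = (F i m / F i x) * (B / A)" unfolding QA by simp
  also have "\<dots> \<le> 1 * (B / A)"
    using Fpos[OF I(2)] F_mono[OF m(1), of i] AB by (intro mult_right_mono) auto
  finally have le: "min 1 (max 0 \<kappa> / Q I x) \<le> B / A" by simp
  have "A * min 1 (max 0 \<kappa> / Q I x) powr T \<le> A * (B / A) powr T"
    using AB T le x by (intro mult_left_mono powr_mono2) auto
  \<comment> \<open>In this form the two products can be matched factor by factor, with the weights
    1 - T and T of late and early arrival.\<close>
  also have "\<dots> = A powr (1 - T) * B powr T"
    using AB T by (simp add: powr_divide powr_diff field_simps)
  also have "\<dots> = (\<Prod>l\<in>I - {i}. F l x powr (1 - T) * F l m powr T)"
    unfolding A_def B_def by (simp add: prod.distrib prod_powr_distrib F_nonneg)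
  also have "\<dots> \<le> (\<Prod>l\<in>I - {i}. (1 - T) * F l x + T * F l m)"
    using T by (intro prod_mono conjI amgm_two_point F_nonneg) auto
  finally have real_le: "A * min 1 (max 0 \<kappa> / Q I x) powr T \<le> (\<Prod>l\<in>I - {i}. (1 - T) * F l x + T * F l m)" .
  have "(\<Prod>l\<in>I - {i}. ennreal (F l x)) * ennreal (min 1 (max 0 \<kappa> / Q I x) powr T)
    = ennreal (A * min 1 (max 0 \<kappa> / Q I x) powr T)"
    using AB by (simp add: A_def prod_ennreal F_nonneg ennreal_mult)
  also have "\<dots> \<le> ennreal (\<Prod>l\<in>I - {i}. (1 - T) * F l x + T * F l m)"
    by (rule ennreal_leI[OF real_le])
  also have "\<dots> = (\<Prod>l\<in>I - {i}. ennreal (1 - T) * ennreal (F l x) + ennreal T * ennreal (F l m))"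
    using T by (subst prod_ennreal[symmetric]) (auto simp: F_nonneg ennreal_mult)
  also have "\<dots> \<le> (\<Prod>l\<in>I - {i}. ennreal (1 - T) * ennreal (F l x) + ennreal T * emeasure (D l) {y. y < x \<and> \<not> a s y})"
  proof (intro prod_mono_ennreal add_left_mono mult_left_mono)
    fix l
    have "\<not> a s y" if "y < m" for y
      using that m(2) Q_mono[of y m I] by (intro rej) auto
    then have "{y. y < m} \<subseteq> {y. y < x \<and> \<not> a s y}" using m(1) by auto
    then have "emeasure (D l) {y. y < m} \<le> emeasure (D l) {y. y < x \<and> \<not> a s y}"
      by (rule emeasure_mono) measurable
    then show "ennreal (F l m) \<le> emeasure (D l) {y. y < x \<and> \<not> a s y}" by (simp add: emeasure_D_less)
  qed auto
  finally show ?thesis .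
qed

lemma past_ok_pred:
  assumes I: "finite I" "i \<in> I"
  shows "Measurable.pred (PiM I P) (\<lambda>z. past_ok (I - {i}) (fst (z i)) z)"
proof -
  have [measurable]: "finite (I - {i})" "finite (I - {i} - {j})" for j using I by auto
  show ?thesis unfolding past_ok_def not_less[symmetric] using I by measurable
qed

lemma past_ok_pred':
  assumes J: "finite J"
  shows "Measurable.pred (PiM J P) (past_ok J T)"
proof -
  have [measurable]: "finite J" "finite (J - {j})" for j using J by auto
  show ?thesis unfolding past_ok_def[abs_def] by measurable
qed

lemma wins_disjoint:
  assumes I: "finite I"
  shows "(of_bool (wins I z) :: ennreal) = (\<Sum>i\<in>I. of_bool (a (fst (z i)) (snd (z i)) \<and>
    (\<forall>l\<in>I - {i}. snd (z l) < snd (z i)) \<and> past_ok (I - {i}) (fst (z i)) z))"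
  unfolding wins_def
proof (rule sum_of_bool_unique[symmetric, OF I])
  fix i j
  assume ij: "i \<in> I" "j \<in> I"
    "a (fst (z i)) (snd (z i)) \<and> (\<forall>l\<in>I - {i}. snd (z l) < snd (z i)) \<and> past_ok (I - {i}) (fst (z i)) z"
    "a (fst (z j)) (snd (z j)) \<and> (\<forall>l\<in>I - {j}. snd (z l) < snd (z j)) \<and> past_ok (I - {j}) (fst (z j)) z"
  show "i = j"
  proof (rule ccontr)
    assume "i \<noteq> j"
    then have "snd (z i) < snd (z j)" "snd (z j) < snd (z i)" using ij by auto
    then show False by simp
  qed
qed

text \<open>The situation with item i fixed at time T and value x.
  \<open>nn_integral_past_ok\<close> writes the right side as an average over s; for each s,
  \<open>weighted_prod_ge\<close> is applied with \<kappa> = \<open>level s - \<delta>\<close>, the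
  height up to which rejection at time s is certain.\<close>

lemma past_ok_bound:
  assumes I: "finite I" "i \<in> I" and \<delta>: "0 \<le> \<delta>"
    and acc: "\<And>t x. level t + \<delta> \<le> Q I x \<Longrightarrow> a t x"
    and rej: "\<And>t x. t < 1 \<Longrightarrow> Q I x \<le> level t - \<delta> \<Longrightarrow> \<not> a t x"
  shows "(\<Prod>l\<in>I - {i}. ennreal (F l x)) * (\<integral>\<^sup>+s. ennreal (success_density \<delta> T s (Q I x)) \<partial>lborel) \<le>
    of_bool (a T x) * (\<integral>\<^sup>+z. of_bool ((\<forall>l\<in>I - {i}. snd (z l) < x) \<and> past_ok (I - {i}) T z) \<partial>PiM (I - {i}) P)"
proof (cases "0 < T \<and> T < 1 \<and> level T + \<delta> \<le> Q I x")
  case False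
  then have "success_density \<delta> T s (Q I x) = 0" for s
    unfolding success_density_def by (intro if_not_P) auto
  then show ?thesis by simp
next
  case True
  then have T: "0 < T" "T < 1" and a: "a T x" and Q: "0 < Q I x"
    using acc[of T x] level_pos[of T] \<delta> by auto
  have "(\<Prod>l\<in>I - {i}. ennreal (F l x)) * (\<integral>\<^sup>+s. ennreal (success_density \<delta> T s (Q I x)) \<partial>lborel)
    = (\<integral>\<^sup>+s. (\<Prod>l\<in>I - {i}. ennreal (F l x)) * ennreal (success_density \<delta> T s (Q I x)) \<partial>lborel)"
    by (rule nn_integral_cmult[symmetric]) measurable
  also have "\<dots> \<le> (\<integral>\<^sup>+s. ennreal (1 / T) * (\<integral>\<^sup>+z. of_bool ((\<forall>l\<in>I - {i}. snd (z l) < x) \<and> past_ok_at (I - {i}) T s z) \<partial>PiM (I - {i}) P)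
       * indicator {0<..<T} s \<partial>lborel)"
  proof (rule nn_integral_mono)
    fix s
    show "(\<Prod>l\<in>I - {i}. ennreal (F l x)) * ennreal (success_density \<delta> T s (Q I x)) \<le>
      ennreal (1 / T) * (\<integral>\<^sup>+z. of_bool ((\<forall>l\<in>I - {i}. snd (z l) < x) \<and> past_ok_at (I - {i}) T s z) \<partial>PiM (I - {i}) P)
       * indicator {0<..<T} s"
    proof (cases "0 < s \<and> s < T")
      case s: True
      then have "s < 1" using T by simp
      have sd: "success_density \<delta> T s (Q I x) = 1 / T * min 1 (max 0 (level s - \<delta>) / Q I x) powr T"
        using s True Q_le_1 by (simp add: success_density_def)
      have "(\<Prod>l\<in>I - {i}. ennreal (F l x)) * ennreal (success_density \<delta> T s (Q I x)) =
        ennreal (1 / T) * ((\<Prod>l\<in>I - {i}. ennreal (F l x)) * ennreal (min 1 (max 0 (level s - \<delta>) / Q I x) powr T))"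
        unfolding sd using T by (simp add: ennreal_mult' mult.left_commute del: times_divide_eq_left)
      also have "\<dots> \<le> ennreal (1 / T) * (\<Prod>l\<in>I - {i}. ennreal (1 - T) * ennreal (F l x) + ennreal T * emeasure (D l) {y. y < x \<and> \<not> a s y})"
        using rej[OF \<open>s < 1\<close>] level_less_1[of s] \<delta> Q_le_1
        by (intro mult_left_mono weighted_prod_ge I T Q) auto
      also have "\<dots> \<le> ennreal (1 / T) * (\<integral>\<^sup>+z. of_bool ((\<forall>l\<in>I - {i}. snd (z l) < x) \<and> past_ok_at (I - {i}) T s z) \<partial>PiM (I - {i}) P)"
        using I T by (intro mult_left_mono nn_integral_past_ok_at_ge) auto
      finally show ?thesis using s by simp
    next
      case False
      then have "success_density \<delta> T s (Q I x) = 0"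
        unfolding success_density_def by (intro if_not_P) auto
      then show ?thesis by simp
    qed
  qed
  also have "\<dots> = (\<integral>\<^sup>+z. of_bool ((\<forall>l\<in>I - {i}. snd (z l) < x) \<and> past_ok (I - {i}) T z) \<partial>PiM (I - {i}) P)"
    by (rule nn_integral_past_ok[symmetric]) (use I T in auto)
  finally show ?thesis using a by simp
qed

lemma past_ok_cong: "i \<notin> J \<Longrightarrow> past_ok J T (z(i := p)) \<longleftrightarrow> past_ok J T z"
  unfolding past_ok_def by (intro disj_cong ball_cong bex_cong conj_cong refl) (auto split: if_splits)

text \<open>The variable q of \<open>success_bound\<close> is uniform, hence distributed as
  \<open>Q I\<close> at the maximum; splitting by the item that attains the maximum reduces the
  claim to \<open>past_ok_bound\<close>.\<close>

lemma success_bound_le_wins: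
  assumes I: "finite I" "I \<noteq> {}" and \<delta>: "0 \<le> \<delta>"
    and acc: "\<And>t x. level t + \<delta> \<le> Q I x \<Longrightarrow> a t x"
    and rej: "\<And>t x. t < 1 \<Longrightarrow> Q I x \<le> level t - \<delta> \<Longrightarrow> \<not> a t x"
  shows "success_bound \<delta> \<le> (\<integral>\<^sup>+z. of_bool (wins I z) \<partial>PiM I P)"
proof -
  define g where "g T q = (\<integral>\<^sup>+s. ennreal (success_density \<delta> T s q) \<partial>lborel)" for T q
  have [measurable]: "(\<lambda>w. g (f w) (h w)) \<in> borel_measurable M"
    if [measurable]: "f \<in> borel_measurable M" "h \<in> borel_measurable M" for f h and M :: "'c measure"
    unfolding g_def by measurable
  have F_meas[measurable]: "F l \<in> borel_measurable borel" for l
    by (intro borel_measurable_continuous_onI F_cont)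
  \<comment> \<open>\<open>g\<close> vanishes outside the unit square, so Lebesgue measure may be
    replaced by \<open>uniform01\<close> in T and in q.\<close>
  have g0: "g T q = 0" if "T \<notin> {0..1} \<or> q \<notin> {0..1}" for T q
  proof -
    have "success_density \<delta> T s q = 0" for s
      unfolding success_density_def using that level_nonneg[of T] \<delta> by (intro if_not_P) auto
    then show ?thesis by (simp add: g_def)
  qed
  have g0': "g T = (\<lambda>_. 0)" if "T \<notin> {0..1}" for T
    using g0 that by blast
  have "success_bound \<delta> = (\<integral>\<^sup>+T. \<integral>\<^sup>+q. g T q \<partial>lborel \<partial>lborel)"
    unfolding success_bound_def g_def
    by (intro nn_integral_cong lborel_pair.Fubini') measurable
  also have "\<dots> = (\<integral>\<^sup>+T. \<integral>\<^sup>+q. g T q \<partial>uniform01 \<partial>uniform01)"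
  proof -
    have "(\<integral>\<^sup>+q. g T q \<partial>uniform01) = (\<integral>\<^sup>+q. g T q \<partial>lborel)" for T
      by (subst nn_integral_uniform01, measurable, intro nn_integral_cong) (auto simp: indicator_def g0)
    moreover have "(\<integral>\<^sup>+T. \<integral>\<^sup>+q. g T q \<partial>lborel \<partial>uniform01) = (\<integral>\<^sup>+T. \<integral>\<^sup>+q. g T q \<partial>lborel \<partial>lborel)"
      by (subst nn_integral_uniform01, measurable, intro nn_integral_cong) (auto simp: indicator_def g0')
    ultimately show ?thesis by simp
  qed
  \<comment> \<open>\<open>nn_integral_max\<close> read from right to left: the distributions enter
    here.\<close>
  also have "\<dots> = (\<integral>\<^sup>+T. (\<Sum>i\<in>I. \<integral>\<^sup>+x. (\<Prod>l\<in>I - {i}. ennreal (F l x)) * g T (Q I x) \<partial>D i) \<partial>uniform01)"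
    by (intro nn_integral_cong nn_integral_max[symmetric] I) measurable
  also have "\<dots> = (\<Sum>i\<in>I. \<integral>\<^sup>+T. \<integral>\<^sup>+x. (\<Prod>l\<in>I - {i}. ennreal (F l x)) * g T (Q I x) \<partial>D i \<partial>uniform01)"
  proof (rule nn_integral_sum)
    fix i
    interpret prob_space "D i" by (rule D_prob)
    show "(\<lambda>T. \<integral>\<^sup>+x. (\<Prod>l\<in>I - {i}. ennreal (F l x)) * g T (Q I x) \<partial>D i) \<in> borel_measurable uniform01"
      by measurable
  qed
  also have "\<dots> = (\<Sum>i\<in>I. \<integral>\<^sup>+p. (\<Prod>l\<in>I - {i}. ennreal (F l (snd p))) * g (fst p) (Q I (snd p)) \<partial>P i)"
    by (subst nn_integral_P) auto
  also have "\<dots> \<le> (\<Sum>i\<in>I. \<integral>\<^sup>+z. of_bool (a (fst (z i)) (snd (z i)) \<and>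
      (\<forall>l\<in>I - {i}. snd (z l) < snd (z i)) \<and> past_ok (I - {i}) (fst (z i)) z) \<partial>PiM I P)"
  proof (rule sum_mono)
    fix i assume i: "i \<in> I"
    have eq: "insert i (I - {i}) = I" using i by auto
    have [measurable]: "finite (I - {i})" using I by auto
    note [measurable] = past_ok_pred[OF I(1) i] past_ok_pred'[OF \<open>finite (I - {i})\<close>]
    have 1: "(\<lambda>z. of_bool (a (fst (z i)) (snd (z i)) \<and> (\<forall>l\<in>I - {i}. snd (z l) < snd (z i)) \<and> past_ok (I - {i}) (fst (z i)) z) :: ennreal)
      \<in> borel_measurable (PiM I P)"
      using i by measurable
    have "(\<integral>\<^sup>+p. (\<Prod>l\<in>I - {i}. ennreal (F l (snd p))) * g (fst p) (Q I (snd p)) \<partial>P i) \<le>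
      (\<integral>\<^sup>+p. of_bool (a (fst p) (snd p)) * (\<integral>\<^sup>+z. of_bool ((\<forall>l\<in>I - {i}. snd (z l) < snd p) \<and> past_ok (I - {i}) (fst p) z) \<partial>PiM (I - {i}) P) \<partial>P i)"
      unfolding g_def by (intro nn_integral_mono past_ok_bound I i \<delta> acc rej)
    also have "\<dots> = (\<integral>\<^sup>+p. \<integral>\<^sup>+z. of_bool (a (fst ((z(i := p)) i)) (snd ((z(i := p)) i)) \<and>
       (\<forall>l\<in>I - {i}. snd ((z(i := p)) l) < snd ((z(i := p)) i)) \<and> past_ok (I - {i}) (fst ((z(i := p)) i)) (z(i := p))) \<partial>PiM (I - {i}) P \<partial>P i)"
    proof (rule nn_integral_cong)
      fix p
      show "of_bool (a (fst p) (snd p)) * (\<integral>\<^sup>+z. of_bool ((\<forall>l\<in>I - {i}. snd (z l) < snd p) \<and> past_ok (I - {i}) (fst p) z) \<partial>PiM (I - {i}) P) =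
        (\<integral>\<^sup>+z. of_bool (a (fst ((z(i := p)) i)) (snd ((z(i := p)) i)) \<and>
       (\<forall>l\<in>I - {i}. snd ((z(i := p)) l) < snd ((z(i := p)) i)) \<and> past_ok (I - {i}) (fst ((z(i := p)) i)) (z(i := p))) \<partial>PiM (I - {i}) P)"
        by (cases "a (fst p) (snd p)") (auto simp: past_ok_cong intro!: nn_integral_cong)
    qed
    also have "\<dots> = (\<integral>\<^sup>+z. of_bool (a (fst (z i)) (snd (z i)) \<and>
      (\<forall>l\<in>I - {i}. snd (z l) < snd (z i)) \<and> past_ok (I - {i}) (fst (z i)) z) \<partial>PiM I P)"
      using P.product_nn_integral_insert_rev[of "I - {i}" i "\<lambda>z. of_bool (a (fst (z i)) (snd (z i)) \<and>
        (\<forall>l\<in>I - {i}. snd (z l) < snd (z i)) \<and> past_ok (I - {i}) (fst (z i)) z)"] I 1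
      unfolding eq by simp
    finally show "(\<integral>\<^sup>+p. (\<Prod>l\<in>I - {i}. ennreal (F l (snd p))) * g (fst p) (Q I (snd p)) \<partial>P i) \<le> \<dots>" .
  qed
  also have "\<dots> = (\<integral>\<^sup>+z. of_bool (wins I z) \<partial>PiM I P)"
    unfolding wins_disjoint[OF I(1)]
  proof (rule nn_integral_sum[symmetric])
    fix i assume i: "i \<in> I"
    have [measurable]: "finite (I - {i})" using I by auto
    note [measurable] = past_ok_pred[OF I(1) i]
    show "(\<lambda>z. of_bool (a (fst (z i)) (snd (z i)) \<and> (\<forall>l\<in>I - {i}. snd (z l) < snd (z i)) \<and> past_ok (I - {i}) (fst (z i)) z) :: ennreal)
      \<in> borel_measurable (PiM I P)"
      using i by measurable
  qed
  finally show ?thesis .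
qed

end

section \<open>Empirical distribution of the maximum\<close>

lemma (in product_prob_space) indep_vars_PiM_component:
  assumes "I \<noteq> {}"
  shows "P.indep_vars M (\<lambda>i x. x i) I"
proof -
  have "distr (PiM I M) (PiM I M) (\<lambda>x. \<lambda>i\<in>I. x i) = distr (PiM I M) (PiM I M) (\<lambda>x. x)"
    by (intro distr_cong refl) (auto simp: space_PiM PiE_iff extensional_restrict)
  also have "\<dots> = PiM I (\<lambda>i. distr (PiM I M) (M i) (\<lambda>x. x i))"
    unfolding distr_id by (intro PiM_cong refl PiM_component[symmetric])
  finally show ?thesis
    by (subst P.indep_vars_iff_distr_eq_PiM') (use assms in auto)
qed

text \<open>The j-th draws from all n distributions form one sampled maximum, so N draws from each
  give N independent copies of the maximum whatever n is. As a conjunction the condition has a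
  product as its probability.\<close>

definition below_max :: "nat \<Rightarrow> real \<Rightarrow> (nat \<times> nat \<Rightarrow> real) \<Rightarrow> nat \<Rightarrow> bool" where
  "below_max n x s j \<longleftrightarrow> (\<forall>i<n. s (i, j) \<le> x)"

definition emp_cdf :: "nat \<Rightarrow> nat \<Rightarrow> (nat \<times> nat \<Rightarrow> real) \<Rightarrow> real \<Rightarrow> real" where
  "emp_cdf n N s x = (\<Sum>j<N. of_bool (below_max n x s j)) / real N"

lemma emp_cdf_mono: "x \<le> y \<Longrightarrow> emp_cdf n N s x \<le> emp_cdf n N s y"
  unfolding emp_cdf_def below_max_def
  by (intro divide_right_mono sum_mono) (force simp: of_bool_def)+

lemma emp_cdf_nonneg: "0 \<le> emp_cdf n N s x"
  unfolding emp_cdf_def by (intro divide_nonneg_nonneg sum_nonneg) auto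

lemma emp_cdf_le_1: "emp_cdf n N s x \<le> 1"
proof -
  have "(\<Sum>j<N. of_bool (below_max n x s j)) \<le> (\<Sum>j<N. 1::real)" by (intro sum_mono) auto
  then show ?thesis unfolding emp_cdf_def by (simp add: divide_le_eq)
qed

section \<open>Concentration of the empirical distribution function\<close>

context continuous_distributions
begin

abbreviation sample_space :: "nat \<Rightarrow> nat \<Rightarrow> (nat \<times> nat \<Rightarrow> real) measure" where
  "sample_space n N \<equiv> PiM ({..<n} \<times> {..<N}) (\<lambda>(i, j). D i)"

lemma prob_space_sample: "prob_space (sample_space n N)"
  by (intro prob_space_PiM) (auto intro: D_prob)

text \<open>Hoeffding's inequality for N independent indicators with mean \<open>Q {..<n} x\<close>;
  the number n of distributions enters only through this mean, not through the bound.\<close>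

lemma emp_cdf_deviation:
  assumes n: "n \<ge> 1" and N: "N \<ge> 1" and d: "d \<ge> 0"
  shows "{s \<in> space (sample_space n N). d \<le> \<bar>emp_cdf n N s x - Q {..<n} x\<bar>} \<in> sets (sample_space n N)"
    and "measure (sample_space n N) {s \<in> space (sample_space n N). d \<le> \<bar>emp_cdf n N s x - Q {..<n} x\<bar>}
      \<le> 2 * exp (- 2 * real N * d\<^sup>2)"
proof -
  let ?K = "{..<n} \<times> {..<N}" and ?M = "\<lambda>(i, j :: nat). D i"
  interpret S: prob_space "sample_space n N" by (rule prob_space_sample)
  interpret PS: product_prob_space ?M ?K
    by (rule product_prob_spaceI) (auto intro: D_prob)
  define X where "X j s = (of_bool (below_max n x s j) :: real)" for j s
  have comp[measurable]: "(\<lambda>s. s (i, j)) \<in> borel_measurable (sample_space n N)" if "i < n" "j < N" for i j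
    using measurable_component_singleton[of "(i, j)" ?K ?M] that by (simp cong: measurable_cong_sets)
  have pred: "Measurable.pred (sample_space n N) (\<lambda>s. below_max n x s j)" if "j < N" for j
    unfolding below_max_def
  proof -
    have [measurable]: "Measurable.pred (sample_space n N) (\<lambda>s. s (i, j) \<le> x)" if "i < n" for i
      using comp[OF that \<open>j < N\<close>] by measurable
    show "Measurable.pred (sample_space n N) (\<lambda>s. \<forall>i<n. s (i, j) \<le> x)"
      by measurable
  qed
  have X_meas[measurable]: "X j \<in> borel_measurable (sample_space n N)" if "j < N" for j
    unfolding X_def[abs_def] of_bool_def using pred[OF that] by measurable
  have dev[measurable]: "(\<lambda>s. \<Sum>j<N. X j s) \<in> borel_measurable (sample_space n N)"
    by (intro borel_measurable_sum X_meas) auto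
  have emp: "emp_cdf n N s x = (\<Sum>j<N. X j s) / real N" for s
    by (simp add: emp_cdf_def X_def)
  show "{s \<in> space (sample_space n N). d \<le> \<bar>emp_cdf n N s x - Q {..<n} x\<bar>} \<in> sets (sample_space n N)"
    unfolding emp by measurable
  have EX: "S.expectation (X j) = Q {..<n} x" if j: "j < N" for j
  proof -
    have set_eq: "{s \<in> space (sample_space n N). below_max n x s j} = {s \<in> space (sample_space n N). \<forall>k\<in>{..<n} \<times> {j}. s k \<in> {..x}}"
      by (auto simp: below_max_def)
    have "emeasure (sample_space n N) {s \<in> space (sample_space n N). below_max n x s j} = (\<Prod>k\<in>{..<n} \<times> {j}. emeasure (?M k) {..x})"
      unfolding set_eq by (rule PS.emeasure_PiM_Collect) (use j in auto)
    also have "\<dots> = (\<Prod>i<n. emeasure (D i) {..x})"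
      by (rule prod.reindex_bij_witness[of _ "\<lambda>i. (i, j)" fst]) auto
    also have "\<dots> = ennreal (Q {..<n} x)"
      using emeasure_D_le unfolding Q_def by (simp add: prod_ennreal F_nonneg atMost_def)
    finally have "S.prob {s \<in> space (sample_space n N). below_max n x s j} = Q {..<n} x"
      by (simp add: S.emeasure_eq_measure Q_nonneg)
    moreover have "S.expectation (X j) = S.expectation (indicator {s \<in> space (sample_space n N). below_max n x s j})"
      by (intro Bochner_Integration.integral_cong) (auto simp: X_def indicator_def)
    ultimately show ?thesis using pred[OF j] by simp
  qed
  have indep: "S.indep_vars (\<lambda>_. borel) X {..<N}"
  proof -
    have "S.indep_vars ?M (\<lambda>k s. s k) ?K"
      using n N by (intro PS.indep_vars_PiM_component) (auto simp: lessThan_empty_iff bot_nat_def)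
    \<comment> \<open>Different j read disjoint blocks of coordinates.\<close>
    then have "S.indep_vars (\<lambda>j. PiM ({..<n} \<times> {j}) ?M) (\<lambda>j s. restrict (\<lambda>k. s k) ({..<n} \<times> {j})) {..<N}"
      by (rule S.indep_vars_restrict) (auto simp: disjoint_family_on_def)
    then have "S.indep_vars (\<lambda>_. borel) (\<lambda>j s. X j (restrict (\<lambda>k. s k) ({..<n} \<times> {j}))) {..<N}"
    proof (rule S.indep_vars_compose2[where Y=X])
      fix j
      have [measurable]: "Measurable.pred (PiM ({..<n} \<times> {j}) ?M) (\<lambda>s. s (i, j) \<le> x)" if "i < n" for i
      proof -
        have "(\<lambda>s. s (i, j)) \<in> borel_measurable (PiM ({..<n} \<times> {j}) ?M)"
          using measurable_component_singleton[of "(i, j)" "{..<n} \<times> {j}" ?M] that by (simp cong: measurable_cong_sets)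
        then show ?thesis by measurable
      qed
      have [measurable]: "Measurable.pred (PiM ({..<n} \<times> {j}) ?M) (\<lambda>s. below_max n x s j)"
        unfolding below_max_def by measurable
      show "X j \<in> borel_measurable (PiM ({..<n} \<times> {j}) ?M)"
        unfolding X_def[abs_def] of_bool_def by measurable
    qed
    moreover have "X j (restrict (\<lambda>k. s k) ({..<n} \<times> {j})) = X j s" for j s
      by (simp add: X_def below_max_def)
    ultimately show ?thesis by simp
  qed
  interpret H: Hoeffding_ineq "sample_space n N" "{..<N}" X "\<lambda>_. 0" "\<lambda>_. 1" "\<Sum>j<N. S.expectation (X j)"
    by unfold_locales (auto simp: indep X_def)
  have mu: "(\<Sum>j<N. S.expectation (X j)) = real N * Q {..<n} x" by (simp add: EX)
  have "{s \<in> space (sample_space n N). d \<le> \<bar>emp_cdf n N s x - Q {..<n} x\<bar>} =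
    {s \<in> space (sample_space n N). real N * d \<le> \<bar>(\<Sum>j<N. X j s) - (\<Sum>j<N. S.expectation (X j))\<bar>}"
  proof -
    have "d \<le> \<bar>emp_cdf n N s x - Q {..<n} x\<bar> \<longleftrightarrow> real N * d \<le> \<bar>(\<Sum>j<N. X j s) - real N * Q {..<n} x\<bar>" for s
    proof -
      have "(\<Sum>j<N. X j s) - real N * Q {..<n} x = real N * (emp_cdf n N s x - Q {..<n} x)"
        using N by (simp add: emp field_simps)
      then show ?thesis using N by (simp add: abs_mult)
    qed
    then show ?thesis by (simp add: mu)
  qed
  also have "S.prob \<dots> \<le> 2 * exp (- 2 * (real N * d)\<^sup>2 / (\<Sum>j<N. (1 - 0)\<^sup>2))"
    by (rule H.Hoeffding_ineq_abs_ge) (use N d in auto)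
  also have "- 2 * (real N * d)\<^sup>2 / (\<Sum>j<N. (1 - 0)\<^sup>2) = - 2 * real N * d\<^sup>2"
    using N by (simp add: power2_eq_square)
  finally show "S.prob {s \<in> space (sample_space n N). d \<le> \<bar>emp_cdf n N s x - Q {..<n} x\<bar>} \<le> 2 * exp (- 2 * real N * d\<^sup>2)" .
qed

text \<open>The Glivenko-Cantelli argument: control at K - 1 quantiles, a union bound, and
  monotonicity in between. Of the error 2/K, one half is the deviation at a quantile and one half
  the gap between neighbouring quantiles. Placing the grid at the heights of \<open>Q\<close> makes
  its size independent of the distributions.\<close>

lemma emp_cdf_close:
  assumes n: "n \<ge> 1" and N: "N \<ge> 1" and K: "K \<ge> 1"
  shows "\<exists>G\<in>sets (sample_space n N). 1 - 2 * real K * exp (- 2 * real N / (real K)\<^sup>2) \<le> measure (sample_space n N) G \<and>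
    (\<forall>s\<in>G. \<forall>x. \<bar>emp_cdf n N s x - Q {..<n} x\<bar> < 2 / real K)"
proof -
  interpret S: prob_space "sample_space n N" by (rule prob_space_sample)
  have ne: "finite {..<n}" "{..<n} \<noteq> {}" using n by (auto simp: lessThan_empty_iff bot_nat_def)
  have "\<exists>b. Q {..<n} b = real g / real K" if "g \<in> {1..<K}" for g
    using that by (intro Q_surj ne) auto
  then obtain b where b: "\<And>g. g \<in> {1..<K} \<Longrightarrow> Q {..<n} (b g) = real g / real K" by metis
  define B where "B g = {s \<in> space (sample_space n N). 1 / real K \<le> \<bar>emp_cdf n N s (b g) - Q {..<n} (b g)\<bar>}" for g
  have B_sets: "B g \<in> sets (sample_space n N)" for g
    unfolding B_def by (intro emp_cdf_deviation(1) n N) auto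
  define G where "G = space (sample_space n N) - (\<Union>g\<in>{1..<K}. B g)"
  have G: "G \<in> sets (sample_space n N)" unfolding G_def using B_sets by auto
  have "S.prob (\<Union>g\<in>{1..<K}. B g) \<le> (\<Sum>g\<in>{1..<K}. S.prob (B g))"
    by (intro S.finite_measure_subadditive_finite) (use B_sets in auto)
  also have "\<dots> \<le> (\<Sum>g\<in>{1..<K}. 2 * exp (- 2 * real N * (1 / real K)\<^sup>2))"
    unfolding B_def by (intro sum_mono emp_cdf_deviation(2) n N) auto
  also have "\<dots> \<le> real K * (2 * exp (- 2 * real N * (1 / real K)\<^sup>2))"
    by (simp add: mult_right_mono)
  finally have "S.prob (\<Union>g\<in>{1..<K}. B g) \<le> 2 * real K * exp (- 2 * real N / (real K)\<^sup>2)"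
    by (simp add: power_divide)
  moreover have "S.prob G = 1 - S.prob (\<Union>g\<in>{1..<K}. B g)"
    unfolding G_def by (rule S.prob_compl) (use B_sets in auto)
  moreover have "\<bar>emp_cdf n N s x - Q {..<n} x\<bar> < 2 / real K" if s: "s \<in> G" for s x
  proof -
    have close: "\<bar>emp_cdf n N s (b g) - real g / real K\<bar> < 1 / real K" if "g \<in> {1..<K}" for g
    proof -
      have "s \<in> space (sample_space n N)" "s \<notin> B g" using s that by (auto simp: G_def)
      then show ?thesis unfolding b[OF that, symmetric] by (simp add: B_def not_le)
    qed
    let ?q = "Q {..<n} x" and ?e = "emp_cdf n N s x"
    have K0: "real K > 0" using K by simp
    \<comment> \<open>g/K is the last grid height strictly below \<open>?q\<close>; strictness gives
      \<open>b g \<le> x\<close> even where \<open>Q\<close> is flat. If \<open>?q\<close> is at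
      most 1/K, there is no such g \<ge> 1, but \<open>?e\<close> \<ge> 0 suffices.\<close>
    have lower: "?q - 2 / real K < ?e"
    proof (cases "real K * ?q \<le> 1")
      case True
      then have "?q \<le> 1 / real K" using K0 by (simp add: field_simps)
      moreover have "1 / real K < 2 / real K" using K0 by (simp add: divide_strict_right_mono)
      ultimately show ?thesis using emp_cdf_nonneg[of n N s x] by linarith
    next
      case False
      define g where "g = nat (\<lceil>real K * ?q\<rceil> - 1)"
      have g: "real g < real K * ?q" "real K * ?q \<le> real g + 1" "1 \<le> g"
        using False unfolding g_def by linarith+
      have "real K * ?q \<le> real K" using Q_le_1[of "{..<n}" x] K0 by simp
      then have gK: "g \<in> {1..<K}" using g by auto
      have "Q {..<n} (b g) < ?q" unfolding b[OF gK] using g K0 by (simp add: field_simps)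
      then have "b g \<le> x" using Q_mono[of x "b g" "{..<n}"] by linarith
      then have "emp_cdf n N s (b g) \<le> ?e" by (rule emp_cdf_mono)
      moreover have "?q \<le> real g / real K + 1 / real K" using g K0 by (simp add: field_simps)
      ultimately show ?thesis using close[OF gK] by (simp add: abs_less_iff)
    qed
    \<comment> \<open>Symmetrically, g/K is the first grid height strictly above \<open>?q\<close>,
      and close to height 1 the bound \<open>?e\<close> \<le> 1 replaces the missing
      quantile.\<close>
    have upper: "?e < ?q + 2 / real K"
    proof (cases "real K * ?q < real K - 1")
      case False
      then have "1 \<le> ?q + 1 / real K" using K0 by (simp add: field_simps)
      moreover have "1 / real K < 2 / real K" using K0 by (simp add: divide_strict_right_mono)
      ultimately show ?thesis using emp_cdf_le_1[of n N s x] by linarith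
    next
      case True
      define g where "g = nat (\<lfloor>real K * ?q\<rfloor> + 1)"
      have "0 \<le> real K * ?q" using K0 Q_nonneg by simp
      then have g: "real K * ?q < real g" "real g \<le> real K * ?q + 1" "1 \<le> g"
        unfolding g_def by linarith+
      then have gK: "g \<in> {1..<K}" using True by auto
      have "?q < Q {..<n} (b g)" unfolding b[OF gK] using g K0 by (simp add: field_simps)
      then have "x \<le> b g" using Q_mono[of "b g" x "{..<n}"] by linarith
      then have "?e \<le> emp_cdf n N s (b g)" by (rule emp_cdf_mono)
      moreover have "real g / real K \<le> ?q + 1 / real K" using g K0 by (simp add: field_simps)
      ultimately show ?thesis using close[OF gK] by (simp add: abs_less_iff)
    qed
    show ?thesis using lower upper by linarith
  qed
  ultimately show ?thesis by (intro bexI[OF _ G] conjI) auto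
qed

end

lemma sample_size_exists:
  assumes "K \<ge> 1" "\<eta> > 0"
  shows "\<exists>N\<ge>1. 2 * real K * exp (- 2 * real N / (real K)\<^sup>2) \<le> \<eta>"
proof -
  define c where "c = 2 / (real K)\<^sup>2"
  have c: "c > 0" using assms by (simp add: c_def)
  then have "(\<lambda>N. exp (- c * real N)) \<longlonglongrightarrow> 0" by real_asymp
  then have "(\<lambda>N. 2 * real K * exp (- c * real N)) \<longlonglongrightarrow> 0" by (rule tendsto_mult_right_zero)
  then have "eventually (\<lambda>N. 2 * real K * exp (- c * real N) < \<eta>) sequentially"
    using assms by (intro order_tendstoD) auto
  then have "eventually (\<lambda>N. 1 \<le> N \<and> 2 * real K * exp (- c * real N) < \<eta>) sequentially"
    using eventually_ge_at_top[of 1] by eventually_elim auto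
  from eventually_happens'[OF sequentially_bot this]
  obtain N where "1 \<le> N" "2 * real K * exp (- c * real N) < \<eta>"
    by blast
  moreover have "- c * real N = - 2 * real N / (real K)\<^sup>2" by (simp add: c_def)
  ultimately show ?thesis by (intro exI[of _ N]) (simp add: less_imp_le)
qed

section \<open>The algorithm\<close>

definition arrival_rank :: "nat \<Rightarrow> (nat \<Rightarrow> real) \<Rightarrow> nat \<Rightarrow> nat" where
  "arrival_rank n r i = card {j \<in> {..<n}. r j < r i}"

text \<open>\<open>r i\<close> is merely the i-th internal random number, not a time attached to
  distribution i: step t receives the t-th smallest of the first n numbers, counted from 0 and up to
  ties. The rule thus uses no identity of the shown value.\<close>

definition sampling_algorithm :: "nat \<Rightarrow> nat \<Rightarrow> algorithm" where
  "sampling_algorithm n N t r s h \<longleftrightarrow>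
     (\<exists>i<n. arrival_rank n r i = t \<and> level (r i) \<le> emp_cdf n N s (h t) \<and> (\<forall>u<t. h u \<le> h t))"

lemma arrival_rank_less: "i < n \<Longrightarrow> arrival_rank n r i < n"
proof -
  assume "i < n"
  then have "{j \<in> {..<n}. r j < r i} \<subset> {..<n}" by auto
  from psubset_card_mono[OF _ this] show ?thesis by (simp add: arrival_rank_def)
qed

lemma arrival_rank_strict_mono:
  assumes "i < n" "r i < r j"
  shows "arrival_rank n r i < arrival_rank n r j"
  unfolding arrival_rank_def
proof (rule psubset_card_mono)
  have "i \<in> {k \<in> {..<n}. r k < r j}" "i \<notin> {k \<in> {..<n}. r k < r i}" using assms by auto
  moreover have "{k \<in> {..<n}. r k < r i} \<subseteq> {k \<in> {..<n}. r k < r j}" using assms by auto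
  ultimately show "{k \<in> {..<n}. r k < r i} \<subset> {k \<in> {..<n}. r k < r j}" by blast
qed simp

lemma arrival_rank_less_iff:
  assumes "i < n" "j < n"
  shows "arrival_rank n r i < arrival_rank n r j \<longleftrightarrow> r i < r j"
  using arrival_rank_strict_mono[of i n r j] arrival_rank_strict_mono[of j n r i] assms
  by (cases "r i" "r j" rule: linorder_cases) (auto simp: arrival_rank_def)

text \<open>The identity outside \<open>{..<n}\<close> makes this a permutation in the sense of
  \<open>permutes\<close>, which can be inverted and composed with presentation orders.\<close>

definition rank_perm :: "nat \<Rightarrow> (nat \<Rightarrow> real) \<Rightarrow> nat \<Rightarrow> nat" where
  "rank_perm n r i = (if i < n then arrival_rank n r i else i)"

lemma rank_perm_permutes:
  assumes "\<And>i j. i < n \<Longrightarrow> j < n \<Longrightarrow> i \<noteq> j \<Longrightarrow> r i \<noteq> r j"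
  shows "rank_perm n r permutes {..<n}"
proof (rule bij_imp_permutes)
  have "inj_on (rank_perm n r) {..<n}"
  proof (rule inj_onI)
    fix i j assume ij: "i \<in> {..<n}" "j \<in> {..<n}" "rank_perm n r i = rank_perm n r j"
    then have "\<not> r i < r j" "\<not> r j < r i"
      using arrival_rank_less_iff[of i n j r] arrival_rank_less_iff[of j n i r] by (auto simp: rank_perm_def)
    then show "i = j" using assms[of i j] ij by auto
  qed
  moreover have "rank_perm n r ` {..<n} \<subseteq> {..<n}" by (auto simp: rank_perm_def arrival_rank_less)
  ultimately show "bij_betw (rank_perm n r) {..<n} {..<n}"
    unfolding bij_betw_def by (intro conjI endo_inj_surj) auto
qed (simp add: rank_perm_def)

text \<open>Here \<rho> i is the index of the value arriving at time \<open>r i\<close>. Only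
  premature acceptance has to be excluded: if k were accepted before the maximum, the best value j
  before the maximum, rejected by \<open>past_ok\<close>, would exceed k and arrive no earlier,
  hence would have been acceptable too.\<close>

lemma wins_imp_succeeds:
  fixes n N :: nat and s :: "nat \<times> nat \<Rightarrow> real" and D' :: "nat \<Rightarrow> real measure"
  defines "a \<equiv> \<lambda>t y. level t \<le> emp_cdf n N s y"
  assumes distinct: "\<And>i j. i < n \<Longrightarrow> j < n \<Longrightarrow> i \<noteq> j \<Longrightarrow> r i \<noteq> r j"
    and \<rho>: "\<rho> permutes {..<n}" and acc: "accepted_distributions D' a"
    and wins: "accepted_distributions.wins a {..<n} (\<lambda>i\<in>{..<n}. (r i, x (\<rho> i)))"
  shows "succeeds n (sampling_algorithm n N) r s x (\<rho> \<circ> inv (rank_perm n r))"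
proof -
  interpret accepted_distributions D' a by (rule acc)
  define \<sigma> where "\<sigma> = \<rho> \<circ> inv (rank_perm n r)"
  have perm: "rank_perm n r permutes {..<n}" by (rule rank_perm_permutes[OF distinct])
  have \<sigma>: "\<sigma> (arrival_rank n r l) = \<rho> l" if "l < n" for l
    using permutes_inverses(2)[OF perm, of l] that by (simp add: \<sigma>_def rank_perm_def)
  have rank_surj: "\<exists>l<n. arrival_rank n r l = u" if "u < n" for u
  proof -
    have "u \<in> rank_perm n r ` {..<n}" using permutes_image[OF perm] that by simp
    then show ?thesis by (auto simp: rank_perm_def)
  qed
  from wins obtain i where i: "i < n" "a (r i) (x (\<rho> i))"
    "\<And>l. l < n \<Longrightarrow> l \<noteq> i \<Longrightarrow> x (\<rho> l) < x (\<rho> i)"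
    and past: "past_ok ({..<n} - {i}) (r i) (\<lambda>i\<in>{..<n}. (r i, x (\<rho> i)))"
    unfolding wins_def by (auto split: if_splits)
  have le: "x (\<rho> l) \<le> x (\<rho> i)" if "l < n" for l
    using i(3)[OF that] by (cases "l = i") auto
  let ?t = "arrival_rank n r i"
  have t: "?t < n" by (rule arrival_rank_less[OF i(1)])
  have "sampling_algorithm n N ?t r s (restrict (x \<circ> \<sigma>) {..?t})"
    unfolding sampling_algorithm_def
  proof (intro exI[of _ i] conjI allI impI)
    fix u assume u: "u < ?t"
    then obtain l where "l < n" "arrival_rank n r l = u" using rank_surj t by (meson less_trans)
    then show "restrict (x \<circ> \<sigma>) {..?t} u \<le> restrict (x \<circ> \<sigma>) {..?t} ?t"
      using u \<sigma>[of l] \<sigma>[OF i(1)] le[of l] by auto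
  qed (use i \<sigma>[OF i(1)] in \<open>auto simp: a_def\<close>)
  moreover have "\<not> sampling_algorithm n N u r s (restrict (x \<circ> \<sigma>) {..u})" if u: "u < ?t" for u
  proof
    assume "sampling_algorithm n N u r s (restrict (x \<circ> \<sigma>) {..u})"
    then obtain k where k: "k < n" "arrival_rank n r k = u" "a (r k) (x (\<rho> k))"
      and rec: "\<And>v. v < u \<Longrightarrow> x (\<sigma> v) \<le> x (\<rho> k)"
      unfolding sampling_algorithm_def using \<sigma> by (auto simp: a_def)
    have ki: "r k < r i" "k \<noteq> i"
      using u k arrival_rank_less_iff[of k n i r] i(1) by auto
    \<comment> \<open>k arrives before i, which rules out the alternative of \<open>past_ok\<close>
      that nothing came earlier.\<close>
    then obtain j where j: "j < n" "j \<noteq> i" "r j < r i" "\<not> a (r j) (x (\<rho> j))"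
      and best: "\<And>l. l < n \<Longrightarrow> l \<noteq> i \<Longrightarrow> l \<noteq> j \<Longrightarrow> r l < r i \<Longrightarrow> x (\<rho> l) < x (\<rho> j)"
      using past k(1) unfolding past_ok_def by (fastforce split: if_splits)
    have "k \<noteq> j" using j k by auto
    then have kj: "x (\<rho> k) < x (\<rho> j)" using best k(1) ki by auto
    \<comment> \<open>k was a record when shown, so the larger value of j was not shown before
      it.\<close>
    have "\<not> r j < r k"
    proof
      assume "r j < r k"
      then have "arrival_rank n r j < u" using arrival_rank_less_iff[of j n k r] j(1) k by auto
      from rec[OF this] \<sigma>[OF j(1)] kj show False by simp
    qed
    then have "level (r j) \<le> level (r k)" by (intro level_antimono) simp
    also have "\<dots> \<le> emp_cdf n N s (x (\<rho> k))" using k by (simp add: a_def)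
    also have "\<dots> \<le> emp_cdf n N s (x (\<rho> j))" using kj by (intro emp_cdf_mono) simp
    finally show False using j by (simp add: a_def)
  qed
  ultimately have "accepts_at (sampling_algorithm n N) r s (x \<circ> \<sigma>) ?t"
    by (simp add: accepts_at_def)
  moreover have "x (\<sigma> ?t) = Max (x ` {..<n})"
  proof (rule Max_eqI[symmetric])
    fix y assume "y \<in> x ` {..<n}"
    then obtain l where "l < n" "y = x (\<rho> l)"
      using permutes_image[OF \<rho>] by (auto simp: image_iff) (metis \<rho> lessThan_iff permutes_in_image permutes_surj surjD)
    then show "y \<le> x (\<sigma> ?t)" using le \<sigma>[OF i(1)] by simp
  next
    show "x (\<sigma> ?t) \<in> x ` {..<n}" using \<sigma>[OF i(1)] i(1) permutes_in_image[OF \<rho>, of i] by auto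
  qed simp
  ultimately show ?thesis unfolding succeeds_def \<sigma>_def[symmetric] using t by blast
qed

section \<open>Measurability of the rule\<close>

lemma measurable_emp_cdf:
  assumes s: "\<And>i j. i < n \<Longrightarrow> j < N \<Longrightarrow> (\<lambda>w. f w (i, j)) \<in> borel_measurable M"
    and [measurable]: "g \<in> borel_measurable M"
  shows "(\<lambda>w. emp_cdf n N (f w) (g w)) \<in> borel_measurable M"
proof -
  have "Measurable.pred M (\<lambda>w. below_max n (g w) (f w) j)" if j: "j < N" for j
  proof -
    have [measurable]: "Measurable.pred M (\<lambda>w. f w (i, j) \<le> g w)" if "i < n" for i
      using s[OF that j] by measurable
    show ?thesis unfolding below_max_def by measurable
  qed
  then have "(\<lambda>w. of_bool (below_max n (g w) (f w) j) :: real) \<in> borel_measurable M" if "j < N" for j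
    unfolding of_bool_def using that by measurable
  then show ?thesis unfolding emp_cdf_def by (intro borel_measurable_divide borel_measurable_sum) auto
qed

lemma secretary_algorithm_sampling: "secretary_algorithm n N (sampling_algorithm n N)"
  unfolding secretary_algorithm_def
proof (intro allI impI)
  fix t assume "t < n"
  let ?R = "\<Pi>\<^sub>M k\<in>UNIV. (borel :: real measure)" and ?S = "\<Pi>\<^sub>M ij\<in>{..<n} \<times> {..<N}. (borel :: real measure)"
    and ?H = "\<Pi>\<^sub>M u\<in>{..t}. (borel :: real measure)"
  let ?M = "?R \<Otimes>\<^sub>M ?S \<Otimes>\<^sub>M ?H"
  have r[measurable]: "(\<lambda>w. fst w i) \<in> borel_measurable ?M" for i
    by (rule measurable_compose[OF measurable_fst measurable_component_singleton]) simp
  have s: "(\<lambda>w. fst (snd w) (i, j)) \<in> borel_measurable ?M" if "i < n" "j < N" for i j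
    using that by (intro measurable_compose[OF measurable_compose[OF measurable_snd measurable_fst] measurable_component_singleton]) auto
  have h: "(\<lambda>w. snd (snd w) u) \<in> borel_measurable ?M" if "u \<le> t" for u
    using that by (intro measurable_compose[OF measurable_compose[OF measurable_snd measurable_snd] measurable_component_singleton]) auto
  have rank[measurable]: "Measurable.pred ?M (\<lambda>w. arrival_rank n (fst w) i = t)" for i
  proof -
    \<comment> \<open>The cardinality becomes a finite sum of indicators, whose measurability is
      automatic.\<close>
    have "arrival_rank n r i = t \<longleftrightarrow> (\<Sum>j<n. of_bool (r j < r i)) = real t" for r
      by (simp add: arrival_rank_def sum_of_bool_eq Int_def)
    moreover have "Measurable.pred ?M (\<lambda>w. (\<Sum>j<n. of_bool (fst w j < fst w i)) = real t)"
      unfolding of_bool_def by measurable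
    ultimately show ?thesis by simp
  qed
  have [measurable]: "(\<lambda>w. emp_cdf n N (fst (snd w)) (snd (snd w) t)) \<in> borel_measurable ?M"
    by (intro measurable_emp_cdf s h) auto
  have rec[measurable]: "Measurable.pred ?M (\<lambda>w. \<forall>u<t. snd (snd w) u \<le> snd (snd w) t)"
  proof -
    have "Measurable.pred ?M (\<lambda>w. \<not> snd (snd w) t < snd (snd w) u)" if "u \<in> {..<t}" for u
      by (intro pred_intros_logic borel_measurable_pred_less h) (use that in auto)
    then have "Measurable.pred ?M (\<lambda>w. \<forall>u\<in>{..<t}. \<not> snd (snd w) t < snd (snd w) u)"
      by (intro pred_intros_finite) auto
    then show ?thesis by (simp only: not_less Ball_def lessThan_iff)
  qed
  have [measurable]: "Measurable.pred ?M (\<lambda>w. level (fst w i) \<le> emp_cdf n N (fst (snd w)) (snd (snd w) t))" for i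
    by measurable
  have step: "Measurable.pred ?M (\<lambda>w. arrival_rank n (fst w) i = t \<and>
      level (fst w i) \<le> emp_cdf n N (fst (snd w)) (snd (snd w) t) \<and> (\<forall>u<t. snd (snd w) u \<le> snd (snd w) t))" for i
    by (intro pred_intros_logic) fact+
  have "Measurable.pred ?M (\<lambda>w. \<exists>i\<in>{..<n}. arrival_rank n (fst w) i = t \<and>
      level (fst w i) \<le> emp_cdf n N (fst (snd w)) (snd (snd w) t) \<and> (\<forall>u<t. snd (snd w) u \<le> snd (snd w) t))"
    by (intro pred_intros_finite(4) step) simp
  then show "Measurable.pred ?M (\<lambda>(r, s, h). sampling_algorithm n N t r s h)"
    unfolding sampling_algorithm_def case_prod_beta' Bex_def lessThan_iff .
qed

section \<open>The secretary space\<close>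

lemma sets_random_source[measurable_cong]: "sets random_source = sets (\<Pi>\<^sub>M k\<in>UNIV. borel)"
  unfolding random_source_def by (intro sets_PiM_cong) auto

lemma prob_space_random_source: "prob_space random_source"
  unfolding random_source_def by (intro prob_space_PiM prob_space_uniform01)

lemma measurable_succeeds:
  fixes D :: "nat \<Rightarrow> real measure"
  assumes A: "secretary_algorithm n N A" and \<sigma>: "\<sigma> permutes {..<n}"
    and D: "\<And>i. sets (D i) = sets borel"
  shows "Measurable.pred (random_source \<Otimes>\<^sub>M (\<Pi>\<^sub>M (i, j)\<in>{..<n} \<times> {..<N}. D i) \<Otimes>\<^sub>M (\<Pi>\<^sub>M i\<in>{..<n}. D i))
    (\<lambda>w. succeeds n A (fst w) (fst (snd w)) (snd (snd w)) \<sigma>)"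
proof -
  let ?W = "random_source \<Otimes>\<^sub>M (\<Pi>\<^sub>M (i, j)\<in>{..<n} \<times> {..<N}. D i) \<Otimes>\<^sub>M (\<Pi>\<^sub>M i\<in>{..<n}. D i)"
  have setsS: "sets (\<Pi>\<^sub>M (i, j)\<in>{..<n} \<times> {..<N}. D i) = sets (\<Pi>\<^sub>M ij\<in>{..<n} \<times> {..<N}. borel)"
    and setsX: "sets (\<Pi>\<^sub>M i\<in>{..<n}. D i) = sets (\<Pi>\<^sub>M i\<in>{..<n}. borel)"
    by (intro sets_PiM_cong; auto simp: D)+
  have r: "fst \<in> measurable ?W (\<Pi>\<^sub>M k\<in>UNIV. borel)"
    using measurable_fst by (subst measurable_cong_sets[OF refl sets_random_source[symmetric]])
  have s: "(\<lambda>w. fst (snd w)) \<in> measurable ?W (\<Pi>\<^sub>M ij\<in>{..<n} \<times> {..<N}. borel)"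
    by (subst measurable_cong_sets[OF refl setsS[symmetric]]) measurable
  have x: "(\<lambda>w. snd (snd w)) \<in> measurable ?W (\<Pi>\<^sub>M i\<in>{..<n}. borel)"
    by (subst measurable_cong_sets[OF refl setsX[symmetric]]) measurable
  have xi: "(\<lambda>w. snd (snd w) i) \<in> borel_measurable ?W" if "i < n" for i
    using that by (intro measurable_compose[OF x measurable_component_singleton]) auto
  have \<sigma>n: "\<sigma> k < n" if "k < n" for k using permutes_in_image[OF \<sigma>, of k] that by simp
  have A_pred: "Measurable.pred ?W (\<lambda>w. A t (fst w) (fst (snd w)) (restrict (snd (snd w) \<circ> \<sigma>) {..t}))" if t: "t < n" for t
  proof -
    have "(\<lambda>w. restrict (snd (snd w) \<circ> \<sigma>) {..t}) \<in> measurable ?W (\<Pi>\<^sub>M u\<in>{..t}. borel)"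
      using t \<sigma>n by (intro measurable_restrict) (auto intro!: xi)
    note meas = measurable_Pair[OF r measurable_Pair[OF s this]]
    have "Measurable.pred ((\<Pi>\<^sub>M k\<in>UNIV. borel) \<Otimes>\<^sub>M (\<Pi>\<^sub>M ij\<in>{..<n} \<times> {..<N}. borel) \<Otimes>\<^sub>M (\<Pi>\<^sub>M u\<in>{..t}. borel))
        (\<lambda>(r, s, h). A t r s h)"
      using A t unfolding secretary_algorithm_def by blast
    from measurable_compose[OF meas this] show ?thesis by (simp only: prod.case)
  qed
  have acc: "Measurable.pred ?W (\<lambda>w. accepts_at A (fst w) (fst (snd w)) (snd (snd w) \<circ> \<sigma>) t)" if t: "t < n" for t
  proof -
    have "Measurable.pred ?W (\<lambda>w. \<forall>u\<in>{..<t}. \<not> A u (fst w) (fst (snd w)) (restrict (snd (snd w) \<circ> \<sigma>) {..u}))"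
      using t by (intro pred_intros_finite(3) pred_intros_logic(2) A_pred) auto
    then have "Measurable.pred ?W (\<lambda>w. A t (fst w) (fst (snd w)) (restrict (snd (snd w) \<circ> \<sigma>) {..t}) \<and>
       (\<forall>u\<in>{..<t}. \<not> A u (fst w) (fst (snd w)) (restrict (snd (snd w) \<circ> \<sigma>) {..u})))"
      by (intro pred_intros_logic(3) A_pred t)
    then show ?thesis unfolding accepts_at_def by (simp only: Ball_def lessThan_iff)
  qed
  have max: "(\<lambda>w. Max ((\<lambda>i. snd (snd w) i) ` {..<n})) \<in> borel_measurable ?W"
    by (intro borel_measurable_Max xi) auto
  have "Measurable.pred ?W (\<lambda>w. \<exists>t\<in>{..<n}. accepts_at A (fst w) (fst (snd w)) (snd (snd w) \<circ> \<sigma>) t \<and>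
      snd (snd w) (\<sigma> t) = Max ((\<lambda>i. snd (snd w) i) ` {..<n}))"
    by (intro pred_intros_finite(4) pred_intros_logic(3) acc
        borel_measurable_eq[OF xi[OF \<sigma>n] max, unfolded pred_def[symmetric]]) auto
  then show ?thesis unfolding succeeds_def by (simp only: Bex_def lessThan_iff)
qed

section \<open>Arrival times and relabelled values\<close>

context continuous_distributions
begin

lemma AE_random_source_distinct:
  "AE r in random_source. \<forall>i\<in>{..<n}. \<forall>j\<in>{..<n}. i \<noteq> j \<longrightarrow> r i \<noteq> r j"
proof -
  have "AE p in uniform01. p \<noteq> c" for c :: real
    using AE_lborel_singleton[of c] by (intro AE_uniform_measureI) auto
  then have "AE r in (\<Pi>\<^sub>M i\<in>{..<n}. uniform01). \<forall>i\<in>{..<n}. \<forall>j\<in>{..<n}. i \<noteq> j \<longrightarrow> r i \<noteq> r j"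
    by (intro AE_PiM_distinct[where f="\<lambda>x. x"] prob_space_uniform01) auto
  moreover have "distr random_source (\<Pi>\<^sub>M i\<in>{..<n}. uniform01) (\<lambda>r. \<lambda>i\<in>{..<n}. r i) = (\<Pi>\<^sub>M i\<in>{..<n}. uniform01)"
    unfolding random_source_def by (intro distr_PiM_reindex[where f="\<lambda>i. i"] prob_space_uniform01) auto
  ultimately have "AE r in distr random_source (\<Pi>\<^sub>M i\<in>{..<n}. uniform01) (\<lambda>r. \<lambda>i\<in>{..<n}. r i).
     \<forall>i\<in>{..<n}. \<forall>j\<in>{..<n}. i \<noteq> j \<longrightarrow> r i \<noteq> r j" by (simp only:)
  then have "AE r in random_source. \<forall>i\<in>{..<n}. \<forall>j\<in>{..<n}. i \<noteq> j \<longrightarrow> (\<lambda>i\<in>{..<n}. r i) i \<noteq> (\<lambda>i\<in>{..<n}. r i) j"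
    by (rule AE_distrD[rotated]) (auto simp: random_source_def intro!: measurable_restrict)
  then show ?thesis by eventually_elim auto
qed

text \<open>Relabelling the independent draws by \<rho> gives independent pairs with value laws
  \<open>D (\<rho> i)\<close>; of the infinite random source only the first n coordinates are read.
  The pairs are thus those of the permuted family, to which \<open>success_bound_le_wins\<close>
  applies.\<close>

lemma nn_integral_reindexed_pair:
  assumes \<rho>: "\<rho> permutes {..<n}" and h[measurable]: "h \<in> borel_measurable (PiM {..<n} (\<lambda>i. uniform01 \<Otimes>\<^sub>M D (\<rho> i)))"
  shows "(\<integral>\<^sup>+r. \<integral>\<^sup>+x. h (\<lambda>i\<in>{..<n}. (r i, x (\<rho> i))) \<partial>PiM {..<n} D \<partial>random_source) =
    (\<integral>\<^sup>+z. h z \<partial>PiM {..<n} (\<lambda>i. uniform01 \<Otimes>\<^sub>M D (\<rho> i)))"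
proof -
  let ?I = "{..<n}" and ?U = "\<Pi>\<^sub>M i\<in>{..<n}. uniform01" and ?Y = "\<Pi>\<^sub>M i\<in>{..<n}. D (\<rho> i)"
  interpret Y: prob_space ?Y by (intro prob_space_PiM D_prob)
  have inj: "inj_on \<rho> ?I" "\<rho> \<in> ?I \<rightarrow> ?I"
    using permutes_inj_on[OF \<rho>] permutes_in_image[OF \<rho>] by auto
  have pair[measurable]: "(\<lambda>(r, y). \<lambda>i\<in>?I. (r i, y i)) \<in> measurable (?U \<Otimes>\<^sub>M ?Y) (PiM ?I (\<lambda>i. uniform01 \<Otimes>\<^sub>M D (\<rho> i)))"
    by (auto simp: case_prod_beta' intro!: measurable_restrict)
  have h'[measurable]: "(\<lambda>(r, y). h (\<lambda>i\<in>?I. (r i, y i))) \<in> borel_measurable (?U \<Otimes>\<^sub>M ?Y)"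
    using measurable_compose[OF pair h] by (simp add: case_prod_beta')
  have inner: "(\<integral>\<^sup>+x. h (\<lambda>i\<in>?I. (r i, x (\<rho> i))) \<partial>PiM ?I D) = (\<integral>\<^sup>+y. h (\<lambda>i\<in>?I. (r i, y i)) \<partial>?Y)" if r: "r \<in> space ?U" for r
  proof -
    have [measurable]: "(\<lambda>y. h (\<lambda>i\<in>?I. (r i, y i))) \<in> borel_measurable ?Y"
      using measurable_compose[OF measurable_Pair1'[OF r] h'] by simp
    have re[measurable]: "(\<lambda>x. \<lambda>i\<in>?I. x (\<rho> i)) \<in> measurable (PiM ?I D) ?Y"
      using inj by (intro measurable_restrict measurable_component_singleton) auto
    have "(\<integral>\<^sup>+y. h (\<lambda>i\<in>?I. (r i, y i)) \<partial>?Y) = (\<integral>\<^sup>+y. h (\<lambda>i\<in>?I. (r i, y i)) \<partial>distr (PiM ?I D) ?Y (\<lambda>x. \<lambda>i\<in>?I. x (\<rho> i)))"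
      by (subst distr_PiM_reindex[OF D_prob inj]) simp
    also have "\<dots> = (\<integral>\<^sup>+x. h (\<lambda>i\<in>?I. (r i, (\<lambda>i\<in>?I. x (\<rho> i)) i)) \<partial>PiM ?I D)"
      by (rule nn_integral_distr) measurable
    also have "\<dots> = (\<integral>\<^sup>+x. h (\<lambda>i\<in>?I. (r i, x (\<rho> i))) \<partial>PiM ?I D)"
      by (intro nn_integral_cong arg_cong[where f=h]) auto
    finally show ?thesis ..
  qed
  have res[measurable]: "(\<lambda>r. restrict r ?I) \<in> measurable random_source ?U"
    unfolding random_source_def by (intro measurable_restrict measurable_component_singleton) auto
  have "(\<integral>\<^sup>+r. \<integral>\<^sup>+x. h (\<lambda>i\<in>?I. (r i, x (\<rho> i))) \<partial>PiM ?I D \<partial>random_source) =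
     (\<integral>\<^sup>+r. \<integral>\<^sup>+y. h (\<lambda>i\<in>?I. (restrict r ?I i, y i)) \<partial>?Y \<partial>random_source)"
  proof (rule nn_integral_cong)
    fix r
    have "(\<integral>\<^sup>+x. h (\<lambda>i\<in>?I. (r i, x (\<rho> i))) \<partial>PiM ?I D) = (\<integral>\<^sup>+x. h (\<lambda>i\<in>?I. (restrict r ?I i, x (\<rho> i))) \<partial>PiM ?I D)"
      by (intro nn_integral_cong arg_cong[where f=h]) auto
    also have "\<dots> = (\<integral>\<^sup>+y. h (\<lambda>i\<in>?I. (restrict r ?I i, y i)) \<partial>?Y)"
      by (rule inner) (auto simp: space_PiM PiE_iff extensional_def)
    finally show "(\<integral>\<^sup>+x. h (\<lambda>i\<in>?I. (r i, x (\<rho> i))) \<partial>PiM ?I D) = \<dots>" .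
  qed
  also have "\<dots> = (\<integral>\<^sup>+r. \<integral>\<^sup>+y. h (\<lambda>i\<in>?I. (r i, y i)) \<partial>?Y \<partial>distr random_source ?U (\<lambda>r. restrict r ?I))"
    by (rule nn_integral_distr[symmetric, OF res]) measurable
  also have "distr random_source ?U (\<lambda>r. restrict r ?I) = ?U"
    unfolding random_source_def using distr_PiM_reindex[of UNIV "\<lambda>_. uniform01" "\<lambda>i. i" ?I] prob_space_uniform01
    by simp
  also have "(\<integral>\<^sup>+r. \<integral>\<^sup>+y. h (\<lambda>i\<in>?I. (r i, y i)) \<partial>?Y \<partial>?U) = (\<integral>\<^sup>+w. (case w of (r, y) \<Rightarrow> h (\<lambda>i\<in>?I. (r i, y i))) \<partial>(?U \<Otimes>\<^sub>M ?Y))"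
    using sigma_finite_measure.nn_integral_fst[OF prob_space_imp_sigma_finite[OF Y.prob_space_axioms] h'] by simp
  also have "\<dots> = (\<integral>\<^sup>+z. h z \<partial>distr (?U \<Otimes>\<^sub>M ?Y) (PiM ?I (\<lambda>i. uniform01 \<Otimes>\<^sub>M D (\<rho> i))) (\<lambda>(r, y). \<lambda>i\<in>?I. (r i, y i)))"
    by (subst nn_integral_distr) (auto simp: case_prod_beta')
  also have "\<dots> = (\<integral>\<^sup>+z. h z \<partial>PiM ?I (\<lambda>i. uniform01 \<Otimes>\<^sub>M D (\<rho> i)))"
    by (subst distr_PiM_pair) (auto intro: prob_space_uniform01 D_prob)
  finally show ?thesis .
qed

lemma wins_pred:
  assumes "accepted_distributions D a" and I: "finite I"
  shows "Measurable.pred (PiM I P) (accepted_distributions.wins a I)"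
proof -
  interpret accepted_distributions D a by fact
  have "Measurable.pred (PiM I P) (\<lambda>z. a (fst (z i)) (snd (z i)) \<and> (\<forall>l\<in>I - {i}. snd (z l) < snd (z i)) \<and>
     past_ok (I - {i}) (fst (z i)) z)" if i: "i \<in> I" for i
  proof -
    have fin[measurable]: "finite (I - {i})" using I by simp
    note [measurable] = past_ok_pred[OF I i]
    have "Measurable.pred (PiM I P) (\<lambda>z. \<forall>l\<in>I - {i}. snd (z l) < snd (z i))"
      by (intro pred_intros_finite(3) borel_measurable_pred_less P_component fin) (use i in auto)
    then show ?thesis
      by (intro pred_intros_logic(3) measurable_acceptance P_component i past_ok_pred I)
  qed
  then show ?thesis unfolding wins_def[abs_def] by (intro pred_intros_finite(4) I)
qed

end

section \<open>Integration over the secretary space\<close>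

lemma nn_integral_sum_cmult:
  fixes f :: "'i \<Rightarrow> 'a \<Rightarrow> ennreal"
  assumes "\<And>i. i \<in> I \<Longrightarrow> f i \<in> borel_measurable M"
  shows "(\<integral>\<^sup>+x. (\<Sum>i\<in>I. c * f i x) \<partial>M) = (\<Sum>i\<in>I. c * (\<integral>\<^sup>+x. f i x \<partial>M))"
  using assms by (subst nn_integral_sum) (auto intro!: sum.cong nn_integral_cmult)

lemma nn_integral_uniform_permutation:
  "(\<integral>\<^sup>+\<sigma>. f \<sigma> \<partial>uniform_count_measure {\<sigma>. \<sigma> permutes {..<n}}) =
     (\<Sum>\<sigma> | \<sigma> permutes {..<n}. ennreal (1 / fact n) * f \<sigma>)"
  unfolding uniform_count_measure_def
  by (subst nn_integral_point_measure_finite) (auto simp: finite_permutations card_permutations[OF refl])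

lemma prob_space_uniform_permutation: "prob_space (uniform_count_measure {\<sigma>. \<sigma> permutes {..<n::nat}})"
  by (intro prob_space_uniform_count_measure) (auto simp: finite_permutations intro!: exI[of _ id] permutes_id)

text \<open>The samples are outermost because the analysis is conditional on them; the orders are
  innermost so that, with the times already fixed, they can be reindexed by the rank
  permutation.\<close>

lemma nn_integral_secretary_space:
  assumes D: "\<And>i. prob_space (D i)"
    and f[measurable]: "f \<in> borel_measurable (secretary_space n N D)"
  shows "(\<integral>\<^sup>+w. f w \<partial>secretary_space n N D) =
    (\<integral>\<^sup>+s. \<integral>\<^sup>+r. \<integral>\<^sup>+x. (\<Sum>\<sigma> | \<sigma> permutes {..<n}. ennreal (1 / fact n) * f (r, s, x, \<sigma>))
       \<partial>PiM {..<n} D \<partial>random_source \<partial>(\<Pi>\<^sub>M (i, j)\<in>{..<n} \<times> {..<N}. D i))"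
proof -
  let ?R = random_source and ?S = "\<Pi>\<^sub>M (i, j)\<in>{..<n} \<times> {..<N}. D i" and ?X = "PiM {..<n} D"
    and ?B = "uniform_count_measure {\<sigma>. \<sigma> permutes {..<n}}"
  have S: "prob_space ?S" and X: "prob_space ?X"
    by (intro prob_space_PiM; auto intro: D)+
  interpret R: prob_space ?R by (rule prob_space_random_source)
  interpret S: prob_space ?S by (rule S)
  interpret X: prob_space ?X by (rule X)
  interpret B: prob_space ?B by (rule prob_space_uniform_permutation)
  interpret XB: pair_prob_space ?X ?B ..
  interpret SXB: pair_prob_space ?S "?X \<Otimes>\<^sub>M ?B" ..
  interpret RS: pair_prob_space ?R ?S ..
  have [measurable]: "f \<in> borel_measurable (?R \<Otimes>\<^sub>M ?S \<Otimes>\<^sub>M ?X \<Otimes>\<^sub>M ?B)"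
    using f unfolding secretary_space_def .
  have "(\<integral>\<^sup>+w. f w \<partial>secretary_space n N D) = (\<integral>\<^sup>+r. \<integral>\<^sup>+v. f (r, v) \<partial>(?S \<Otimes>\<^sub>M ?X \<Otimes>\<^sub>M ?B) \<partial>?R)"
    unfolding secretary_space_def by (rule SXB.P.nn_integral_fst[symmetric]) measurable
  also have "\<dots> = (\<integral>\<^sup>+r. \<integral>\<^sup>+s. \<integral>\<^sup>+v. f (r, s, v) \<partial>(?X \<Otimes>\<^sub>M ?B) \<partial>?S \<partial>?R)"
    by (intro nn_integral_cong XB.P.nn_integral_fst[symmetric]) measurable
  also have "\<dots> = (\<integral>\<^sup>+r. \<integral>\<^sup>+s. \<integral>\<^sup>+x. \<integral>\<^sup>+\<sigma>. f (r, s, x, \<sigma>) \<partial>?B \<partial>?X \<partial>?S \<partial>?R)"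
    by (intro nn_integral_cong B.nn_integral_fst[symmetric]) measurable
  also have "\<dots> = (\<integral>\<^sup>+s. \<integral>\<^sup>+r. \<integral>\<^sup>+x. \<integral>\<^sup>+\<sigma>. f (r, s, x, \<sigma>) \<partial>?B \<partial>?X \<partial>?R \<partial>?S)"
    by (intro RS.Fubini'[symmetric]) measurable
  finally show ?thesis unfolding nn_integral_uniform_permutation .
qed

text \<open>The order takes finitely many values, so the event is a finite union over fixed orders,
  each covered by \<open>measurable_succeeds\<close>.\<close>

lemma succeeds_pred:
  fixes D :: "nat \<Rightarrow> real measure"
  assumes A: "secretary_algorithm n N A" and D: "\<And>i. sets (D i) = sets borel"
  shows "Measurable.pred (secretary_space n N D) (\<lambda>(r, s, x, \<sigma>). succeeds n A r s x \<sigma>)"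
proof -
  let ?M = "secretary_space n N D"
  let ?V = "random_source \<Otimes>\<^sub>M (\<Pi>\<^sub>M (i, j)\<in>{..<n} \<times> {..<N}. D i) \<Otimes>\<^sub>M (\<Pi>\<^sub>M i\<in>{..<n}. D i)"
  have proj: "(\<lambda>w. (fst w, fst (snd w), fst (snd (snd w)))) \<in> measurable ?M ?V"
    unfolding secretary_space_def by measurable
  have last: "(\<lambda>w. snd (snd (snd w))) \<in> measurable ?M (uniform_count_measure {\<sigma>. \<sigma> permutes {..<n}})"
    unfolding secretary_space_def by measurable
  have "Measurable.pred ?M (\<lambda>w. snd (snd (snd w)) = \<sigma> \<and> succeeds n A (fst w) (fst (snd w)) (fst (snd (snd w))) \<sigma>)"
    if \<sigma>: "\<sigma> permutes {..<n}" for \<sigma>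
  proof (intro pred_intros_logic(3))
    have "Measurable.pred (uniform_count_measure {\<sigma>. \<sigma> permutes {..<n}}) (\<lambda>p. p = \<sigma>)"
      by (auto simp: pred_def space_uniform_count_measure sets_uniform_count_measure)
    from measurable_compose[OF last this] show "Measurable.pred ?M (\<lambda>w. snd (snd (snd w)) = \<sigma>)" .
    from measurable_compose[OF proj measurable_succeeds[OF A \<sigma> D]]
    show "Measurable.pred ?M (\<lambda>w. succeeds n A (fst w) (fst (snd w)) (fst (snd (snd w))) \<sigma>)"
      by (simp only: fst_conv snd_conv)
  qed
  then have "Measurable.pred ?M (\<lambda>w. \<exists>\<sigma>\<in>{\<sigma>. \<sigma> permutes {..<n}}. snd (snd (snd w)) = \<sigma> \<and>
      succeeds n A (fst w) (fst (snd w)) (fst (snd (snd w))) \<sigma>)"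
    by (intro pred_intros_finite(4)) (auto simp: finite_permutations)
  also have "?this \<longleftrightarrow> Measurable.pred ?M (\<lambda>(r, s, x, \<sigma>). succeeds n A r s x \<sigma>)"
    by (intro measurable_cong)
       (auto simp: secretary_space_def space_pair_measure space_uniform_count_measure)
  finally show ?thesis .
qed

context continuous_distributions
begin

lemma permuted: "continuous_distributions (\<lambda>i. D (\<rho> i))"
  by standard (rule cont)

text \<open>\<open>Q\<close> is a symmetric product, so a single accuracy statement about the
  empirical function serves every relabelling of the items.\<close>

lemma Q_permuted: "\<rho> permutes {..<n} \<Longrightarrow> continuous_distributions.Q (\<lambda>i. D (\<rho> i)) {..<n} x = Q {..<n} x"
  unfolding continuous_distributions.Q_def[OF permuted] Q_def
  using prod.permute[of \<rho> "{..<n}" "\<lambda>i. F i x"] by (simp add: o_def)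

text \<open>For fixed times \<open>r\<close>, the presentation orders are the maps \<open>\<rho> \<circ> inv (rank_perm n r)\<close>, under which the
  value \<open>x (\<rho> i)\<close> arrives at time \<open>r i\<close>.\<close>

lemma success_given_samples:
  assumes n: "n \<ge> 1" and \<delta>: "0 \<le> \<delta>" and s: "s \<in> space (sample_space n N)"
    and close: "\<And>x. \<bar>emp_cdf n N s x - Q {..<n} x\<bar> < \<delta>"
  shows "success_bound \<delta> \<le> (\<integral>\<^sup>+r. \<integral>\<^sup>+x. (\<Sum>\<sigma> | \<sigma> permutes {..<n}. ennreal (1 / fact n) *
     of_bool (succeeds n (sampling_algorithm n N) r s x \<sigma>)) \<partial>PiM {..<n} D \<partial>random_source)"
proof -
  let ?A = "sampling_algorithm n N" and ?c = "ennreal (1 / fact n)" and ?X = "PiM {..<n} D"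
  define a where "a = (\<lambda>t y. level t \<le> emp_cdf n N s y)"
  have acceptance: "acceptance a"
  proof
    have "(\<lambda>w. emp_cdf n N s (snd w)) \<in> borel_measurable (borel \<Otimes>\<^sub>M borel :: (real \<times> real) measure)"
      by (intro measurable_emp_cdf) auto
    then show "Measurable.pred (borel \<Otimes>\<^sub>M borel) (\<lambda>(t, y). a t y)"
      unfolding a_def case_prod_beta' by measurable
  qed
  have acc: "accepted_distributions (\<lambda>i. D (\<rho> i)) a" for \<rho>
    by (intro accepted_distributions.intro permuted acceptance)
  define w where "w \<rho> r x = (of_bool (accepted_distributions.wins a {..<n} (\<lambda>i\<in>{..<n}. (r i, x (\<rho> i)))) :: ennreal)"
    for \<rho> :: "nat \<Rightarrow> nat" and r x :: "nat \<Rightarrow> real"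
  have P_eq: "continuous_distributions.P (\<lambda>i. D (\<rho> i)) = (\<lambda>i. uniform01 \<Otimes>\<^sub>M D (\<rho> i))" for \<rho>
    by (intro ext) (simp add: continuous_distributions.P_def[OF permuted])
  have meas: "(\<lambda>z. of_bool (accepted_distributions.wins a {..<n} z) :: ennreal) \<in> borel_measurable (PiM {..<n} (\<lambda>i. uniform01 \<Otimes>\<^sub>M D (\<rho> i)))" for \<rho>
    using continuous_distributions.wins_pred[OF permuted acc, of "{..<n}" \<rho>]
    unfolding P_eq by (intro measurable_of_bool_ennreal) auto
  have w_meas: "(\<lambda>(r, x). w \<rho> r x) \<in> borel_measurable (random_source \<Otimes>\<^sub>M ?X)" if \<rho>: "\<rho> permutes {..<n}" for \<rho>
  proof -
    have "(\<lambda>p. \<lambda>i\<in>{..<n}. (fst p i, snd p (\<rho> i))) \<in> measurable (random_source \<Otimes>\<^sub>M ?X) (PiM {..<n} (\<lambda>i. uniform01 \<Otimes>\<^sub>M D (\<rho> i)))"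
    proof (intro measurable_restrict measurable_Pair)
      fix i assume i: "i \<in> {..<n}"
      then have "\<rho> i \<in> {..<n}" using permutes_in_image[OF \<rho>, of i] by simp
      then show "(\<lambda>p. snd p (\<rho> i)) \<in> measurable (random_source \<Otimes>\<^sub>M ?X) (D (\<rho> i))"
        by (rule measurable_compose[OF measurable_snd measurable_component_singleton])
      show "(\<lambda>p. fst p i) \<in> measurable (random_source \<Otimes>\<^sub>M ?X) uniform01"
        unfolding random_source_def
        by (rule measurable_compose[OF measurable_fst measurable_component_singleton]) simp
    qed
    from measurable_compose[OF this meas] show ?thesis by (simp add: w_def case_prod_beta')
  qed
  have G_meas: "(\<lambda>r. \<integral>\<^sup>+x. w \<rho> r x \<partial>?X) \<in> borel_measurable random_source" if "\<rho> permutes {..<n}" for \<rho>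
    using w_meas[OF that]
    by (rule sigma_finite_measure.borel_measurable_nn_integral[OF prob_space_imp_sigma_finite[OF prob_space_PiM[OF D_prob]]])
  \<comment> \<open>The permuted family has the same \<open>Q\<close> and the same rule
    \<open>a\<close>, so one bound holds for every \<rho>, and averaging over \<rho> loses
    nothing.\<close>
  have bound: "success_bound \<delta> \<le> (\<integral>\<^sup>+r. \<integral>\<^sup>+x. w \<rho> r x \<partial>?X \<partial>random_source)" if \<rho>: "\<rho> permutes {..<n}" for \<rho>
  proof -
    have "success_bound \<delta> \<le> (\<integral>\<^sup>+z. of_bool (accepted_distributions.wins a {..<n} z) \<partial>PiM {..<n} (continuous_distributions.P (\<lambda>i. D (\<rho> i))))"
    proof (rule accepted_distributions.success_bound_le_wins[OF acc])
      show "{..<n} \<noteq> {}" using n by (auto simp: lessThan_empty_iff bot_nat_def)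
      show "a t x" if "level t + \<delta> \<le> continuous_distributions.Q (\<lambda>i. D (\<rho> i)) {..<n} x" for t x
        using that close[of x] unfolding Q_permuted[OF \<rho>] a_def by linarith
      show "\<not> a t x" if "continuous_distributions.Q (\<lambda>i. D (\<rho> i)) {..<n} x \<le> level t - \<delta>" for t x
        using that close[of x] unfolding Q_permuted[OF \<rho>] a_def by linarith
    qed (use \<delta> in auto)
    also have "\<dots> = (\<integral>\<^sup>+r. \<integral>\<^sup>+x. w \<rho> r x \<partial>?X \<partial>random_source)"
      unfolding P_eq w_def by (rule nn_integral_reindexed_pair[OF \<rho> meas, symmetric])
    finally show ?thesis .
  qed
  have "(\<Sum>\<rho> | \<rho> permutes {..<n}. ?c) = ennreal (real (fact n) * (1 / fact n))"
    by (simp add: card_permutations[OF refl] ennreal_mult' ennreal_of_nat_eq_real_of_nat del: times_divide_eq_right)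
  then have c1: "(\<Sum>\<rho> | \<rho> permutes {..<n}. ?c) = 1" by simp
  have "success_bound \<delta> = (\<Sum>\<rho> | \<rho> permutes {..<n}. ?c * success_bound \<delta>)"
    unfolding sum_distrib_right[symmetric] c1 by simp
  also have "\<dots> \<le> (\<Sum>\<rho> | \<rho> permutes {..<n}. ?c * (\<integral>\<^sup>+r. \<integral>\<^sup>+x. w \<rho> r x \<partial>?X \<partial>random_source))"
    by (intro sum_mono mult_left_mono bound) auto
  also have "\<dots> \<le> (\<integral>\<^sup>+r. (\<Sum>\<rho> | \<rho> permutes {..<n}. ?c * (\<integral>\<^sup>+x. w \<rho> r x \<partial>?X)) \<partial>random_source)"
    using G_meas by (subst nn_integral_sum_cmult) auto
  also have "\<dots> \<le> (\<integral>\<^sup>+r. \<integral>\<^sup>+x. (\<Sum>\<sigma> | \<sigma> permutes {..<n}. ?c * of_bool (succeeds n ?A r s x \<sigma>)) \<partial>?X \<partial>random_source)"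
  proof (rule nn_integral_mono_AE)
    show "AE r in random_source. (\<Sum>\<rho> | \<rho> permutes {..<n}. ?c * (\<integral>\<^sup>+x. w \<rho> r x \<partial>?X)) \<le>
      (\<integral>\<^sup>+x. (\<Sum>\<sigma> | \<sigma> permutes {..<n}. ?c * of_bool (succeeds n ?A r s x \<sigma>)) \<partial>?X)"
      using AE_random_source_distinct[of n] AE_space
    proof eventually_elim
      case (elim r)
      have x_meas: "w \<rho> r \<in> borel_measurable ?X" if "\<rho> permutes {..<n}" for \<rho>
        using measurable_compose[OF measurable_Pair1'[OF elim(2)] w_meas[OF that]] by simp
      have perm: "inv (rank_perm n r) permutes {..<n}"
        using elim(1) by (intro permutes_inv rank_perm_permutes) auto
      have "(\<Sum>\<rho> | \<rho> permutes {..<n}. ?c * (\<integral>\<^sup>+x. w \<rho> r x \<partial>?X)) = (\<integral>\<^sup>+x. (\<Sum>\<rho> | \<rho> permutes {..<n}. ?c * w \<rho> r x) \<partial>?X)"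
        using x_meas by (intro nn_integral_sum_cmult[symmetric]) auto
      also have "\<dots> \<le> (\<integral>\<^sup>+x. (\<Sum>\<sigma> | \<sigma> permutes {..<n}. ?c * of_bool (succeeds n ?A r s x \<sigma>)) \<partial>?X)"
      proof (rule nn_integral_mono)
        fix x
        have "w \<rho> r x \<le> of_bool (succeeds n ?A r s x (\<rho> \<circ> inv (rank_perm n r)))" if \<rho>: "\<rho> permutes {..<n}" for \<rho>
          using wins_imp_succeeds[of n r \<rho> "\<lambda>i. D (\<rho> i)" N s x] elim(1) \<rho> acc[of \<rho>]
          unfolding a_def w_def by (auto simp: of_bool_def)
        then have "(\<Sum>\<rho> | \<rho> permutes {..<n}. ?c * w \<rho> r x) \<le>
          (\<Sum>\<rho> | \<rho> permutes {..<n}. ?c * of_bool (succeeds n ?A r s x (\<rho> \<circ> inv (rank_perm n r))))"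
          by (intro sum_mono mult_left_mono) auto
        \<comment> \<open>Composition with the fixed permutation \<open>inv (rank_perm n r)\<close>
          is a bijection of the orders; this is where a uniform order of presentation and
          independent uniform times become interchangeable.\<close>
        also have "\<dots> = (\<Sum>\<sigma> | \<sigma> permutes {..<n}. ?c * of_bool (succeeds n ?A r s x \<sigma>))"
          by (rule sum_permutations_compose_right[OF perm, symmetric])
        finally show "(\<Sum>\<rho> | \<rho> permutes {..<n}. ?c * w \<rho> r x) \<le> \<dots>" .
      qed
      finally show ?case .
    qed
  qed
  finally show ?thesis .
qed

text \<open>Samples, draws and order are independent: on the good event for the samples the
  conditional success probability is at least v, and elsewhere it is bounded below by 0.\<close>

lemma success_probability_ge:
  assumes n: "n \<ge> 1" and N: "N \<ge> 1" and K: "K \<ge> 1" and \<delta>: "2 / real K \<le> \<delta>"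
    and v: "0 \<le> v" "ennreal v \<le> success_bound \<delta>"
  shows "v * (1 - 2 * real K * exp (- 2 * real N / (real K)\<^sup>2)) \<le> success_prob n N D (sampling_algorithm n N)"
proof -
  let ?A = "sampling_algorithm n N" and ?M = "secretary_space n N D" and ?p = "1 - 2 * real K * exp (- 2 * real N / (real K)\<^sup>2)"
  have \<delta>0: "0 \<le> \<delta>" using \<delta> K by (meson divide_nonneg_nonneg of_nat_0_le_iff order_trans zero_le_numeral)
  interpret SP: prob_space ?M
    unfolding secretary_space_def
    by (intro prob_space_pair prob_space_random_source prob_space_uniform_permutation prob_space_PiM)
       (auto intro: D_prob)
  obtain G where G: "G \<in> sets (sample_space n N)" "?p \<le> measure (sample_space n N) G"
    "\<And>s x. s \<in> G \<Longrightarrow> \<bar>emp_cdf n N s x - Q {..<n} x\<bar> < 2 / real K"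
    using emp_cdf_close[OF n N K] by blast
  interpret S: prob_space "sample_space n N" by (rule prob_space_sample)
  have pred: "Measurable.pred ?M (\<lambda>(r, s, x, \<sigma>). succeeds n ?A r s x \<sigma>)"
    by (intro succeeds_pred secretary_algorithm_sampling D_sets)
  have "ennreal (v * ?p) \<le> ennreal v * emeasure (sample_space n N) G"
    using G(2) v(1) by (simp add: ennreal_mult' S.emeasure_eq_measure mult_left_mono ennreal_leI)
  also have "\<dots> = (\<integral>\<^sup>+s. ennreal v * indicator G s \<partial>sample_space n N)"
    using G(1) by (simp add: nn_integral_cmult_indicator)
  also have "\<dots> \<le> (\<integral>\<^sup>+s. \<integral>\<^sup>+r. \<integral>\<^sup>+x. (\<Sum>\<sigma> | \<sigma> permutes {..<n}. ennreal (1 / fact n) *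
     of_bool (succeeds n ?A r s x \<sigma>)) \<partial>PiM {..<n} D \<partial>random_source \<partial>sample_space n N)"
  proof (rule nn_integral_mono)
    fix s assume s: "s \<in> space (sample_space n N)"
    show "ennreal v * indicator G s \<le> (\<integral>\<^sup>+r. \<integral>\<^sup>+x. (\<Sum>\<sigma> | \<sigma> permutes {..<n}. ennreal (1 / fact n) *
     of_bool (succeeds n ?A r s x \<sigma>)) \<partial>PiM {..<n} D \<partial>random_source)"
    proof (cases "s \<in> G")
      case True
      have "success_bound \<delta> \<le> (\<integral>\<^sup>+r. \<integral>\<^sup>+x. (\<Sum>\<sigma> | \<sigma> permutes {..<n}. ennreal (1 / fact n) *
         of_bool (succeeds n ?A r s x \<sigma>)) \<partial>PiM {..<n} D \<partial>random_source)"
        by (intro success_given_samples n \<delta>0 s order.strict_trans2[OF G(3)[OF True] \<delta>])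
      with v(2) True show ?thesis by simp
    qed simp
  qed
  also have "\<dots> = (\<integral>\<^sup>+w. of_bool (case w of (r, s, x, \<sigma>) \<Rightarrow> succeeds n ?A r s x \<sigma>) \<partial>?M)"
    by (subst nn_integral_secretary_space[OF D_prob measurable_of_bool_ennreal[OF pred]]) simp
  also have "\<dots> = (\<integral>\<^sup>+w. indicator {(r, s, x, \<sigma>) \<in> space ?M. succeeds n ?A r s x \<sigma>} w \<partial>?M)"
    by (intro nn_integral_cong) (auto simp: indicator_def)
  also have "\<dots> = ennreal (success_prob n N D ?A)"
  proof -
    have "{(r, s, x, \<sigma>) \<in> space ?M. succeeds n ?A r s x \<sigma>} = {w \<in> space ?M. case w of (r, s, x, \<sigma>) \<Rightarrow> succeeds n ?A r s x \<sigma>}"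
      by auto
    then have "{(r, s, x, \<sigma>) \<in> space ?M. succeeds n ?A r s x \<sigma>} \<in> sets ?M"
      using pred by (simp add: pred_def)
    then show ?thesis by (simp add: success_prob_def SP.emeasure_eq_measure)
  qed
  finally show ?thesis by (simp add: success_prob_def)
qed

end

section \<open>Choice of the parameters\<close>

lemma success_prob_cong:
  assumes "\<And>i. i < n \<Longrightarrow> D i = D' i"
  shows "success_prob n N D A = success_prob n N D' A"
proof -
  have "(\<Pi>\<^sub>M (i, j)\<in>{..<n} \<times> {..<N}. D i) = (\<Pi>\<^sub>M (i, j)\<in>{..<n} \<times> {..<N}. D' i)" "(\<Pi>\<^sub>M i\<in>{..<n}. D i) = (\<Pi>\<^sub>M i\<in>{..<n}. D' i)"
    using assms by (auto intro!: PiM_cong)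
  then show ?thesis unfolding success_prob_def secretary_space_def by simp
qed

text \<open>\<open>A\<close> is quantified before \<open>D\<close>, so the distributions influence
  the decisions through the samples and the shown values alone.\<close>

theorem theorem2:
  shows "\<exists>N :: real \<Rightarrow> nat. \<forall>\<epsilon>\<in>{0<..<1}. \<forall>n\<ge>1. \<exists>A. secretary_algorithm n (N \<epsilon>) A \<and>
    (\<forall>D :: nat \<Rightarrow> real measure. (\<forall>i<n. continuous_distribution (D i)) \<longrightarrow>
       success_prob n (N \<epsilon>) D A \<ge> gamma_opt - \<epsilon>)"
proof -
  have "\<exists>N. \<forall>n\<ge>1. \<forall>D :: nat \<Rightarrow> real measure. (\<forall>i<n. continuous_distribution (D i)) \<longrightarrow>
      gamma_opt - \<epsilon> \<le> success_prob n N D (sampling_algorithm n N)" if \<epsilon>: "\<epsilon> > 0" for \<epsilon>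
  proof -
    \<comment> \<open>One half of \<epsilon> pays for the margin \<delta>, the other half for bad
      samples. The maximum with 0 keeps v a valid lower bound for a probability when \<epsilon> is
      large.\<close>
    define v where "v = max 0 (gamma_opt - \<epsilon> / 2)"
    obtain \<delta> where \<delta>: "\<delta> > 0" "ennreal (gamma_opt - \<epsilon> / 2) \<le> success_bound \<delta>"
      using success_bound_approx[of "\<epsilon> / 2"] \<epsilon> by auto
    then have v: "0 \<le> v" "ennreal v \<le> success_bound \<delta>" "v \<le> gamma_opt"
      using \<epsilon> gamma_opt_nonneg by (auto simp: v_def max_def)
    obtain K :: nat where K: "2 / \<delta> < real K" using reals_Archimedean2 by blast
    have K1: "K \<ge> 1" "2 / real K \<le> \<delta>"
    proof -
      have "0 < real K" using K \<delta>(1) by (meson divide_pos_pos less_trans zero_less_numeral)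
      then show "K \<ge> 1" "2 / real K \<le> \<delta>" using K \<delta>(1) by (simp_all add: field_simps)
    qed
    \<comment> \<open>Chosen so that the loss \<open>gamma_opt * \<eta>\<close> is at most
      \<epsilon> / 2; the summand 1 keeps the denominator positive, as only \<open>gamma_opt\<close>
      \<ge> 0 has been shown.\<close>
    define \<eta> where "\<eta> = \<epsilon> / (2 * (gamma_opt + 1))"
    have \<eta>: "\<eta> > 0" "gamma_opt * \<eta> \<le> \<epsilon> / 2"
      using \<epsilon> gamma_opt_nonneg by (auto simp: \<eta>_def field_simps)
    obtain N where N: "N \<ge> 1" "2 * real K * exp (- 2 * real N / (real K)\<^sup>2) \<le> \<eta>"
      using sample_size_exists[OF K1(1) \<eta>(1)] by blast
    have "gamma_opt - \<epsilon> \<le> success_prob n N D (sampling_algorithm n N)"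
      if n: "n \<ge> 1" and D: "\<forall>i<n. continuous_distribution (D i)" for n and D :: "nat \<Rightarrow> real measure"
    proof -
      \<comment> \<open>Fills up the family beyond n with \<open>D 0\<close>, which is continuous
        since n \<ge> 1; the success probability does not see these indices.\<close>
      define D' where "D' i = (if i < n then D i else D 0)" for i
      interpret continuous_distributions D' by standard (use D n in \<open>auto simp: D'_def\<close>)
      have "gamma_opt - \<epsilon> \<le> v - gamma_opt * \<eta>" using \<eta>(2) by (simp add: v_def)
      also have "\<dots> \<le> v * (1 - \<eta>)"
        using v(3) \<eta>(1) by (simp add: right_diff_distrib mult_right_mono)
      also have "\<dots> \<le> v * (1 - 2 * real K * exp (- 2 * real N / (real K)\<^sup>2))"
        using N(2) v(1) by (intro mult_left_mono) auto
      also have "\<dots> \<le> success_prob n N D' (sampling_algorithm n N)"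
        by (rule success_probability_ge[OF n N(1) K1 v(1,2)])
      also have "\<dots> = success_prob n N D (sampling_algorithm n N)"
        by (rule success_prob_cong) (simp add: D'_def)
      finally show ?thesis .
    qed
    then show ?thesis by blast
  qed
  then obtain N where N: "\<And>\<epsilon> n D. \<epsilon> > 0 \<Longrightarrow> n \<ge> 1 \<Longrightarrow> \<forall>i<n. continuous_distribution (D i) \<Longrightarrow>
      gamma_opt - \<epsilon> \<le> success_prob n (N \<epsilon>) D (sampling_algorithm n (N \<epsilon>))"
    by metis
  show ?thesis
  proof (intro exI[of _ N] ballI allI impI)
    fix \<epsilon> :: real and n :: nat
    assume "\<epsilon> \<in> {0<..<1}" "n \<ge> 1"
    then show "\<exists>A. secretary_algorithm n (N \<epsilon>) A \<and>
      (\<forall>D :: nat \<Rightarrow> real measure. (\<forall>i<n. continuous_distribution (D i)) \<longrightarrow>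
         success_prob n (N \<epsilon>) D A \<ge> gamma_opt - \<epsilon>)"
      using N by (intro exI[of _ "sampling_algorithm n (N \<epsilon>)"] conjI secretary_algorithm_sampling) auto
  qed
qed

end
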